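(* Let $K$ be a field, $\overline{K}$ an algebraic closure of $K$ and $v$ a valuation on $\overline{K}$ such that $(K,v)$ is Henselian. Let $L/K$, with $L\subseteq\overline{K}$, be a finite simple field extension such that $(L/K,v)$ is defectless, $vL/vK$ is a cyclic group and $Lv/Kv$ is a separable extension. Then $\operatorname{depth}(L/K,v)\le 2$.
   Context: **Notation.** Valuations are written additively, with arbitrary ordered abelian value groups. For a subfield $F\subseteq\overline{K}$, $vF$ and $Fv$ are the value group and residue field of $(F,v)$. Put $e(L/K)=(vL:vK)$, $f(L/K)=[Lv:Kv]$. For $(K,v)$ Henselian, $[L:K]=e(L/K)f(L/K)d(L/K)$ with $d(L/K)$ the defect; defectless means $d(L/K)=1$. **Valuations on $K[x]$.** Put $\Gamma=v\overline{K}$ and $\Gamma_\infty=\Gamma\cup\{\infty\}$. For $\theta\in\overline{K}$, define $v_\theta\colon K[x]\to\Gamma_\infty$ by $v_\theta(f)=v(f(\theta))$. Let $\mathcal{T}(\Gamma)$ be the set of all valuations $\mu\colon K[x]\to\Gamma_\infty$ with $\mu_{|K}=v_{|K}$ (the value $\infty$ on nonzero polynomials is allowed; $\operatorname{supp}(\mu)=\mu^{-1}(\infty)$ is a prime ideal). **Key polynomials.** For $\mu\in\mathcal{T}(\Gamma)$ let $\Gamma_\mu$ be its value group and $\mathcal{G}_\mu=\bigoplus_{\epsilon\in\Gamma_\mu}\mathcal{P}_\epsilon/\mathcal{P}_\epsilon^+$ its graded algebra, where $\mathcal{P}_\epsilon=\{f\in K[x]\mid\mu(f)\ge\epsilon\}$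 and $\mathcal{P}^+_\epsilon=\{f\in K[x]\mid\mu(f)>\epsilon\}$. For $f\notin\operatorname{supp}(\mu)$, $\operatorname{in}_\mu f$ is the image of $f$ in $\mathcal{P}_{\mu(f)}/\mathcal{P}^+_{\mu(f)}$. A monic $\phi\in K[x]$ is a key polynomial for $\mu$ if $(\operatorname{in}_\mu\phi)\mathcal{G}_\mu$ is a homogeneous prime ideal containing no $\operatorname{in}_\mu f$ with $\deg f<\deg\phi$. The set of key polynomials is $\operatorname{KP}(\mu)$; the degree of $\mu$ is the minimal degree of its key polynomials. **Ordinary augmentation.** For $\phi\in\operatorname{KP}(\mu)$ and $\gamma\in\Gamma_\infty$, $\gamma>\mu(\phi)$, the valuation $[\mu;\phi,\gamma]$ is defined on $\phi$-expansions by $\sum_n a_n\phi^n\mapsto\min_n\{\mu(a_n)+n\gamma\}$ ($\deg a_n<\deg\phi$). **Limit augmentation.** Let $\mathcal{A}=(\rho_i)_{i\in I}$ be a family in $\mathcal{T}(\Gamma)$ indexed by a totally ordered set $I$ with a least element $0$ and no maximal element, such that $\rho_0=\mu$ and, for all $i<j$, $\rho_j=[\rho_i;\chi_j,\beta_j]$ is an ordinary augmentation with $\beta_j\in\Gamma$, where all $\chi_j$ have the same degree. A polynomial $f$ is $\mathcal{A}$-stable if $\rho_i(f)$ is eventually constant; the eventual value is denoted $\rho_{\mathcal{A}}(f)$. A limit key polynomial for $\mathcal{A}$ is a monic $\mathcal{A}$-unstable polynomial $\phi$ of minimal degree among the unstable ones. For $\gamma\in\Gamma_\infty$ with $\gamma>\rho_i(\phi)$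 for all $i$, the limit augmentation $[\mathcal{A};\phi,\gamma]$ of $\mu$ is $\sum_n a_n\phi^n\mapsto\min_n\{\rho_{\mathcal{A}}(a_n)+n\gamma\}$ ($\deg a_n<\deg\phi$). **MLV chains and depth.** A Mac Lane--Vaquié (MLV) chain of $v_\theta$ of length $r$ is a chain $$v\xrightarrow{\phi_0,\gamma_0}\mu_0\xrightarrow{\phi_1,\gamma_1}\mu_1\to\cdots\xrightarrow{\phi_r,\gamma_r}\mu_r=v_\theta$$ in which: $\phi_0$ is monic of degree one and $\mu_0(\sum_n a_n\phi_0^n)=\min_n\{v(a_n)+n\gamma_0\}$ for $a_n\in K$; each $\mu_{n-1}\to\mu_n$ ($1\le n\le r$) is either an ordinary augmentation $\mu_n=[\mu_{n-1};\phi_n,\gamma_n]$ with $\phi_n\in \operatorname{KP}(\mu_{n-1})$, or a limit augmentation $\mu_n=[\mathcal{A}_n;\phi_n,\gamma_n]$, where $\mathcal{A}_n=(\rho_i)_{i\in I}$ is a family in $\mathcal{T}(\Gamma)$ indexed by a totally ordered set $I$ with a least element $0$ and no maximal element, with first valuation $\rho_0=\mu_{n-1}$ and such that, for all $i<j$, $\rho_j=[\rho_i;\chi_j,\beta_j]$ is an ordinary augmentation with $\beta_j\in\Gamma$ and all $\chi_j$ of the same degree, $\phi_n$ is a limit key polynomial for $\mathcal{A}_n$, and $\gamma_n>\rho_i(\phi_n)$ for all $i\in I$; $\gamma_0,\dots,\gamma_{r-1}\in\Gamma$, $\gamma_r=\infty$, and $\phi_r$ is the minimal polynomial of $\theta$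 over $K$; $1=\deg\phi_0<\cdots<\deg\phi_r$; and if $\mu_{n-1}\to\mu_n$ is a limit augmentation, then $v_\theta(\phi_{n-1})=\gamma_{n-1}$ and all valuations in $\mathcal{A}_n$ have degree equal to $\deg\phi_{n-1}$. It is a known theorem (Mac Lane, Vaquié, Nart) that $v_\theta$ admits MLV chains and all of them have the same length; this common length is $\operatorname{depth}(\theta)=\operatorname{depth}(v_\theta)$. **Depth of an extension.** For a finite simple extension $L/K$, $L\subseteq\overline{K}$, $\operatorname{depth}(L/K,v):=\min\{\operatorname{depth}(\theta)\mid L=K(\theta)\}$. *)

theory Defs
  imports
    "HOL-Algebra.Algebra"
    "HOL-Algebra.Algebraic_Closure_Type"
begin

section \<open>Values in an ordered group with a top element\<close>

datatype 'g vinf = Fin 'g | Infty (\<open>\<infinity>\<close>)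

instantiation vinf :: (linordered_ab_group_add) linorder
begin

fun less_eq_vinf :: "'a vinf \<Rightarrow> 'a vinf \<Rightarrow> bool" where
  "x \<le> \<infinity> \<longleftrightarrow> True"
| "\<infinity> \<le> Fin b \<longleftrightarrow> False"
| "Fin a \<le> Fin b \<longleftrightarrow> a \<le> b"

definition less_vinf :: "'a vinf \<Rightarrow> 'a vinf \<Rightarrow> bool" where
  "x < y \<longleftrightarrow> x \<le> y \<and> \<not> y \<le> x" for x y :: "'a vinf"

instance
proof
  fix x y z :: "'a vinf"
  show "x < y \<longleftrightarrow> x \<le> y \<and> \<not> y \<le> x" by (fact less_vinf_def)
  show "x \<le> x" by (cases x) auto
  show "x \<le> y \<Longrightarrow> y \<le> z \<Longrightarrow> x \<le> z" by (cases x; cases y; cases z) auto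
  show "x \<le> y \<Longrightarrow> y \<le> x \<Longrightarrow> x = y" by (cases x; cases y) auto
  show "x \<le> y \<or> y \<le> x" by (cases x; cases y) auto
qed

end

instantiation vinf :: (linordered_ab_group_add) comm_monoid_add
begin

definition zero_vinf :: "'a vinf" where "0 = Fin 0"

fun plus_vinf :: "'a vinf \<Rightarrow> 'a vinf \<Rightarrow> 'a vinf" where
  "Fin a + Fin b = Fin (a + b)"
| "\<infinity> + y = \<infinity>"
| "x + \<infinity> = \<infinity>"

instance
proof
  fix x y z :: "'a vinf"
  show "(x + y) + z = x + (y + z)" by (cases x; cases y; cases z) (auto simp: add.assoc)
  show "x + y = y + x" by (cases x; cases y) (auto simp: add.commute)
  show "0 + x = x" by (cases x) (auto simp: zero_vinf_def)
qed

end

abbreviation nat_times :: "nat \<Rightarrow> 'g::linordered_ab_group_add vinf \<Rightarrow> 'g vinf"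
    (infixr \<open>\<cdot>\<close> 75)
  where "n \<cdot> \<gamma> \<equiv> (\<Sum>i<n. \<gamma>)"


section \<open>The field \<open>K\<close>, its algebraic closure and the valuation\<close>

text \<open>
  The field \<open>K\<close> is a type \<open>'k\<close>, its algebraic closure a type \<open>'a\<close>, and the inclusion of \<open>K\<close> is a
  map \<open>\<iota>\<close>. Fields between \<open>K\<close> and its closure are sets of type \<open>'a set\<close>; \<open>K\<close> itself, seen as
  such a set, is \<open>range \<iota>\<close>. The ring \<open>K[x]\<close> is the type \<open>'k poly\<close>.
\<close>

abbreviation closure_ring :: "'a::field ring" (\<open>\<Omega>\<close>)
  where "\<Omega> \<equiv> ring_of_type_algebra"

definition is_algebraic_closure :: "('k::field \<Rightarrow> 'a::alg_closed_field) \<Rightarrow> bool" where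
  "is_algebraic_closure \<iota> \<longleftrightarrow>
     \<iota> \<in> ring_hom ring_of_type_algebra \<Omega> \<and>
     (\<forall>x. \<exists>p. p \<noteq> 0 \<and> poly (map_poly \<iota> p) x = 0)"

definition is_valuation :: "('a::field \<Rightarrow> 'g::linordered_ab_group_add vinf) \<Rightarrow> bool" where
  "is_valuation v \<longleftrightarrow>
     (\<forall>x. v x = \<infinity> \<longleftrightarrow> x = 0) \<and>
     (\<forall>x y. v (x * y) = v x + v y) \<and>
     (\<forall>x y. min (v x) (v y) \<le> v (x + y))"

definition valuation_ring :: "('a::field \<Rightarrow> 'g::linordered_ab_group_add vinf) \<Rightarrow> 'a set" where
  "valuation_ring v = {x. 0 \<le> v x}"

definition is_valuation_ring :: "'a::field set \<Rightarrow> bool" where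
  "is_valuation_ring B \<longleftrightarrow> subring B \<Omega> \<and> (\<forall>x. x \<in> B \<or> inverse x \<in> B)"

text \<open>
  Henselian: the restriction of \<open>v\<close> to \<open>K\<close> extends uniquely to the algebraic closure.
  As extensions may take values in any ordered group and are considered up to equivalence,
  uniqueness is stated for the valuation rings.
\<close>
definition henselian ::
    "('k::field \<Rightarrow> 'a::alg_closed_field) \<Rightarrow> ('a \<Rightarrow> 'g::linordered_ab_group_add vinf) \<Rightarrow> bool" where
  "henselian \<iota> v \<longleftrightarrow>
     (\<forall>B. is_valuation_ring B \<and> B \<inter> range \<iota> = valuation_ring v \<inter> range \<iota> \<longrightarrow>
          B = valuation_ring v)"


section \<open>Value groups, residue fields, ramification and defect\<close>

definition value_group :: "('a::field \<Rightarrow> 'g::linordered_ab_group_add vinf) \<Rightarrow> 'a set \<Rightarrow> 'g set" where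
  "value_group v F = {g. \<exists>x\<in>F. v x = Fin g}"

definition value_quotient ::
    "('a::field \<Rightarrow> 'g::linordered_ab_group_add vinf) \<Rightarrow> 'a set \<Rightarrow> 'a set \<Rightarrow> 'g set monoid" where
  "value_quotient v L K =
     \<lparr>carrier = value_group v L, monoid.mult = (+), one = 0\<rparr> Mod value_group v K"

definition ramification_index ::
    "('a::field \<Rightarrow> 'g::linordered_ab_group_add vinf) \<Rightarrow> 'a set \<Rightarrow> 'a set \<Rightarrow> nat" where
  "ramification_index v L K = Coset.order (value_quotient v L K)"

definition residue_ring :: "('a::field \<Rightarrow> 'g::linordered_ab_group_add vinf) \<Rightarrow> 'a set ring" where
  "residue_ring v = (\<Omega>\<lparr>carrier := valuation_ring v\<rparr>) Quot {x. 0 < v x}"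

text \<open>
  The residue field \<open>Fv\<close> of a subfield \<open>F\<close>, as a subfield of the residue field of the closure.
\<close>
definition residue_field ::
    "('a::field \<Rightarrow> 'g::linordered_ab_group_add vinf) \<Rightarrow> 'a set \<Rightarrow> 'a set set" where
  "residue_field v F =
     (\<lambda>x. {x. 0 < v x} +>\<^bsub>\<Omega>\<lparr>carrier := valuation_ring v\<rparr>\<^esub> x) ` (F \<inter> valuation_ring v)"

definition inertia_degree ::
    "('a::field \<Rightarrow> 'g::linordered_ab_group_add vinf) \<Rightarrow> 'a set \<Rightarrow> 'a set \<Rightarrow> nat" where
  "inertia_degree v L K = ring.dim (residue_ring v) (residue_field v K) (residue_field v L)"

text \<open>The defect, defined by \<open>[L:K] = e(L/K) f(L/K) d(L/K)\<close>.\<close>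
definition defect ::
    "('a::field \<Rightarrow> 'g::linordered_ab_group_add vinf) \<Rightarrow> 'a set \<Rightarrow> 'a set \<Rightarrow> rat" where
  "defect v L K =
     of_nat (ring.dim \<Omega> K L) / of_nat (ramification_index v L K * inertia_degree v L K)"

definition defectless ::
    "('a::field \<Rightarrow> 'g::linordered_ab_group_add vinf) \<Rightarrow> 'a set \<Rightarrow> 'a set \<Rightarrow> bool" where
  "defectless v L K \<longleftrightarrow> defect v L K = 1"

text \<open>
  An algebraic extension \<open>E/F\<close> inside a field \<open>R\<close> is separable if the minimal polynomial over
  \<open>F\<close> of every element of \<open>E\<close> has only simple roots in an algebraic closure of \<open>F\<close>. In the
  definition \<open>R\<close> itself must contain all these roots; this is the case below, the residue field of
  an algebraically closed field being algebraically closed.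
\<close>
definition separable_extension_in :: "'b ring \<Rightarrow> 'b set \<Rightarrow> 'b set \<Rightarrow> bool" where
  "separable_extension_in R F E \<longleftrightarrow>
     (\<forall>a\<in>E. ring.algebraic R F a \<and>
            (\<forall>b\<in>carrier R. ring.alg_mult R (ring.Irr R F a) b \<le> 1))"


section \<open>Valuations on \<open>K[x]\<close>\<close>

definition eval_valuation ::
    "('k::field \<Rightarrow> 'a::field) \<Rightarrow> ('a \<Rightarrow> 'g::linordered_ab_group_add vinf) \<Rightarrow> 'a \<Rightarrow> 'k poly \<Rightarrow> 'g vinf" where
  "eval_valuation \<iota> v \<theta> f = v (poly (map_poly \<iota> f) \<theta>)"

text \<open>The set \<open>\<T>(\<Gamma>)\<close>, where \<open>\<Gamma> = value_group v UNIV\<close>.\<close>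
definition poly_valuations ::
    "('k::field \<Rightarrow> 'a::field) \<Rightarrow> ('a \<Rightarrow> 'g::linordered_ab_group_add vinf) \<Rightarrow> ('k poly \<Rightarrow> 'g vinf) set" where
  "poly_valuations \<iota> v =
     {\<mu>. range \<mu> \<subseteq> insert \<infinity> (Fin ` value_group v UNIV) \<and>
         (\<forall>f g. \<mu> (f * g) = \<mu> f + \<mu> g) \<and>
         (\<forall>f g. min (\<mu> f) (\<mu> g) \<le> \<mu> (f + g)) \<and>
         (\<forall>c. \<mu> [:c:] = v (\<iota> c))}"


section \<open>The graded algebra and key polynomials\<close>

text \<open>
  The support of \<open>\<mu>\<close> may be nonzero, and \<open>K[x]\<close> modulo the support is only a domain: the value group
  of \<open>\<mu>\<close> is that of the induced valuation on its fraction field.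
\<close>
definition poly_value_group ::
    "('k::field poly \<Rightarrow> 'g::linordered_ab_group_add vinf) \<Rightarrow> 'g set" where
  "poly_value_group \<mu> = {a - b | a b. Fin a \<in> range \<mu> \<and> Fin b \<in> range \<mu>}"

definition graded_ge :: "('k::field poly \<Rightarrow> 'g::linordered_ab_group_add vinf) \<Rightarrow> 'g \<Rightarrow> 'k poly set" where
  "graded_ge \<mu> \<epsilon> = {f. Fin \<epsilon> \<le> \<mu> f}"

definition graded_gt :: "('k::field poly \<Rightarrow> 'g::linordered_ab_group_add vinf) \<Rightarrow> 'g \<Rightarrow> 'k poly set" where
  "graded_gt \<mu> \<epsilon> = {f. Fin \<epsilon> < \<mu> f}"

definition graded_class ::
    "('k::field poly \<Rightarrow> 'g::linordered_ab_group_add vinf) \<Rightarrow> 'g \<Rightarrow> 'k poly \<Rightarrow> 'k poly set" where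
  "graded_class \<mu> \<epsilon> f = (+) f ` graded_gt \<mu> \<epsilon>"

abbreviation repr :: "'b set \<Rightarrow> 'b" where "repr A \<equiv> SOME f. f \<in> A"

text \<open>
  The direct sum \<open>\<Oplus> P\<^sub>\<epsilon> / P\<^sub>\<epsilon>\<^sup>+\<close> over the value group: an element is a family of cosets of which all
  but finitely many are the zero coset \<open>P\<^sub>\<epsilon>\<^sup>+\<close>. Sums and products of cosets are computed with
  representatives, on which they do not depend; the product has the component
  \<open>\<Sum>\<^sub>\<delta> F\<^sub>\<delta> G\<^sub>\<epsilon>\<^sub>-\<^sub>\<delta>\<close> in degree \<open>\<epsilon>\<close>.
\<close>
definition graded_algebra ::
    "('k::field poly \<Rightarrow> 'g::linordered_ab_group_add vinf) \<Rightarrow> ('g \<Rightarrow> 'k poly set) ring" where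
  "graded_algebra \<mu> =
     \<lparr>carrier = {F \<in> \<Pi>\<^sub>E \<epsilon>\<in>poly_value_group \<mu>. graded_class \<mu> \<epsilon> ` graded_ge \<mu> \<epsilon>.
                   finite {\<epsilon> \<in> poly_value_group \<mu>. F \<epsilon> \<noteq> graded_gt \<mu> \<epsilon>}},
      monoid.mult = (\<lambda>F G. \<lambda>\<epsilon>\<in>poly_value_group \<mu>. graded_class \<mu> \<epsilon>
         (\<Sum>\<delta> \<in> {\<delta> \<in> poly_value_group \<mu>. F \<delta> \<noteq> graded_gt \<mu> \<delta>}. repr (F \<delta>) * repr (G (\<epsilon> - \<delta>)))),
      one = (\<lambda>\<epsilon>\<in>poly_value_group \<mu>. graded_class \<mu> \<epsilon> (if \<epsilon> = 0 then 1 else 0)),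
      ring.zero = (\<lambda>\<epsilon>\<in>poly_value_group \<mu>. graded_gt \<mu> \<epsilon>),
      ring.add = (\<lambda>F G. \<lambda>\<epsilon>\<in>poly_value_group \<mu>. graded_class \<mu> \<epsilon> (repr (F \<epsilon>) + repr (G \<epsilon>)))\<rparr>"

definition graded_component ::
    "('k::field poly \<Rightarrow> 'g::linordered_ab_group_add vinf) \<Rightarrow> 'g \<Rightarrow> ('g \<Rightarrow> 'k poly set) \<Rightarrow> 'g \<Rightarrow> 'k poly set" where
  "graded_component \<mu> \<delta> F =
     (\<lambda>\<epsilon>\<in>poly_value_group \<mu>. if \<epsilon> = \<delta> then F \<epsilon> else graded_gt \<mu> \<epsilon>)"

definition homogeneous_set ::
    "('k::field poly \<Rightarrow> 'g::linordered_ab_group_add vinf) \<Rightarrow> ('g \<Rightarrow> 'k poly set) set \<Rightarrow> bool" where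
  "homogeneous_set \<mu> J \<longleftrightarrow> (\<forall>F\<in>J. \<forall>\<delta>\<in>poly_value_group \<mu>. graded_component \<mu> \<delta> F \<in> J)"

text \<open>Only meaningful for \<open>f\<close> outside the support of \<open>\<mu>\<close>.\<close>
definition initial_form ::
    "('k::field poly \<Rightarrow> 'g::linordered_ab_group_add vinf) \<Rightarrow> 'k poly \<Rightarrow> 'g \<Rightarrow> 'k poly set" where
  "initial_form \<mu> f = (\<lambda>\<epsilon>\<in>poly_value_group \<mu>. graded_class \<mu> \<epsilon> (if \<mu> f = Fin \<epsilon> then f else 0))"

definition key_polynomials ::
    "('k::field poly \<Rightarrow> 'g::linordered_ab_group_add vinf) \<Rightarrow> 'k poly set" where
  "key_polynomials \<mu> =
     {\<phi>. Polynomial.lead_coeff \<phi> = 1 \<and> \<mu> \<phi> \<noteq> \<infinity> \<and>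
         (let J = PIdl\<^bsub>graded_algebra \<mu>\<^esub> (initial_form \<mu> \<phi>) in
            primeideal J (graded_algebra \<mu>) \<and> homogeneous_set \<mu> J \<and>
            (\<forall>f. \<mu> f \<noteq> \<infinity> \<and> Polynomial.degree f < Polynomial.degree \<phi> \<longrightarrow>
                 initial_form \<mu> f \<notin> J))}"

definition valuation_degree ::
    "('k::field poly \<Rightarrow> 'g::linordered_ab_group_add vinf) \<Rightarrow> nat" where
  "valuation_degree \<mu> = (LEAST d. \<exists>\<phi>\<in>key_polynomials \<mu>. Polynomial.degree \<phi> = d)"


section \<open>Augmentations\<close>

text \<open>\<open>\<mu>\<close> is the map \<open>\<Sum>\<^sub>n a\<^sub>n \<phi>\<^sup>n \<mapsto> min\<^sub>n {w(a\<^sub>n) + n\<gamma>}\<close> on \<open>\<phi>\<close>-expansions.\<close>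
definition defined_on_expansions ::
    "('k::field poly \<Rightarrow> 'g::linordered_ab_group_add vinf) \<Rightarrow> 'k poly \<Rightarrow> 'g vinf \<Rightarrow>
     ('k poly \<Rightarrow> 'g vinf) \<Rightarrow> bool" where
  "defined_on_expansions w \<phi> \<gamma> \<mu> \<longleftrightarrow>
     (\<forall>a N. (\<forall>n\<le>N. Polynomial.degree (a n) < Polynomial.degree \<phi>) \<longrightarrow>
        \<mu> (\<Sum>n\<le>N. a n * \<phi> ^ n) = Min ((\<lambda>n. w (a n) + n \<cdot> \<gamma>) ` {..N}))"

text \<open>\<open>\<mu>' = [\<mu>; \<phi>, \<gamma>]\<close>.\<close>
definition ordinary_augmentation ::
    "('k::field poly \<Rightarrow> 'g::linordered_ab_group_add vinf) \<Rightarrow> 'k poly \<Rightarrow> 'g vinf \<Rightarrow>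
     ('k poly \<Rightarrow> 'g vinf) \<Rightarrow> bool" where
  "ordinary_augmentation \<mu> \<phi> \<gamma> \<mu>' \<longleftrightarrow>
     \<phi> \<in> key_polynomials \<mu> \<and> \<mu> \<phi> < \<gamma> \<and> defined_on_expansions \<mu> \<phi> \<gamma> \<mu>'"

text \<open>
  The families \<open>(\<rho>\<^sub>i)\<close>, \<open>i \<in> I\<close>, with \<open>r\<close> the strict order of \<open>I\<close> and \<open>z\<close> its least element.
\<close>
definition augmentation_family ::
    "('k::field \<Rightarrow> 'a::field) \<Rightarrow> ('a \<Rightarrow> 'g::linordered_ab_group_add vinf) \<Rightarrow> 'i set \<Rightarrow> 'i rel \<Rightarrow> 'i \<Rightarrow>
     ('i \<Rightarrow> 'k poly \<Rightarrow> 'g vinf) \<Rightarrow> bool" where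
  "augmentation_family \<iota> v I r z \<rho> \<longleftrightarrow>
     strict_linear_order_on I r \<and>
     z \<in> I \<and> (\<forall>i\<in>I. i \<noteq> z \<longrightarrow> (z, i) \<in> r) \<and>
     (\<forall>i\<in>I. \<exists>j\<in>I. (i, j) \<in> r) \<and>
     (\<forall>i\<in>I. \<rho> i \<in> poly_valuations \<iota> v) \<and>
     (\<exists>\<chi> \<beta> m. \<forall>i\<in>I. \<forall>j\<in>I. (i, j) \<in> r \<longrightarrow>
        \<beta> j \<in> value_group v UNIV \<and> Polynomial.degree (\<chi> j) = m \<and>
        ordinary_augmentation (\<rho> i) (\<chi> j) (Fin (\<beta> j)) (\<rho> j))"

definition eventual_value ::
    "'i set \<Rightarrow> 'i rel \<Rightarrow> ('i \<Rightarrow> 'k::field poly \<Rightarrow> 'g vinf) \<Rightarrow> 'k poly \<Rightarrow> 'g vinf \<Rightarrow> bool" where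
  "eventual_value I r \<rho> f c \<longleftrightarrow> (\<exists>i\<^sub>0\<in>I. \<forall>i\<in>I. (i\<^sub>0, i) \<in> r \<longrightarrow> \<rho> i f = c)"

definition stable :: "'i set \<Rightarrow> 'i rel \<Rightarrow> ('i \<Rightarrow> 'k::field poly \<Rightarrow> 'g vinf) \<Rightarrow> 'k poly \<Rightarrow> bool" where
  "stable I r \<rho> f \<longleftrightarrow> (\<exists>c. eventual_value I r \<rho> f c)"

definition stable_value ::
    "'i set \<Rightarrow> 'i rel \<Rightarrow> ('i \<Rightarrow> 'k::field poly \<Rightarrow> 'g vinf) \<Rightarrow> 'k poly \<Rightarrow> 'g vinf" where
  "stable_value I r \<rho> f = (THE c. eventual_value I r \<rho> f c)"

definition limit_key_polynomial ::
    "'i set \<Rightarrow> 'i rel \<Rightarrow> ('i \<Rightarrow> 'k::field poly \<Rightarrow> 'g vinf) \<Rightarrow> 'k poly \<Rightarrow> bool" where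
  "limit_key_polynomial I r \<rho> \<phi> \<longleftrightarrow>
     Polynomial.lead_coeff \<phi> = 1 \<and> \<not> stable I r \<rho> \<phi> \<and>
     (\<forall>f. \<not> stable I r \<rho> f \<longrightarrow> Polynomial.degree \<phi> \<le> Polynomial.degree f)"

text \<open>\<open>\<mu>' = [\<A>; \<phi>, \<gamma>]\<close> for the family \<open>\<A> = (\<rho>\<^sub>i)\<close>, which is a limit augmentation of \<open>\<rho>\<^sub>z\<close>.\<close>
definition limit_augmentation ::
    "('k::field \<Rightarrow> 'a::field) \<Rightarrow> ('a \<Rightarrow> 'g::linordered_ab_group_add vinf) \<Rightarrow> 'i set \<Rightarrow> 'i rel \<Rightarrow> 'i \<Rightarrow>
     ('i \<Rightarrow> 'k poly \<Rightarrow> 'g vinf) \<Rightarrow> 'k poly \<Rightarrow> 'g vinf \<Rightarrow> ('k poly \<Rightarrow> 'g vinf) \<Rightarrow> bool" where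
  "limit_augmentation \<iota> v I r z \<rho> \<phi> \<gamma> \<mu>' \<longleftrightarrow>
     augmentation_family \<iota> v I r z \<rho> \<and> limit_key_polynomial I r \<rho> \<phi> \<and>
     (\<forall>i\<in>I. \<rho> i \<phi> < \<gamma>) \<and> defined_on_expansions (stable_value I r \<rho>) \<phi> \<gamma> \<mu>'"


section \<open>MLV chains and depth\<close>

definition is_minimal_polynomial :: "('k::field \<Rightarrow> 'a::field) \<Rightarrow> 'a \<Rightarrow> 'k poly \<Rightarrow> bool" where
  "is_minimal_polynomial \<iota> \<theta> p \<longleftrightarrow>
     Polynomial.lead_coeff p = 1 \<and> Factorial_Ring.irreducible p \<and> poly (map_poly \<iota> p) \<theta> = 0"

text \<open>
  In a limit step the index set may be any totally ordered set. It is taken as a set of elements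
  of the type of maps from \<open>K[x]\<close> to the values, which loses no family: \<open>i \<mapsto> \<rho>\<^sub>i\<close> is injective because
  \<open>\<rho>\<^sub>i(\<chi>\<^sub>j) < \<beta>\<^sub>j = \<rho>\<^sub>j(\<chi>\<^sub>j)\<close> for \<open>i < j\<close>, so that every family can be reindexed by its own members.
  A \<open>\<phi>\<^sub>0\<close>-expansion has constant coefficients, and on these the first valuation is given by \<open>v\<close>.
\<close>
definition mlv_chain ::
    "('k::field \<Rightarrow> 'a::field) \<Rightarrow> ('a \<Rightarrow> 'g::linordered_ab_group_add vinf) \<Rightarrow> 'a \<Rightarrow> nat \<Rightarrow>
     (nat \<Rightarrow> 'k poly \<Rightarrow> 'g vinf) \<Rightarrow> (nat \<Rightarrow> 'k poly) \<Rightarrow> (nat \<Rightarrow> 'g vinf) \<Rightarrow> bool" where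
  "mlv_chain \<iota> v \<theta> r \<mu> \<phi> \<gamma> \<longleftrightarrow>
     (\<forall>n\<le>r. \<mu> n \<in> poly_valuations \<iota> v) \<and>
     Polynomial.lead_coeff (\<phi> 0) = 1 \<and> Polynomial.degree (\<phi> 0) = 1 \<and>
     defined_on_expansions (\<lambda>a. v (\<iota> (poly.coeff a 0))) (\<phi> 0) (\<gamma> 0) (\<mu> 0) \<and>
     (\<forall>n<r.
        ordinary_augmentation (\<mu> n) (\<phi> (Suc n)) (\<gamma> (Suc n)) (\<mu> (Suc n)) \<or>
        (\<exists>(I :: ('k poly \<Rightarrow> 'g vinf) set) R z \<rho>.
           \<rho> z = \<mu> n \<and>
           limit_augmentation \<iota> v I R z \<rho> (\<phi> (Suc n)) (\<gamma> (Suc n)) (\<mu> (Suc n)) \<and>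
           eval_valuation \<iota> v \<theta> (\<phi> n) = \<gamma> n \<and>
           (\<forall>i\<in>I. valuation_degree (\<rho> i) = Polynomial.degree (\<phi> n)))) \<and>
     (\<forall>n<r. \<gamma> n \<in> Fin ` value_group v UNIV) \<and> \<gamma> r = \<infinity> \<and>
     is_minimal_polynomial \<iota> \<theta> (\<phi> r) \<and>
     (\<forall>n<r. Polynomial.degree (\<phi> n) < Polynomial.degree (\<phi> (Suc n))) \<and>
     \<mu> r = eval_valuation \<iota> v \<theta>"

text \<open>The common length of all MLV chains of \<open>v\<^sub>\<theta>\<close>.\<close>
definition depth ::
    "('k::field \<Rightarrow> 'a::field) \<Rightarrow> ('a \<Rightarrow> 'g::linordered_ab_group_add vinf) \<Rightarrow> 'a \<Rightarrow> nat" where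
  "depth \<iota> v \<theta> = (THE r. \<exists>\<mu> \<phi> \<gamma>. mlv_chain \<iota> v \<theta> r \<mu> \<phi> \<gamma>)"

definition adjoin :: "('k::field \<Rightarrow> 'a::field) \<Rightarrow> 'a \<Rightarrow> 'a set" where
  "adjoin \<iota> \<theta> = generate_field \<Omega> (insert \<theta> (range \<iota>))"

definition finite_simple_extension :: "('k::field \<Rightarrow> 'a::field) \<Rightarrow> 'a set \<Rightarrow> bool" where
  "finite_simple_extension \<iota> L \<longleftrightarrow>
     (\<exists>\<theta>. L = adjoin \<iota> \<theta>) \<and> ring.finite_dimension \<Omega> (range \<iota>) L"

definition extension_depth ::
    "('k::field \<Rightarrow> 'a::field) \<Rightarrow> ('a \<Rightarrow> 'g::linordered_ab_group_add vinf) \<Rightarrow> 'a set \<Rightarrow> nat" where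
  "extension_depth \<iota> v L = (LEAST d. \<exists>\<theta>. L = adjoin \<iota> \<theta> \<and> d = depth \<iota> v \<theta>)"

end

theory Submission
  imports Defs "HOL-Library.Poly_Mapping"
begin

text \<open>
  By the primitive element theorem for \<open>Lv/Kv\<close> and Hensel's lemma there is \<open>\<eta> \<in> L\<close> that is a root of a
  monic lift \<open>\<phi>\<close> of the minimal polynomial of a generator of \<open>Lv/Kv\<close>. Let \<open>\<pi> \<in> L\<close> have a value \<open>\<delta> > 0\<close>
  that generates \<open>vL\<close> modulo \<open>vK\<close>, and put \<open>\<theta> = \<eta> + \<pi>\<close> (\<open>\<theta> = \<eta>\<close> if \<open>vL = vK\<close>). As \<open>v(\<phi>(\<theta>)) = \<delta>\<close>, the
  terms of a \<open>\<phi>\<close>-expansion of length \<open>e\<close> have values in distinct cosets of \<open>vK\<close>; hence the powers of \<open>\<theta>\<close>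
  of exponent less than \<open>ef = [L:K]\<close> are independent and \<open>L = K(\<theta>)\<close>. In degrees less than \<open>ef\<close>, \<open>v\<^sub>\<theta>\<close> agrees
  with the restriction \<open>\<mu>\<^sub>1\<close> to \<open>K[x]\<close> of the monomial valuation of center \<open>\<eta>\<close> and radius \<open>\<delta>\<close>, and \<open>\<mu>\<^sub>1\<close> is
  the augmentation \<open>[\<mu>\<^sub>0; \<phi>, \<delta>]\<close> of the Gauss valuation \<open>\<mu>\<^sub>0\<close>. So \<open>v\<^sub>\<theta>\<close> has a chain of length at most 2.

  That all chains of \<open>v\<^sub>\<theta>\<close> have the same length is seen directly for this \<open>\<theta>\<close>: in each degree less than
  \<open>[L:K]\<close> the value \<open>v\<^sub>\<theta>\<close> attains a maximum on the monic polynomials, which excludes limit augmentations, and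
  in a chain of ordinary augmentations \<open>\<mu>\<^sub>k\<close> and \<open>deg \<phi>\<^sub>k\<^sub>+\<^sub>1\<close> are determined by \<open>v\<^sub>\<theta>\<close>, the latter as the least
  degree in which \<open>\<mu>\<^sub>k\<close> and \<open>v\<^sub>\<theta>\<close> differ.
\<close>

text \<open>The predicate \<open>henselian\<close> asserts only that the extended valuation ring is
  unique, so Hensel's lemma has to be derived. If x is a root near c \<in> L and y satisfies no
  relation over L that x does not satisfy, Chevalley's theorem gives a valuation ring in which y -
  c, if nonzero, is a nonunit; uniqueness identifies it with the ring of v. Conjugates of a root
  near c thus stay near c, and a residually simple root has no others. Separability acts twice: it
  gives the generator of Lv/Kv, and it makes the root \<eta> of \<phi> = (x - \<eta>) Q residually
  simple. The second use yields v(\<phi>(\<theta>)) = \<delta>: Q(\<eta>) is a unit, hence so is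
  Q(\<theta>), and \<theta> - \<eta> = \<pi>. Positivity of \<delta> keeps \<theta> and \<eta>
  residually equal, so that in degrees below deg \<phi> both carry the Gauss valuation. As
  \<open>depth\<close> is a definite description, a short chain says nothing about it before
  uniqueness is known. Key polynomials are defined by a prime ideal of the graded algebra; primality
  is never computed directly but read off from a larger valuation, whose graded algebra is a
  domain.\<close>

hide_const (open) Polynomials.degree Polynomials.lead_coeff

section \<open>Valuations\<close>

lemma less_vinf_simps [simp]:
  "Fin a < Fin b \<longleftrightarrow> a < b" "\<not> \<infinity> < x" "x < \<infinity> \<longleftrightarrow> x \<noteq> \<infinity>"
  for a b :: "'g::linordered_ab_group_add"
  by (cases x; auto simp: less_vinf_def)+

lemma infty_le_iff [simp]: "\<infinity> \<le> x \<longleftrightarrow> x = \<infinity>" for x :: "'g::linordered_ab_group_add vinf"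
  by (cases x) auto

lemma add_infty [simp]: "x + \<infinity> = \<infinity>" for x :: "'g::linordered_ab_group_add vinf"
  by (cases x) auto

lemma add_eq_infty_iff [simp]: "x + y = \<infinity> \<longleftrightarrow> x = \<infinity> \<or> y = \<infinity>"
  for x y :: "'g::linordered_ab_group_add vinf"
  by (cases x; cases y) auto

lemma zero_neq_infty [simp]: "0 \<noteq> (\<infinity> :: 'g::linordered_ab_group_add vinf)" "(\<infinity> :: 'g vinf) \<noteq> 0"
  by (simp_all add: zero_vinf_def)

instance vinf :: (linordered_ab_group_add) ordered_comm_monoid_add
proof
  fix a b c :: "'a vinf"
  show "a \<le> b \<Longrightarrow> c + a \<le> c + b" by (cases a; cases b; cases c) auto
qed

lemma vinf_add_left_cancel [simp]: "c \<noteq> \<infinity> \<Longrightarrow> c + a = c + b \<longleftrightarrow> a = b"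
  for a b c :: "'g::linordered_ab_group_add vinf"
  by (cases a; cases b; cases c) auto

lemma vinf_add_less_cancel [simp]: "c \<noteq> \<infinity> \<Longrightarrow> c + a < c + b \<longleftrightarrow> a < b"
  for a b c :: "'g::linordered_ab_group_add vinf"
  by (cases a; cases b; cases c) auto

lemma vinf_add_strict_mono: "a < b \<Longrightarrow> c \<le> d \<Longrightarrow> c \<noteq> \<infinity> \<Longrightarrow> a + c < b + d"
  for a b c d :: "'g::linordered_ab_group_add vinf"
  by (cases a; cases b; cases c; cases d) (auto intro: add_less_le_mono)

text \<open>If one summand grew and the other did not drop, a finite sum would grow. In
  \<open>mod_value_ge\<close> this turns constancy of a sum of two increasing values into constancy
  of one of them.\<close>

lemma vinf_add_squeeze:
  fixes a b c d :: "'g::linordered_ab_group_add vinf"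
  assumes "a + b = c + d" "a \<le> c" "b \<le> d" "a + b \<noteq> \<infinity>"
  shows "b = d"
proof (rule ccontr)
  assume "b \<noteq> d"
  then have "b + a < d + c" using assms by (intro vinf_add_strict_mono) auto
  then show False using assms by (simp add: add.commute)
qed

lemma Fin_add: "Fin (a + b) = Fin a + Fin b" for a b :: "'g::linordered_ab_group_add"
  by simp

lemma nat_times_Suc: "Suc n \<cdot> x = x + n \<cdot> x" for x :: "'g::linordered_ab_group_add vinf"
  by (simp add: add.commute)

lemma nat_times_add: "(m + n) \<cdot> x = m \<cdot> x + n \<cdot> x" for x :: "'g::linordered_ab_group_add vinf"
  by (induction m) (auto simp: ac_simps simp del: sum.lessThan_Suc simp add: nat_times_Suc)

lemma nat_times_Fin_neq [simp]: "n \<cdot> Fin a \<noteq> \<infinity>" for a :: "'g::linordered_ab_group_add"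
  by (induction n) auto

text \<open>The value \<infinity> is allowed on nonzero elements, so that one locale covers
  \<open>v\<close>, the Gauss valuations and evaluation at \<theta>, whose support contains the
  minimal polynomial of \<theta>.\<close>

locale ring_valuation =
  fixes \<mu> :: "'b::comm_ring_1 \<Rightarrow> 'g::linordered_ab_group_add vinf"
  assumes mult: "\<mu> (x * y) = \<mu> x + \<mu> y"
    and add: "min (\<mu> x) (\<mu> y) \<le> \<mu> (x + y)"
    and zero [simp]: "\<mu> 0 = \<infinity>"
    and one [simp]: "\<mu> 1 = 0"
begin

lemma minus [simp]: "\<mu> (- x) = \<mu> x"
proof -
  have "\<mu> (- 1) + \<mu> (- 1) = 0" by (metis mult one minus_mult_minus mult_1)
  then have "\<mu> (- 1) = 0"
    by (cases "\<mu> (- 1)") (auto simp: zero_vinf_def double_zero)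
  then show ?thesis using mult[of "- 1" x] by simp
qed

lemma diff: "min (\<mu> x) (\<mu> y) \<le> \<mu> (x - y)"
  using add[of x "- y"] by simp

lemma add_ge: "a \<le> \<mu> x \<Longrightarrow> a \<le> \<mu> y \<Longrightarrow> a \<le> \<mu> (x + y)"
  using add[of x y] by (auto simp: min_def split: if_splits)

lemma add_gt: "a < \<mu> x \<Longrightarrow> a < \<mu> y \<Longrightarrow> a < \<mu> (x + y)"
  using add[of x y] by (auto simp: min_def split: if_splits)

lemma diff_ge: "a \<le> \<mu> x \<Longrightarrow> a \<le> \<mu> y \<Longrightarrow> a \<le> \<mu> (x - y)"
  using add_ge[of a x "- y"] by simp

lemma diff_gt: "a < \<mu> x \<Longrightarrow> a < \<mu> y \<Longrightarrow> a < \<mu> (x - y)"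
  using add_gt[of a x "- y"] by simp

lemma diff_commute: "\<mu> (x - y) = \<mu> (y - x)"
  using minus[of "x - y"] by simp

lemma add_eq: "\<mu> x < \<mu> y \<Longrightarrow> \<mu> (x + y) = \<mu> x"
  by (metis add add_diff_cancel_right' diff min_def not_less order_antisym order_less_imp_le)

lemma add_eq': "\<mu> x < \<mu> y \<Longrightarrow> \<mu> (y + x) = \<mu> x"
  using add_eq by (simp add: add.commute)

lemma eq_of_diff_gt: "\<mu> x < \<mu> (x - y) \<Longrightarrow> \<mu> y = \<mu> x"
  using add_eq[of x "y - x"] diff_commute[of x y] by simp

lemma add_neq: "\<mu> x \<noteq> \<mu> y \<Longrightarrow> \<mu> (x + y) = min (\<mu> x) (\<mu> y)"
  using add_eq add_eq' by (metis linorder_neqE min.strict_order_iff min.commute)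

lemma sum_ge: "(\<And>i. i \<in> A \<Longrightarrow> a \<le> \<mu> (f i)) \<Longrightarrow> a \<le> \<mu> (\<Sum>i\<in>A. f i)"
  by (induction A rule: infinite_finite_induct) (auto intro!: add_ge)

lemma sum_gt: "(\<And>i. i \<in> A \<Longrightarrow> a < \<mu> (f i)) \<Longrightarrow> a \<noteq> \<infinity> \<Longrightarrow> a < \<mu> (\<Sum>i\<in>A. f i)"
  by (induction A rule: infinite_finite_induct) (auto intro!: add_gt)

lemma power: "\<mu> (x ^ n) = n \<cdot> \<mu> x"
  by (induction n) (auto simp: mult nat_times_Suc simp del: sum.lessThan_Suc)

end


section \<open>The graded algebra\<close>

abbreviation "lookup \<equiv> Poly_Mapping.lookup"

locale poly_valuation = ring_valuation \<mu> for \<mu> :: "'k::field poly \<Rightarrow> 'g::linordered_ab_group_add vinf"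
begin

abbreviation "\<Gamma> \<equiv> poly_value_group \<mu>"
abbreviation "G \<equiv> graded_algebra \<mu>"

lemma \<Gamma>_value: "\<mu> f = Fin a \<Longrightarrow> a \<in> \<Gamma>"
proof -
  assume "\<mu> f = Fin a"
  then have "Fin a \<in> range \<mu>" "Fin 0 \<in> range \<mu>" by (metis rangeI) (metis rangeI one zero_vinf_def)
  moreover have "a = a - 0" by simp
  ultimately show ?thesis unfolding poly_value_group_def by blast
qed

lemma \<Gamma>_zero: "0 \<in> \<Gamma>" using \<Gamma>_value[of 1 0] by (simp add: zero_vinf_def)

lemma \<Gamma>_diff: "a \<in> \<Gamma> \<Longrightarrow> b \<in> \<Gamma> \<Longrightarrow> a - b \<in> \<Gamma>"
proof -
  assume "a \<in> \<Gamma>" "b \<in> \<Gamma>"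
  then obtain f g h k where *: "a = f - g" "b = h - k" "Fin f \<in> range \<mu>" "Fin g \<in> range \<mu>" "Fin h \<in> range \<mu>" "Fin k \<in> range \<mu>"
    unfolding poly_value_group_def by blast
  then have "Fin (f + k) \<in> range \<mu>" "Fin (g + h) \<in> range \<mu>"
    by (auto simp flip: mult) (metis Fin_add mult rangeI)+
  moreover have "a - b = (f + k) - (g + h)" using * by simp
  ultimately show ?thesis unfolding poly_value_group_def by blast
qed

lemma \<Gamma>_add: "a \<in> \<Gamma> \<Longrightarrow> b \<in> \<Gamma> \<Longrightarrow> a + b \<in> \<Gamma>"
  using \<Gamma>_diff[of a "0 - b"] \<Gamma>_diff[OF \<Gamma>_zero, of b] by simp

lemma graded_class_eq_iff: "graded_class \<mu> \<epsilon> f = graded_class \<mu> \<epsilon> g \<longleftrightarrow> Fin \<epsilon> < \<mu> (f - g)"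
proof
  assume "graded_class \<mu> \<epsilon> f = graded_class \<mu> \<epsilon> g"
  moreover have "f \<in> graded_class \<mu> \<epsilon> f"
    unfolding graded_class_def graded_gt_def by (auto intro!: image_eqI[of _ _ 0])
  ultimately show "Fin \<epsilon> < \<mu> (f - g)" unfolding graded_class_def graded_gt_def by auto
next
  assume *: "Fin \<epsilon> < \<mu> (f - g)"
  have "graded_class \<mu> \<epsilon> f \<subseteq> graded_class \<mu> \<epsilon> g" if "Fin \<epsilon> < \<mu> (f - g)" for f g
  proof
    fix h assume "h \<in> graded_class \<mu> \<epsilon> f"
    then obtain k where "h = f + k" "Fin \<epsilon> < \<mu> k" unfolding graded_class_def graded_gt_def by auto
    then show "h \<in> graded_class \<mu> \<epsilon> g" using add_gt[OF that, of k]
      unfolding graded_class_def graded_gt_def by (auto intro!: image_eqI[of _ _ "f - g + k"])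
  qed
  from this[OF *] this[of g f] show "graded_class \<mu> \<epsilon> f = graded_class \<mu> \<epsilon> g"
    using * diff_commute[of f g] by auto
qed

lemma graded_class_zero: "graded_class \<mu> \<epsilon> 0 = graded_gt \<mu> \<epsilon>"
  unfolding graded_class_def by simp

lemma repr_graded_class: "Fin \<epsilon> < \<mu> (repr (graded_class \<mu> \<epsilon> f) - f)"
proof -
  have "f \<in> graded_class \<mu> \<epsilon> f"
    unfolding graded_class_def graded_gt_def by (auto intro!: image_eqI[of _ _ 0])
  then have "repr (graded_class \<mu> \<epsilon> f) \<in> graded_class \<mu> \<epsilon> f" by (rule someI)
  then show ?thesis unfolding graded_class_def graded_gt_def by auto
qed

lemma repr_ge: "Fin \<epsilon> \<le> \<mu> f \<Longrightarrow> Fin \<epsilon> \<le> \<mu> (repr (graded_class \<mu> \<epsilon> f))"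
  using add_ge[of "Fin \<epsilon>" "repr (graded_class \<mu> \<epsilon> f) - f" f] repr_graded_class[of \<epsilon> f] by simp

text \<open>
  Families of representatives with finite support form a subring of the monoid algebra
  \<open>K[x][\<Gamma>]\<close>, of which the graded algebra is a quotient; the ring axioms are inherited along this map.
\<close>

definition family_ring :: "('g \<Rightarrow>\<^sub>0 'k poly) ring" where
  "family_ring = ring_of_type_algebra\<lparr>carrier := {p. \<forall>\<epsilon>. Fin \<epsilon> \<le> \<mu> (lookup p \<epsilon>) \<and> (\<epsilon> \<notin> \<Gamma> \<longrightarrow> lookup p \<epsilon> = 0)}\<rparr>"

definition graded_of :: "('g \<Rightarrow>\<^sub>0 'k poly) \<Rightarrow> 'g \<Rightarrow> 'k poly set" where
  "graded_of p = (\<lambda>\<epsilon>\<in>\<Gamma>. graded_class \<mu> \<epsilon> (lookup p \<epsilon>))"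

lemma family_carrier: "p \<in> carrier family_ring \<longleftrightarrow>
  (\<forall>\<epsilon>. Fin \<epsilon> \<le> \<mu> (lookup p \<epsilon>) \<and> (\<epsilon> \<notin> \<Gamma> \<longrightarrow> lookup p \<epsilon> = 0))"
  by (simp add: family_ring_def)

lemma family_simps [simp]:
  "p \<otimes>\<^bsub>family_ring\<^esub> q = p * q" "p \<oplus>\<^bsub>family_ring\<^esub> q = p + q" "\<one>\<^bsub>family_ring\<^esub> = 1" "\<zero>\<^bsub>family_ring\<^esub> = 0"
  by (simp_all add: family_ring_def ring_of_type_algebra_def)

text \<open>Exponents form a group, so the convolution is a single sum over the support of the first
  factor. A larger finite set \<open>D\<close> is allowed in order to adjoin an index that is to be
  singled out.\<close>

lemma lookup_times:
  fixes p q :: "'g \<Rightarrow>\<^sub>0 'k poly"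
  assumes "finite D" "Poly_Mapping.keys p \<subseteq> D"
  shows "lookup (p * q) \<epsilon> = (\<Sum>\<delta>\<in>D. lookup p \<delta> * lookup q (\<epsilon> - \<delta>))"
proof -
  have *: "(\<Sum>x. lookup q x when \<epsilon> = \<delta> + x) = lookup q (\<epsilon> - \<delta>)" for \<delta>
  proof -
    have "(\<Sum>x. lookup q x when \<epsilon> = \<delta> + x) = (\<Sum>x. lookup q x when x = \<epsilon> - \<delta>)"
      by (rule Sum_any.cong) (auto simp: algebra_simps when_def)
    then show ?thesis by simp
  qed
  have "lookup (p * q) \<epsilon> = (\<Sum>\<delta>. lookup p \<delta> * lookup q (\<epsilon> - \<delta>))"
    unfolding lookup_mult * ..
  also have "\<dots> = (\<Sum>\<delta>\<in>D. lookup p \<delta> * lookup q (\<epsilon> - \<delta>))"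
    using assms by (intro Sum_any.expand_superset) (auto simp: in_keys_iff)
  finally show ?thesis .
qed

lemma family_single: "Fin \<epsilon> \<le> \<mu> f \<Longrightarrow> \<epsilon> \<in> \<Gamma> \<Longrightarrow> Poly_Mapping.single \<epsilon> f \<in> carrier family_ring"
  by (auto simp: family_carrier lookup_single when_def)

lemma family_mult: 
  assumes "p \<in> carrier family_ring" "q \<in> carrier family_ring"
  shows "p * q \<in> carrier family_ring"
  unfolding family_carrier
proof (intro allI conjI impI)
  fix \<epsilon>
  have *: "lookup (p * q) \<epsilon> = (\<Sum>\<delta>\<in>Poly_Mapping.keys p. lookup p \<delta> * lookup q (\<epsilon> - \<delta>))"
    by (rule lookup_times) auto
  show "Fin \<epsilon> \<le> \<mu> (lookup (p * q) \<epsilon>)"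
    unfolding *
  proof (rule sum_ge)
    fix \<delta>
    have "Fin \<delta> + Fin (\<epsilon> - \<delta>) \<le> \<mu> (lookup p \<delta>) + \<mu> (lookup q (\<epsilon> - \<delta>))"
      using assms unfolding family_carrier by (intro add_mono) auto
    then show "Fin \<epsilon> \<le> \<mu> (lookup p \<delta> * lookup q (\<epsilon> - \<delta>))" by (simp add: mult)
  qed
  assume "\<epsilon> \<notin> \<Gamma>"
  then have "lookup p \<delta> * lookup q (\<epsilon> - \<delta>) = 0" for \<delta>
    using \<Gamma>_add[of \<delta> "\<epsilon> - \<delta>"] assms unfolding family_carrier by fastforce
  then show "lookup (p * q) \<epsilon> = 0" unfolding * by (intro sum.neutral) blast
qed

lemma family_cring: "cring family_ring"
proof -
  interpret M: cring "ring_of_type_algebra :: ('g \<Rightarrow>\<^sub>0 'k poly) ring" by (rule cring_from_type_algebra)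
  let ?M = "ring_of_type_algebra :: ('g \<Rightarrow>\<^sub>0 'k poly) ring"
  have "subcring (carrier family_ring) ?M"
  proof (rule M.subcringI')
    show "subring (carrier family_ring) ?M"
    proof (rule M.subringI)
      show "carrier family_ring \<subseteq> carrier ?M" by (simp add: ring_of_type_algebra_def)
      show "\<one>\<^bsub>?M\<^esub> \<in> carrier family_ring"
        using \<Gamma>_zero by (auto simp: ring_of_type_algebra_def family_carrier lookup_one when_def zero_vinf_def)
    next
      fix p assume p: "p \<in> carrier family_ring"
      have "\<ominus>\<^bsub>?M\<^esub> p = - p"
        by (rule M.minus_equality) (auto simp: ring_of_type_algebra_def)
      then show "\<ominus>\<^bsub>?M\<^esub> p \<in> carrier family_ring" using p by (simp add: family_carrier)
    next
      fix p q assume pq: "p \<in> carrier family_ring" "q \<in> carrier family_ring"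
      then show "p \<otimes>\<^bsub>?M\<^esub> q \<in> carrier family_ring" using family_mult by (simp add: ring_of_type_algebra_def)
      show "p \<oplus>\<^bsub>?M\<^esub> q \<in> carrier family_ring" using pq
        by (auto simp: ring_of_type_algebra_def family_carrier lookup_add add_ge)
    qed
  qed
  then have "cring (?M\<lparr>carrier := carrier family_ring\<rparr>)" by (rule M.subcring_iff[THEN iffD1, rotated]) (simp add: ring_of_type_algebra_def)
  then show ?thesis by (simp add: family_ring_def)
qed

lemma graded_of_in: "p \<in> carrier family_ring \<Longrightarrow> graded_of p \<in> carrier G"
proof -
  assume p: "p \<in> carrier family_ring"
  have "{\<epsilon> \<in> \<Gamma>. graded_of p \<epsilon> \<noteq> graded_gt \<mu> \<epsilon>} \<subseteq> Poly_Mapping.keys p"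
    by (auto simp: graded_of_def in_keys_iff graded_class_zero)
  then have "finite {\<epsilon> \<in> \<Gamma>. graded_of p \<epsilon> \<noteq> graded_gt \<mu> \<epsilon>}" by (rule finite_subset) simp
  then show ?thesis using p
    unfolding graded_algebra_def family_carrier by (auto simp: graded_of_def graded_ge_def)
qed

lemma graded_of_surj: "F \<in> carrier G \<Longrightarrow> \<exists>p\<in>carrier family_ring. F = graded_of p"
proof -
  assume "F \<in> carrier G"
  then have F: "F \<in> (\<Pi>\<^sub>E \<epsilon>\<in>\<Gamma>. graded_class \<mu> \<epsilon> ` graded_ge \<mu> \<epsilon>)" and fin: "finite {\<epsilon> \<in> \<Gamma>. F \<epsilon> \<noteq> graded_gt \<mu> \<epsilon>}"
    unfolding graded_algebra_def by auto
  have "\<exists>f. \<epsilon> \<in> \<Gamma> \<longrightarrow> Fin \<epsilon> \<le> \<mu> f \<and> F \<epsilon> = graded_class \<mu> \<epsilon> f" for \<epsilon>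
    using F unfolding graded_ge_def by (fastforce simp: PiE_iff)
  then obtain f where f: "\<And>\<epsilon>. \<epsilon> \<in> \<Gamma> \<Longrightarrow> Fin \<epsilon> \<le> \<mu> (f \<epsilon>) \<and> F \<epsilon> = graded_class \<mu> \<epsilon> (f \<epsilon>)" by metis
  define D where "D = {\<epsilon> \<in> \<Gamma>. F \<epsilon> \<noteq> graded_gt \<mu> \<epsilon>}"
  define p where "p = Abs_poly_mapping (\<lambda>\<epsilon>. if \<epsilon> \<in> D then f \<epsilon> else 0)"
  have lp: "lookup p = (\<lambda>\<epsilon>. if \<epsilon> \<in> D then f \<epsilon> else 0)"
    unfolding p_def using fin by (subst lookup_Abs_poly_mapping) (auto simp: D_def elim: finite_subset[rotated])
  have "p \<in> carrier family_ring" using f by (auto simp: family_carrier lp D_def)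
  moreover have "F = graded_of p"
  proof
    fix \<epsilon>
    show "F \<epsilon> = graded_of p \<epsilon>"
      using F f[of \<epsilon>] by (auto simp: graded_of_def lp D_def graded_class_zero PiE_iff extensional_def)
  qed
  ultimately show ?thesis by blast
qed

lemma graded_of_add:
  assumes "p \<in> carrier family_ring" "q \<in> carrier family_ring"
  shows "graded_of (p + q) = graded_of p \<oplus>\<^bsub>G\<^esub> graded_of q"
proof
  fix \<epsilon>
  have "Fin \<epsilon> < \<mu> ((lookup p \<epsilon> - repr (graded_class \<mu> \<epsilon> (lookup p \<epsilon>)))
     + (lookup q \<epsilon> - repr (graded_class \<mu> \<epsilon> (lookup q \<epsilon>))))"
    by (intro add_gt) (metis repr_graded_class diff_commute)+
  then show "graded_of (p + q) \<epsilon> = (graded_of p \<oplus>\<^bsub>G\<^esub> graded_of q) \<epsilon>"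
    by (auto simp: graded_algebra_def graded_of_def graded_class_eq_iff lookup_add algebra_simps)
qed

text \<open>The graded product differs from the convolution in two ways: it uses chosen
  representatives, and it omits the degrees in which the first factor has the zero coset. Each of
  these changes the coefficient in degree \<epsilon> by terms of value greater than \<epsilon>
  (\<open>term1\<close> and \<open>term2\<close>).\<close>

lemma graded_of_mult:
  assumes "p \<in> carrier family_ring" "q \<in> carrier family_ring"
  shows "graded_of (p * q) = graded_of p \<otimes>\<^bsub>G\<^esub> graded_of q"
proof
  fix \<epsilon>
  define D where "D = {\<delta> \<in> \<Gamma>. graded_of p \<delta> \<noteq> graded_gt \<mu> \<delta>}"
  have D: "D \<subseteq> Poly_Mapping.keys p"
    by (auto simp: D_def graded_of_def in_keys_iff graded_class_zero)
  define P where "P \<delta> = repr (graded_class \<mu> \<delta> (lookup p \<delta>))" for \<delta>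
  define Q where "Q \<delta> = repr (graded_class \<mu> \<delta> (lookup q \<delta>))" for \<delta>
  have p: "Fin \<delta> \<le> \<mu> (lookup p \<delta>)" "Fin \<delta> \<le> \<mu> (P \<delta>)" "Fin \<delta> < \<mu> (lookup p \<delta> - P \<delta>)" for \<delta>
    using assms(1) repr_ge repr_graded_class by (auto simp: family_carrier P_def diff_commute[of "lookup p \<delta>"])
  have q: "Fin \<delta> \<le> \<mu> (lookup q \<delta>)" "Fin \<delta> \<le> \<mu> (Q \<delta>)" "Fin \<delta> < \<mu> (lookup q \<delta> - Q \<delta>)" for \<delta>
    using assms(2) repr_ge repr_graded_class by (auto simp: family_carrier Q_def diff_commute[of "lookup q \<delta>"])
  show "graded_of (p * q) \<epsilon> = (graded_of p \<otimes>\<^bsub>G\<^esub> graded_of q) \<epsilon>"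
  proof (cases "\<epsilon> \<in> \<Gamma>")
    case True
    have zero: "lookup p \<delta> = 0 \<and> \<delta> \<notin> \<Gamma> \<or> Fin \<delta> < \<mu> (lookup p \<delta>)" if "\<delta> \<notin> D" for \<delta>
    proof (cases "\<delta> \<in> \<Gamma>")
      case True
      then have "graded_class \<mu> \<delta> (lookup p \<delta>) = graded_class \<mu> \<delta> 0"
        using that by (auto simp: D_def graded_of_def graded_class_zero)
      then show ?thesis by (simp add: graded_class_eq_iff)
    qed (use assms(1) in \<open>auto simp: family_carrier\<close>)
    have term1: "Fin \<epsilon> < \<mu> (lookup p \<delta> * lookup q (\<epsilon> - \<delta>) - P \<delta> * Q (\<epsilon> - \<delta>))" for \<delta>
    proof -
      have "lookup p \<delta> * lookup q (\<epsilon> - \<delta>) - P \<delta> * Q (\<epsilon> - \<delta>) =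
        (lookup p \<delta> - P \<delta>) * lookup q (\<epsilon> - \<delta>) + (lookup q (\<epsilon> - \<delta>) - Q (\<epsilon> - \<delta>)) * P \<delta>"
        by (simp add: algebra_simps)
      moreover have "Fin \<delta> + Fin (\<epsilon> - \<delta>) < \<mu> ((lookup p \<delta> - P \<delta>) * lookup q (\<epsilon> - \<delta>))"
        unfolding mult by (rule vinf_add_strict_mono) (auto intro: p q)
      moreover have "Fin (\<epsilon> - \<delta>) + Fin \<delta> < \<mu> ((lookup q (\<epsilon> - \<delta>) - Q (\<epsilon> - \<delta>)) * P \<delta>)"
        unfolding mult by (rule vinf_add_strict_mono) (auto intro: p q)
      ultimately show ?thesis by (auto intro: add_gt)
    qed
    have term2: "Fin \<epsilon> < \<mu> (lookup p \<delta> * lookup q (\<epsilon> - \<delta>))" if "\<delta> \<notin> D" for \<delta>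
    proof (cases "lookup p \<delta> = 0")
      case False
      then have "Fin \<delta> < \<mu> (lookup p \<delta>)" using zero[OF that] by auto
      then have "Fin \<delta> + Fin (\<epsilon> - \<delta>) < \<mu> (lookup p \<delta>) + \<mu> (lookup q (\<epsilon> - \<delta>))"
        by (rule vinf_add_strict_mono) (auto intro: q)
      then show ?thesis by (simp add: mult)
    qed simp
    have "lookup (p * q) \<epsilon> = (\<Sum>\<delta>\<in>Poly_Mapping.keys p. lookup p \<delta> * lookup q (\<epsilon> - \<delta>))"
      by (rule lookup_times) auto
    also have "\<dots> = (\<Sum>\<delta>\<in>D. lookup p \<delta> * lookup q (\<epsilon> - \<delta>)) + (\<Sum>\<delta>\<in>Poly_Mapping.keys p - D. lookup p \<delta> * lookup q (\<epsilon> - \<delta>))"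
      using sum.subset_diff[OF D finite_keys] by (simp add: add.commute)
    finally have "lookup (p * q) \<epsilon> - (\<Sum>\<delta>\<in>D. P \<delta> * Q (\<epsilon> - \<delta>)) =
        (\<Sum>\<delta>\<in>D. lookup p \<delta> * lookup q (\<epsilon> - \<delta>) - P \<delta> * Q (\<epsilon> - \<delta>)) + (\<Sum>\<delta>\<in>Poly_Mapping.keys p - D. lookup p \<delta> * lookup q (\<epsilon> - \<delta>))"
      by (simp add: sum_subtractf)
    moreover have "Fin \<epsilon> < \<mu> \<dots>"
      using term1 term2 by (intro add_gt sum_gt) auto
    ultimately have "graded_class \<mu> \<epsilon> (lookup (p * q) \<epsilon>) = graded_class \<mu> \<epsilon> (\<Sum>\<delta>\<in>D. P \<delta> * Q (\<epsilon> - \<delta>))"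
      by (simp add: graded_class_eq_iff)
    moreover have "(\<Sum>\<delta>\<in>D. P \<delta> * Q (\<epsilon> - \<delta>)) = (\<Sum>\<delta>\<in>D. repr (graded_of p \<delta>) * repr (graded_of q (\<epsilon> - \<delta>)))"
      using True by (intro sum.cong) (auto simp: P_def Q_def graded_of_def D_def \<Gamma>_diff)
    ultimately show ?thesis using True by (simp add: graded_algebra_def graded_of_def D_def)
  qed (simp add: graded_algebra_def graded_of_def)
qed

lemma graded_of_one: "graded_of 1 = \<one>\<^bsub>G\<^esub>"
  by (auto simp: graded_of_def graded_algebra_def lookup_one when_def)

lemma graded_of_zero: "graded_of 0 = \<zero>\<^bsub>G\<^esub>"
  by (auto simp: graded_of_def graded_algebra_def graded_class_zero)

lemma graded_of_hom: "graded_of \<in> ring_hom family_ring G"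
  by (rule ring_hom_memI) (auto simp: graded_of_in graded_of_mult graded_of_add graded_of_one)

lemma graded_of_image: "graded_of ` carrier family_ring = carrier G"
  using graded_of_in graded_of_surj by blast

lemma graded_cring: "cring G"
proof -
  interpret F: cring family_ring by (rule family_cring)
  have "ring (G \<lparr>carrier := graded_of ` carrier family_ring, zero := graded_of \<zero>\<^bsub>family_ring\<^esub>\<rparr>)"
    by (rule F.ring_hom_imp_img_ring[OF graded_of_hom])
  then have "ring G" by (simp add: graded_of_image graded_of_zero)
  moreover have "F \<otimes>\<^bsub>G\<^esub> H = H \<otimes>\<^bsub>G\<^esub> F" if FH: "F \<in> carrier G" "H \<in> carrier G" for F H
    using graded_of_surj[OF FH(1)] graded_of_surj[OF FH(2)] graded_of_mult by (metis mult.commute)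
  ultimately show ?thesis by (intro cring.intro comm_monoid.intro comm_monoid_axioms.intro ring.axioms(2)) auto
qed

end


section \<open>Key polynomials\<close>

lemma degree_mod_less_pos:
  "0 < degree \<phi> \<Longrightarrow> degree (f mod \<phi>) < degree \<phi>"
  for f \<phi> :: "'k::field poly"
  using degree_mod_less[of \<phi> f] by fastforce

context poly_valuation
begin

lemma initial_form_eq: "\<mu> f = Fin \<epsilon> \<Longrightarrow> initial_form \<mu> f = graded_of (Poly_Mapping.single \<epsilon> f)"
  by (auto simp: initial_form_def graded_of_def lookup_single when_def)

lemma lookup_times_single: "lookup (p * Poly_Mapping.single \<gamma> f) \<epsilon> = lookup p (\<epsilon> - \<gamma>) * f"
  for p :: "'g \<Rightarrow>\<^sub>0 'k poly"
proof -
  have "lookup (Poly_Mapping.single \<gamma> f * p) \<epsilon> = (\<Sum>\<delta>\<in>{\<gamma>}. lookup (Poly_Mapping.single \<gamma> f) \<delta> * lookup p (\<epsilon> - \<delta>))"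
    by (rule lookup_times) auto
  then show ?thesis by (simp add: mult.commute)
qed

lemma mem_cgenideal_initial_form:
  assumes "\<mu> \<phi> = Fin \<gamma>"
  shows "PIdl\<^bsub>G\<^esub> (initial_form \<mu> \<phi>) = (\<lambda>p. graded_of (p * Poly_Mapping.single \<gamma> \<phi>)) ` carrier family_ring"
proof -
  have s: "Poly_Mapping.single \<gamma> \<phi> \<in> carrier family_ring"
    using assms \<Gamma>_value by (intro family_single) auto
  show ?thesis
    unfolding cgenideal_def initial_form_eq[OF assms] graded_of_image[symmetric]
    using graded_of_mult[OF _ s] by force
qed

text \<open>A larger value of \<open>r - q * \<phi>\<close> would mean that the initial form of
  \<open>r\<close> is the product of those of \<open>q\<close> and \<open>\<phi>\<close>. It would
  then lie in the ideal of \<open>\<phi>\<close>, which contains no initial form of smaller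
  degree.\<close>

lemma key_polynomial_not_divides:
  assumes "\<phi> \<in> key_polynomials \<mu>" "degree r < degree \<phi>" "\<mu> r \<noteq> \<infinity>"
  shows "\<mu> (r - q * \<phi>) \<le> \<mu> r"
proof (rule ccontr)
  assume "\<not> \<mu> (r - q * \<phi>) \<le> \<mu> r"
  then have gt: "\<mu> r < \<mu> (r - q * \<phi>)" by simp
  from assms(1) have "\<mu> \<phi> \<noteq> \<infinity>" and not_in: "initial_form \<mu> r \<notin> PIdl\<^bsub>G\<^esub> (initial_form \<mu> \<phi>)"
    using assms(2,3) unfolding key_polynomials_def Let_def by auto
  then obtain \<gamma> \<rho> where \<gamma>: "\<mu> \<phi> = Fin \<gamma>" and \<rho>: "\<mu> r = Fin \<rho>"
    using assms(3) by (meson vinf.exhaust)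
  have "\<mu> q + Fin \<gamma> = Fin \<rho>" using eq_of_diff_gt[OF gt] \<gamma> \<rho> by (simp add: mult)
  then have q: "\<mu> q = Fin (\<rho> - \<gamma>)" by (cases "\<mu> q") auto
  have "graded_of (Poly_Mapping.single (\<rho> - \<gamma>) q * Poly_Mapping.single \<gamma> \<phi>) = graded_of (Poly_Mapping.single \<rho> r)"
    using gt diff_commute[of r] by (auto simp: graded_of_def fun_eq_iff mult_single lookup_single graded_class_eq_iff when_def \<rho>)
  moreover have "Poly_Mapping.single (\<rho> - \<gamma>) q \<in> carrier family_ring"
    using q \<Gamma>_value by (intro family_single) auto
  ultimately show False
    using not_in unfolding mem_cgenideal_initial_form[OF \<gamma>] initial_form_eq[OF \<rho>] by (metis imageI)
qed

lemma key_polynomial_mod_ge: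
  assumes "\<phi> \<in> key_polynomials \<mu>" "degree r < degree \<phi>"
  shows "\<mu> (q * \<phi> + r) \<le> \<mu> r"
  using key_polynomial_not_divides[OF assms, of "- q"] by (cases "\<mu> r = \<infinity>") (auto simp: add.commute)

end

text \<open>
  The kernel of \<open>\<G>\<^sub>\<mu> \<rightarrow> \<G>\<^sub>\<nu>\<close> is generated by the initial form of a monic \<open>\<phi>\<close> of least
  degree with \<open>\<mu>(\<phi>) < \<nu>(\<phi>)\<close>; it is prime because \<open>\<G>\<^sub>\<nu>\<close> is a domain.
\<close>
lemma minimal_degree_key_polynomial:
  fixes \<mu> \<nu> :: "'k::field poly \<Rightarrow> 'g::linordered_ab_group_add vinf"
  assumes "poly_valuation \<mu>" "poly_valuation \<nu>"
    and le: "\<And>f. \<mu> f \<le> \<nu> f"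
    and eq: "\<And>f. degree f < degree \<phi> \<Longrightarrow> \<mu> f = \<nu> f"
    and monic: "lead_coeff \<phi> = 1" and gt: "\<mu> \<phi> < \<nu> \<phi>"
  shows "\<phi> \<in> key_polynomials \<mu>"
proof -
  interpret \<mu>: poly_valuation \<mu> by fact
  interpret \<nu>: poly_valuation \<nu> by fact
  interpret G: cring "graded_algebra \<mu>" by (rule \<mu>.graded_cring)
  let ?G = "graded_algebra \<mu>"
  have deg: "0 < degree \<phi>"
  proof (rule ccontr)
    assume "\<not> 0 < degree \<phi>"
    then obtain c where "\<phi> = [:c:]" by (metis degree_eq_zeroE gr0I)
    then have "\<phi> = 1" using monic by simp
    then show False using gt by simp
  qed
  obtain \<gamma> where \<gamma>: "\<mu> \<phi> = Fin \<gamma>" using gt by (cases "\<mu> \<phi>") auto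
  let ?s = "Poly_Mapping.single \<gamma> \<phi>"
  define J where "J = PIdl\<^bsub>?G\<^esub> (initial_form \<mu> \<phi>)"
  have s: "?s \<in> carrier \<mu>.family_ring"
    using \<gamma> \<mu>.\<Gamma>_value by (intro \<mu>.family_single) auto
  \<comment> \<open>If f vanishes in degree \<epsilon> of the graded algebra of \<nu>, its class for
    \<mu> is a multiple of the initial form of \<phi>. The clause for f = 0 keeps the support of a
    whole family of quotients finite.\<close>
  have quot: "\<exists>q. Fin \<epsilon> < \<mu> (f - q * \<phi>) \<and> Fin (\<epsilon> - \<gamma>) \<le> \<mu> q \<and> (f = 0 \<longrightarrow> q = 0)"
    if f: "Fin \<epsilon> \<le> \<mu> f" "Fin \<epsilon> < \<nu> f" for f \<epsilon>
  proof (cases "Fin \<epsilon> < \<mu> f")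
    case True
    then show ?thesis by (intro exI[of _ 0]) simp
  next
    case False
    then have \<epsilon>: "\<mu> f = Fin \<epsilon>" using f by simp
    then have nz: "f \<noteq> 0" by auto
    define q r where "q = f div \<phi>" and "r = f mod \<phi>"
    have fqr: "f = q * \<phi> + r" by (simp add: q_def r_def)
    have "degree r < degree \<phi>"
      unfolding r_def using deg by (rule degree_mod_less_pos)
    then have r: "\<mu> r = \<nu> r" by (rule eq)
    have q: "\<mu> (q * \<phi>) < \<nu> (q * \<phi>)" if "\<mu> q \<noteq> \<infinity>"
      using vinf_add_strict_mono[OF gt le[of q] that] by (simp add: \<mu>.mult \<nu>.mult add.commute)
    \<comment> \<open>A dominant remainder would determine \<nu> f as well: \<nu> agrees with \<mu>
      on r and only enlarges the value of q \<phi>. Then \<nu> f = \<mu> r \<le> \<epsilon>, against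
      the assumption on f.\<close>
    have "\<mu> (q * \<phi>) < \<mu> r"
    proof (rule ccontr)
      assume *: "\<not> \<mu> (q * \<phi>) < \<mu> r"
      have "\<mu> r \<le> \<mu> f" using * unfolding fqr by (intro \<mu>.add_ge) auto
      then have rfin: "\<mu> r \<noteq> \<infinity>" using \<epsilon> by auto
      have "\<nu> r < \<nu> (q * \<phi>)"
      proof (cases "\<mu> q = \<infinity>")
        case True
        then have "\<nu> (q * \<phi>) = \<infinity>" using le[of q] by (simp add: \<nu>.mult)
        then show ?thesis using rfin r by simp
      next
        case False
        then show ?thesis using q * r by simp
      qed
      then have "\<nu> f = \<mu> r" using \<nu>.add_eq' r by (simp add: fqr)
      then show False using \<open>\<mu> r \<le> \<mu> f\<close> f \<epsilon> by simp
    qed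
    then have "\<mu> (q * \<phi>) = \<mu> f" "Fin \<epsilon> < \<mu> r" using \<mu>.add_eq[of "q * \<phi>" r] \<epsilon> by (auto simp: fqr)
    then have "\<mu> q + Fin \<gamma> = Fin \<epsilon>" using \<epsilon> \<gamma> by (simp add: \<mu>.mult)
    then have "\<mu> q = Fin (\<epsilon> - \<gamma>)" by (cases "\<mu> q") auto
    moreover have "f - q * \<phi> = r" by (simp add: fqr)
    ultimately show ?thesis using \<open>Fin \<epsilon> < \<mu> r\<close> nz by (intro exI[of _ q]) simp
  qed
  \<comment> \<open>The ideal as a kernel, on representatives: each component vanishes in the graded
    algebra of \<nu>. Primality is proved from this description, not from the generator.\<close>
  have J: "\<mu>.graded_of p \<in> J \<longleftrightarrow> (\<forall>\<epsilon>. Fin \<epsilon> < \<nu> (lookup p \<epsilon>))" if p: "p \<in> carrier \<mu>.family_ring" for p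
  proof
    assume "\<mu>.graded_of p \<in> J"
    then obtain q where q: "q \<in> carrier \<mu>.family_ring" "\<mu>.graded_of p = \<mu>.graded_of (q * ?s)"
      unfolding J_def \<mu>.mem_cgenideal_initial_form[OF \<gamma>] by blast
    show "\<forall>\<epsilon>. Fin \<epsilon> < \<nu> (lookup p \<epsilon>)"
    proof
      fix \<epsilon>
      show "Fin \<epsilon> < \<nu> (lookup p \<epsilon>)"
      proof (cases "\<epsilon> \<in> poly_value_group \<mu>")
        case True
        then have "graded_class \<mu> \<epsilon> (lookup p \<epsilon>) = graded_class \<mu> \<epsilon> (lookup (q * ?s) \<epsilon>)"
          using fun_cong[OF q(2), of \<epsilon>] by (simp add: \<mu>.graded_of_def)
        then have "Fin \<epsilon> < \<mu> (lookup p \<epsilon> - lookup q (\<epsilon> - \<gamma>) * \<phi>)"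
          by (simp add: \<mu>.graded_class_eq_iff \<mu>.lookup_times_single)
        then have 1: "Fin \<epsilon> < \<nu> (lookup p \<epsilon> - lookup q (\<epsilon> - \<gamma>) * \<phi>)" using le order_less_le_trans by blast
        have "Fin (\<epsilon> - \<gamma>) \<le> \<nu> (lookup q (\<epsilon> - \<gamma>))"
          using q(1) le order_trans unfolding \<mu>.family_carrier by blast
        then have "Fin \<gamma> + Fin (\<epsilon> - \<gamma>) < \<nu> \<phi> + \<nu> (lookup q (\<epsilon> - \<gamma>))"
          using gt \<gamma> by (intro vinf_add_strict_mono) auto
        then have "Fin \<epsilon> < \<nu> (lookup q (\<epsilon> - \<gamma>) * \<phi>)" by (simp add: \<nu>.mult add.commute)
        from \<nu>.add_gt[OF 1 this] show ?thesis by simp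
      next
        case False
        then show ?thesis using p by (simp add: \<mu>.family_carrier)
      qed
    qed
  next
    assume pos: "\<forall>\<epsilon>. Fin \<epsilon> < \<nu> (lookup p \<epsilon>)"
    have "\<exists>q. Fin \<epsilon> < \<mu> (lookup p \<epsilon> - q * \<phi>) \<and> Fin (\<epsilon> - \<gamma>) \<le> \<mu> q \<and> (lookup p \<epsilon> = 0 \<longrightarrow> q = 0)" for \<epsilon>
      using p pos by (intro quot) (auto simp: \<mu>.family_carrier)
    then obtain q where q: "\<And>\<epsilon>. Fin \<epsilon> < \<mu> (lookup p \<epsilon> - q \<epsilon> * \<phi>)" "\<And>\<epsilon>. Fin (\<epsilon> - \<gamma>) \<le> \<mu> (q \<epsilon>)"
      "\<And>\<epsilon>. lookup p \<epsilon> = 0 \<Longrightarrow> q \<epsilon> = 0" by metis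
    define q' where "q' = Abs_poly_mapping (\<lambda>\<delta>. q (\<delta> + \<gamma>))"
    have "{\<delta>. q (\<delta> + \<gamma>) \<noteq> 0} \<subseteq> (\<lambda>\<epsilon>. \<epsilon> - \<gamma>) ` Poly_Mapping.keys p"
    proof
      fix \<delta> assume "\<delta> \<in> {\<delta>. q (\<delta> + \<gamma>) \<noteq> 0}"
      then have "\<delta> + \<gamma> \<in> Poly_Mapping.keys p" using q(3) by (auto simp: in_keys_iff)
      then show "\<delta> \<in> (\<lambda>\<epsilon>. \<epsilon> - \<gamma>) ` Poly_Mapping.keys p" by (intro image_eqI[of _ _ "\<delta> + \<gamma>"]) auto
    qed
    then have "finite {\<delta>. q (\<delta> + \<gamma>) \<noteq> 0}" by (rule finite_subset) simp
    then have lq: "lookup q' = (\<lambda>\<delta>. q (\<delta> + \<gamma>))" unfolding q'_def by (rule lookup_Abs_poly_mapping)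
    have "q' \<in> carrier \<mu>.family_ring"
      unfolding \<mu>.family_carrier lq
    proof (intro allI conjI impI)
      fix \<epsilon> show "Fin \<epsilon> \<le> \<mu> (q (\<epsilon> + \<gamma>))" using q(2)[of "\<epsilon> + \<gamma>"] by simp
      assume "\<epsilon> \<notin> poly_value_group \<mu>"
      then have "\<epsilon> + \<gamma> \<notin> poly_value_group \<mu>" using \<mu>.\<Gamma>_diff[of "\<epsilon> + \<gamma>" \<gamma>] \<mu>.\<Gamma>_value[OF \<gamma>] by auto
      then show "q (\<epsilon> + \<gamma>) = 0" using p q(3) by (simp add: \<mu>.family_carrier)
    qed
    moreover have "\<mu>.graded_of p = \<mu>.graded_of (q' * ?s)"
      using q(1) by (auto simp: \<mu>.graded_of_def fun_eq_iff \<mu>.graded_class_eq_iff \<mu>.lookup_times_single lq)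
    ultimately show "\<mu>.graded_of p \<in> J"
      unfolding J_def \<mu>.mem_cgenideal_initial_form[OF \<gamma>] by (metis imageI)
  qed
  have in_s: "initial_form \<mu> \<phi> \<in> carrier ?G"
    using s \<mu>.graded_of_in by (simp add: \<mu>.initial_form_eq[OF \<gamma>])
  have "ideal J ?G" unfolding J_def by (rule G.cgenideal_ideal[OF in_s])
  moreover have "carrier ?G \<noteq> J"
  proof -
    have "\<mu>.graded_of 1 \<notin> J"
    proof -
      have "1 \<in> carrier \<mu>.family_ring"
        using \<mu>.\<Gamma>_zero by (auto simp: \<mu>.family_carrier lookup_one when_def zero_vinf_def)
      moreover have "\<not> Fin 0 < \<nu> (lookup 1 0)" by (simp add: lookup_one zero_vinf_def)
      ultimately show ?thesis using J[of 1] by blast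
    qed
    moreover have "\<mu>.graded_of 1 \<in> carrier ?G" by (simp add: \<mu>.graded_of_one)
    ultimately show ?thesis by blast
  qed
  moreover have "A \<in> J \<or> B \<in> J" if AB: "A \<in> carrier ?G" "B \<in> carrier ?G" "A \<otimes>\<^bsub>?G\<^esub> B \<in> J" for A B
  proof (rule ccontr)
    assume notin: "\<not> (A \<in> J \<or> B \<in> J)"
    obtain p q where p: "p \<in> carrier \<mu>.family_ring" "A = \<mu>.graded_of p"
      and q: "q \<in> carrier \<mu>.family_ring" "B = \<mu>.graded_of q"
      using \<mu>.graded_of_surj AB by metis
    \<comment> \<open>The lowest degree in which an element outside the kernel has a nonzero image.
      Since the degrees are totally ordered, the product of two such lowest components cannot be
      cancelled by other terms.\<close>
    have minex: "\<exists>a. \<nu> (lookup p a) = Fin a \<and> (\<forall>b<a. Fin b < \<nu> (lookup p b))"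
      if p: "p \<in> carrier \<mu>.family_ring" "\<mu>.graded_of p \<notin> J" for p
    proof -
      define S where "S = {a. \<not> Fin a < \<nu> (lookup p a)}"
      have "S \<subseteq> Poly_Mapping.keys p" by (auto simp: S_def in_keys_iff)
      then have "finite S" by (rule finite_subset) simp
      moreover have "S \<noteq> {}" using J[OF p(1)] p(2) by (auto simp: S_def)
      ultimately have "Min S \<in> S" "\<And>b. b \<in> S \<Longrightarrow> Min S \<le> b" by auto
      moreover have "Fin (Min S) \<le> \<nu> (lookup p (Min S))"
        using p(1) le order_trans unfolding \<mu>.family_carrier by blast
      ultimately show ?thesis by (intro exI[of _ "Min S"]) (fastforce simp: S_def)
    qed
    obtain a where a: "\<nu> (lookup p a) = Fin a" "\<And>b. b < a \<Longrightarrow> Fin b < \<nu> (lookup p b)"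
      using minex[OF p(1)] notin p by blast
    obtain b where b: "\<nu> (lookup q b) = Fin b" "\<And>c. c < b \<Longrightarrow> Fin c < \<nu> (lookup q c)"
      using minex[OF q(1)] notin q by blast
    have pge: "Fin \<delta> \<le> \<nu> (lookup p \<delta>)" for \<delta> using p(1) le order_trans unfolding \<mu>.family_carrier by blast
    have qge: "Fin \<delta> \<le> \<nu> (lookup q \<delta>)" for \<delta> using q(1) le order_trans unfolding \<mu>.family_carrier by blast
    define D where "D = insert a (Poly_Mapping.keys p)"
    have others: "Fin (a + b) < \<nu> (lookup p \<delta> * lookup q (a + b - \<delta>))" if "\<delta> \<noteq> a" for \<delta>
    proof (cases "\<delta> < a")
      case True
      then have "Fin \<delta> + Fin (a + b - \<delta>) < \<nu> (lookup p \<delta>) + \<nu> (lookup q (a + b - \<delta>))"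
        by (intro vinf_add_strict_mono a qge) auto
      then show ?thesis by (simp add: \<nu>.mult)
    next
      case False
      then have "a + b - \<delta> < b" using that by simp
      then have "Fin (a + b - \<delta>) + Fin \<delta> < \<nu> (lookup q (a + b - \<delta>)) + \<nu> (lookup p \<delta>)"
        by (intro vinf_add_strict_mono b pge) auto
      then show ?thesis by (simp add: \<nu>.mult add.commute)
    qed
    have "lookup (p * q) (a + b) = (\<Sum>\<delta>\<in>D. lookup p \<delta> * lookup q (a + b - \<delta>))"
      by (rule \<mu>.lookup_times) (auto simp: D_def)
    also have "\<dots> = lookup p a * lookup q b + (\<Sum>\<delta>\<in>D - {a}. lookup p \<delta> * lookup q (a + b - \<delta>))"
      by (subst sum.remove[of _ a]) (auto simp: D_def)
    finally have split: "lookup (p * q) (a + b) = lookup p a * lookup q b + (\<Sum>\<delta>\<in>D - {a}. lookup p \<delta> * lookup q (a + b - \<delta>))" .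
    have "\<nu> (lookup p a * lookup q b) = Fin (a + b)" using a b by (simp add: \<nu>.mult)
    moreover have "Fin (a + b) < \<nu> (\<Sum>\<delta>\<in>D - {a}. lookup p \<delta> * lookup q (a + b - \<delta>))"
      using others by (intro \<nu>.sum_gt) auto
    ultimately have "\<nu> (lookup (p * q) (a + b)) = Fin (a + b)" unfolding split by (subst \<nu>.add_eq) simp_all
    moreover have "\<mu>.graded_of (p * q) \<in> J" using AB p q \<mu>.graded_of_mult by simp
    ultimately show False using J[OF \<mu>.family_mult[OF p(1) q(1)]] by (metis order_less_irrefl)
  qed
  ultimately have "primeideal J ?G"
    by (intro primeidealI) (auto simp: G.cring_axioms)
  moreover have "homogeneous_set \<mu> J"
    unfolding homogeneous_set_def
  proof (intro ballI)
    fix F \<delta> assume F: "F \<in> J" "\<delta> \<in> poly_value_group \<mu>"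
    then have "F \<in> carrier ?G" using \<open>ideal J ?G\<close> by (meson additive_subgroup.a_subset ideal.axioms(1) subsetD)
    then obtain p where p: "p \<in> carrier \<mu>.family_ring" "F = \<mu>.graded_of p"
      using \<mu>.graded_of_surj by blast
    have "graded_component \<mu> \<delta> F = \<mu>.graded_of (Poly_Mapping.single \<delta> (lookup p \<delta>))"
      by (auto simp: fun_eq_iff graded_component_def p \<mu>.graded_of_def lookup_single when_def \<mu>.graded_class_zero)
    moreover have "Poly_Mapping.single \<delta> (lookup p \<delta>) \<in> carrier \<mu>.family_ring"
      using p(1) F(2) by (intro \<mu>.family_single) (auto simp: \<mu>.family_carrier)
    ultimately show "graded_component \<mu> \<delta> F \<in> J"
      using F(1) J[OF p(1)] J p(2) by (auto simp: lookup_single when_def)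
  qed
  moreover have "initial_form \<mu> f \<notin> J" if f: "\<mu> f \<noteq> \<infinity>" "degree f < degree \<phi>" for f
  proof -
    obtain \<epsilon> where \<epsilon>: "\<mu> f = Fin \<epsilon>" using f by (cases "\<mu> f") auto
    then have "\<nu> f = Fin \<epsilon>" using eq f by simp
    moreover have "Poly_Mapping.single \<epsilon> f \<in> carrier \<mu>.family_ring"
      using \<epsilon> \<mu>.\<Gamma>_value by (intro \<mu>.family_single) auto
    ultimately show ?thesis
      unfolding \<mu>.initial_form_eq[OF \<epsilon>] by (subst J) (auto simp: lookup_single intro!: exI[of _ \<epsilon>])
  qed
  ultimately show ?thesis
    using monic \<gamma> unfolding key_polynomials_def Let_def J_def by auto
qed


section \<open>Augmentations\<close>

instance vinf :: (linordered_ab_group_add) linordered_ab_semigroup_add ..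

text \<open>Division by \<phi> lowers the degree of the quotient, so every polynomial is built in
  Horner form. Inductions of this shape replace the handling of expansions as finite sums.\<close>

lemma expansion_induct [consumes 1, case_names zero step]:
  fixes \<phi> :: "'k::field poly"
  assumes deg: "0 < degree \<phi>" and "P 0"
    and step: "\<And>q r. P q \<Longrightarrow> degree r < degree \<phi> \<Longrightarrow> P (q * \<phi> + r)"
  shows "P f"
proof (induction "degree f" arbitrary: f rule: less_induct)
  case less
  have "\<phi> \<noteq> 0" using deg by auto
  have "P (f div \<phi>)"
  proof (cases "f div \<phi> = 0")
    case False
    have "degree f = degree (f div \<phi> * \<phi> + f mod \<phi>)" by simp
    also have "\<dots> = degree (f div \<phi> * \<phi>)"
      using degree_mod_less_pos[OF deg, of f] False \<open>\<phi> \<noteq> 0\<close>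
      by (intro degree_add_eq_left) (simp add: degree_mult_eq)
    finally have "degree (f div \<phi>) < degree f"
      using False deg \<open>\<phi> \<noteq> 0\<close> by (simp add: degree_mult_eq)
    then show ?thesis by (rule less)
  qed (use \<open>P 0\<close> in simp)
  from step[OF this degree_mod_less_pos[OF deg, of f]] show ?case by simp
qed

lemma expansion_exists:
  fixes \<phi> f :: "'k::field poly"
  assumes "0 < degree \<phi>"
  obtains a N where "\<And>n::nat. degree (a n) < degree \<phi>" "f = (\<Sum>n\<le>N. a n * \<phi> ^ n)"
proof -
  have "\<exists>a N. (\<forall>n::nat. degree (a n) < degree \<phi>) \<and> f = (\<Sum>n\<le>N. a n * \<phi> ^ n)"
    using assms
  proof (induction f rule: expansion_induct)
    case zero
    then show ?case using assms by (intro exI[of _ "\<lambda>_. 0"] exI[of _ 0]) simp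
  next
    case (step q r)
    then obtain a N where a: "\<And>n::nat. degree (a n) < degree \<phi>" "q = (\<Sum>n\<le>N. a n * \<phi> ^ n)" by blast
    have "q * \<phi> + r = (\<Sum>n\<le>Suc N. case_nat r a n * \<phi> ^ n)"
      by (subst sum.atMost_Suc_shift) (simp add: a(2) sum_distrib_left algebra_simps)
    moreover have "degree (case_nat r a n) < degree \<phi>" for n
      using a(1) step(2) by (auto split: nat.split)
    ultimately show ?case by blast
  qed
  with that show thesis by blast
qed

lemma defined_on_expansions_const:
  assumes "defined_on_expansions w \<phi> \<gamma> \<mu>'" "degree r < degree \<phi>"
  shows "\<mu>' r = w r"
  using assms(1)[unfolded defined_on_expansions_def, rule_format, of 0 "\<lambda>_. r"] assms(2) by simp

lemma Min_expansion_step: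
  fixes g :: "nat \<Rightarrow> 'g::linordered_ab_group_add vinf"
  shows "Min ((\<lambda>n. g n + n \<cdot> \<gamma>) ` {..Suc N}) = min (g 0) (Min ((\<lambda>n. g (Suc n) + n \<cdot> \<gamma>) ` {..N}) + \<gamma>)"
proof -
  have "(\<lambda>n. g n + n \<cdot> \<gamma>) ` {..Suc N} = insert (g 0) ((\<lambda>n. (g (Suc n) + n \<cdot> \<gamma>) + \<gamma>) ` {..N})"
    by (simp add: atMost_Suc_eq_insert_0 image_image add.assoc add.left_commute)
  also have "Min \<dots> = min (g 0) (Min ((\<lambda>n. (g (Suc n) + n \<cdot> \<gamma>) + \<gamma>) ` {..N}))"
    by (subst Min_insert) auto
  also have "Min ((\<lambda>n. (g (Suc n) + n \<cdot> \<gamma>) + \<gamma>) ` {..N}) = Min ((\<lambda>n. g (Suc n) + n \<cdot> \<gamma>) ` {..N}) + \<gamma>"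
    by (rule Min_add_commute) auto
  finally show ?thesis .
qed

text \<open>Splitting off the term with n = 0 turns the minimum over an expansion into a recursion.
  Together with its converse \<open>defined_on_expansionsI\<close>, this is the form in which
  augmentations are used.\<close>

lemma defined_on_expansions_step:
  assumes "defined_on_expansions w \<phi> \<gamma> \<mu>'" "degree r < degree \<phi>"
  shows "\<mu>' (q * \<phi> + r) = min (w r) (\<mu>' q + \<gamma>)"
proof -
  have "0 < degree \<phi>" using assms(2) by simp
  obtain a N where a: "\<And>n::nat. degree (a n) < degree \<phi>" "q = (\<Sum>n\<le>N. a n * \<phi> ^ n)"
    using expansion_exists[OF \<open>0 < degree \<phi>\<close>, of q] by metis
  have "q * \<phi> + r = (\<Sum>n\<le>Suc N. case_nat r a n * \<phi> ^ n)"
    by (subst sum.atMost_Suc_shift) (simp add: a(2) sum_distrib_left algebra_simps)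
  also have "\<mu>' \<dots> = Min ((\<lambda>n. w (case_nat r a n) + n \<cdot> \<gamma>) ` {..Suc N})"
    using assms a(1) by (intro assms(1)[unfolded defined_on_expansions_def, rule_format]) (simp split: nat.split)
  also have "\<dots> = min (w r) (Min ((\<lambda>n. w (a n) + n \<cdot> \<gamma>) ` {..N}) + \<gamma>)"
    by (subst Min_expansion_step) simp
  also have "Min ((\<lambda>n. w (a n) + n \<cdot> \<gamma>) ` {..N}) = \<mu>' q"
    using assms a unfolding defined_on_expansions_def by auto
  finally show ?thesis .
qed

lemma defined_on_expansionsI:
  assumes "\<mu>' 0 = \<infinity>"
    and step: "\<And>q r. degree r < degree \<phi> \<Longrightarrow> \<mu>' (q * \<phi> + r) = min (w r) (\<mu>' q + \<gamma>)"
  shows "defined_on_expansions w \<phi> \<gamma> \<mu>'"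
  unfolding defined_on_expansions_def
proof (intro allI)
  fix a N
  show "(\<forall>n\<le>N. degree (a n) < degree \<phi>) \<longrightarrow>
    \<mu>' (\<Sum>n\<le>N. a n * \<phi> ^ n) = Min ((\<lambda>n. w (a n) + n \<cdot> \<gamma>) ` {..N})"
  proof (induction N arbitrary: a)
    case 0
    then show ?case using step[of "a 0" 0] assms(1) by simp
  next
    case (Suc N)
    show ?case
    proof
      assume *: "\<forall>n\<le>Suc N. degree (a n) < degree \<phi>"
      have "(\<Sum>n\<le>Suc N. a n * \<phi> ^ n) = (\<Sum>n\<le>N. a (Suc n) * \<phi> ^ n) * \<phi> + a 0"
        by (subst sum.atMost_Suc_shift) (simp add: sum_distrib_left algebra_simps)
      also have "\<mu>' \<dots> = min (w (a 0)) (\<mu>' (\<Sum>n\<le>N. a (Suc n) * \<phi> ^ n) + \<gamma>)"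
        using * by (intro step) simp
      also have "\<mu>' (\<Sum>n\<le>N. a (Suc n) * \<phi> ^ n) = Min ((\<lambda>n. w (a (Suc n)) + n \<cdot> \<gamma>) ` {..N})"
        using * Suc[of "\<lambda>n. a (Suc n)"] by simp
      finally show "\<mu>' (\<Sum>n\<le>Suc N. a n * \<phi> ^ n) = Min ((\<lambda>n. w (a n) + n \<cdot> \<gamma>) ` {..Suc N})"
        by (subst Min_expansion_step)
    qed
  qed
qed

text \<open>
  For a valuation \<open>\<mu>'\<close> a one-sided estimate suffices: if \<open>\<mu>'(q\<phi> + r) \<le> \<mu>'(r)\<close>, no
  cancellation occurs between the two terms.
\<close>
lemma (in poly_valuation) defined_on_expansionsI_le:
  fixes \<phi> :: "'k poly"
  assumes "\<mu> \<phi> = \<gamma>" "\<And>r. degree r < degree \<phi> \<Longrightarrow> \<mu> r = w r"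
    and "\<And>q r. degree r < degree \<phi> \<Longrightarrow> \<mu> (q * \<phi> + r) \<le> \<mu> r"
  shows "defined_on_expansions w \<phi> \<gamma> \<mu>"
proof (rule defined_on_expansionsI)
  fix q r :: "'k poly" assume r: "degree r < degree \<phi>"
  have "\<mu> (q * \<phi> + r) \<le> \<mu> (q * \<phi> + r - r)"
    using assms(3)[OF r] by (intro diff_ge) auto
  then have "\<mu> (q * \<phi> + r) \<le> \<mu> q + \<gamma>" by (simp add: mult assms(1))
  moreover have "min (\<mu> (q * \<phi>)) (\<mu> r) \<le> \<mu> (q * \<phi> + r)" by (rule add)
  ultimately show "\<mu> (q * \<phi> + r) = min (w r) (\<mu> q + \<gamma>)"
    using assms(3)[OF r, of q] by (auto simp: assms(1) assms(2)[OF r, symmetric] mult min_def split: if_splits)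
qed simp

lemma ordinary_augmentation_eq:
  assumes "ordinary_augmentation \<mu> \<phi> \<gamma> \<mu>'" "degree r < degree \<phi>"
  shows "\<mu>' r = \<mu> r"
  using assms defined_on_expansions_const unfolding ordinary_augmentation_def by blast

lemma defined_on_expansions_self:
  assumes "poly_valuation \<mu>'" "0 < degree \<phi>" "defined_on_expansions w \<phi> \<gamma> \<mu>'"
  shows "\<mu>' \<phi> = \<gamma>"
proof -
  interpret \<mu>': poly_valuation \<mu>' by fact
  have "w 0 = \<infinity>" using defined_on_expansions_const[OF assms(3), of 0] assms(2) by simp
  then show ?thesis
    using defined_on_expansions_step[OF assms(3), of 0 1] assms(2) by (simp add: min_def)
qed

text \<open>For a key polynomial there is no cancellation between \<open>q * \<phi>\<close> and
  \<open>r\<close> under \<open>\<mu>\<close>, so \<open>\<mu> (q * \<phi> + r)\<close> is bounded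
  by the values of both terms. Raising the value of \<open>\<phi>\<close> can then only raise the
  minimum.\<close>

lemma ordinary_augmentation_le:
  assumes "poly_valuation \<mu>" "poly_valuation \<mu>'" "0 < degree \<phi>"
    and aug: "ordinary_augmentation \<mu> \<phi> \<gamma> \<mu>'"
  shows "\<mu> f \<le> \<mu>' f"
proof -
  interpret \<mu>: poly_valuation \<mu> by fact
  interpret \<mu>': poly_valuation \<mu>' by fact
  from aug have key: "\<phi> \<in> key_polynomials \<mu>" and gt: "\<mu> \<phi> < \<gamma>" and d: "defined_on_expansions \<mu> \<phi> \<gamma> \<mu>'"
    unfolding ordinary_augmentation_def by auto
  from assms(3) show ?thesis
  proof (induction f rule: expansion_induct)
    case (step q r)
    have r: "\<mu> (q * \<phi> + r) \<le> \<mu> r" by (rule \<mu>.key_polynomial_mod_ge[OF key step(2)])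
    then have "\<mu> (q * \<phi> + r) \<le> \<mu> (q * \<phi> + r - r)" by (intro \<mu>.diff_ge) auto
    also have "\<dots> \<le> \<mu>' q + \<gamma>" using step(1) gt by (auto simp: \<mu>.mult intro: add_mono)
    finally show ?case using r by (simp add: defined_on_expansions_step[OF d step(2)])
  qed simp
qed


section \<open>Limit augmentations\<close>

locale valued_closure =
  fixes \<iota> :: "'k::field \<Rightarrow> 'a::field" and v :: "'a \<Rightarrow> 'g::linordered_ab_group_add vinf"
  assumes hom: "\<iota> \<in> ring_hom ring_of_type_algebra \<Omega>" and val: "is_valuation v"
begin

lemma \<iota>_simps [simp]: "\<iota> (x + y) = \<iota> x + \<iota> y" "\<iota> (x * y) = \<iota> x * \<iota> y" "\<iota> 1 = 1"
  using hom unfolding ring_hom_def by (auto simp: ring_of_type_algebra_def)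

lemma \<iota>_0 [simp]: "\<iota> 0 = 0"
proof -
  have "\<iota> 0 + \<iota> 0 = \<iota> 0 + 0" by (simp flip: \<iota>_simps(1) del: \<iota>_simps)
  then show ?thesis by (rule add_left_imp_eq)
qed

lemma \<iota>_minus [simp]: "\<iota> (- x) = - \<iota> x"
  using \<iota>_simps(1)[of "- x" x] by (simp add: eq_neg_iff_add_eq_0 del: \<iota>_simps)

lemma \<iota>_diff [simp]: "\<iota> (x - y) = \<iota> x - \<iota> y"
  using \<iota>_simps(1)[of x "- y"] by (simp del: \<iota>_simps)

lemma \<iota>_eq_0_iff [simp]: "\<iota> x = 0 \<longleftrightarrow> x = 0"
proof
  assume "\<iota> x = 0"
  then have "\<iota> (x * inverse x) = 0" by simp
  then show "x = 0" by (cases "x = 0") (auto simp del: \<iota>_simps(2) simp: \<iota>_simps(3))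
qed simp

lemma \<iota>_inverse [simp]: "\<iota> (inverse x) = inverse (\<iota> x)"
proof (cases "x = 0")
  case False
  then have "\<iota> x * \<iota> (inverse x) = 1" by (simp flip: \<iota>_simps(2))
  then show ?thesis by (rule inverse_unique[symmetric])
qed simp

lemma v_infty_iff [simp]: "v x = \<infinity> \<longleftrightarrow> x = 0"
  using val unfolding is_valuation_def by blast

sublocale v: ring_valuation v
proof
  show "v (x * y) = v x + v y" "min (v x) (v y) \<le> v (x + y)" for x y
    using val unfolding is_valuation_def by auto
  show "v 0 = \<infinity>" by simp
  have "v 1 + v 1 = v 1 + 0" using val unfolding is_valuation_def by (metis add.right_neutral mult_1)
  then show "v 1 = 0" by (subst (asm) vinf_add_left_cancel) auto
qed

lemma poly_valuation_of: "\<mu> \<in> poly_valuations \<iota> v \<Longrightarrow> poly_valuation \<mu>"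
proof
  assume "\<mu> \<in> poly_valuations \<iota> v"
  then have *: "\<And>f g. \<mu> (f * g) = \<mu> f + \<mu> g" "\<And>f g. min (\<mu> f) (\<mu> g) \<le> \<mu> (f + g)" "\<And>c. \<mu> [:c:] = v (\<iota> c)"
    unfolding poly_valuations_def by auto
  show "\<mu> (f * g) = \<mu> f + \<mu> g" "min (\<mu> f) (\<mu> g) \<le> \<mu> (f + g)" for f g by fact+
  show "\<mu> 0 = \<infinity>" "\<mu> 1 = 0" using *(3)[of 0] *(3)[of 1] by (simp_all add: one_pCons)
qed

lemma poly_valuations_const: "\<mu> \<in> poly_valuations \<iota> v \<Longrightarrow> degree f = 0 \<Longrightarrow> \<mu> f = v (\<iota> (poly.coeff f 0))"
  unfolding poly_valuations_def by (auto elim!: degree_eq_zeroE)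

end

text \<open>A limit augmentation with the witnesses \<open>\<chi>\<close>, \<open>\<beta>\<close>,
  \<open>m\<close> of its family fixed. Positivity of \<open>m\<close> is not part of the notion of
  a family; in a chain it follows from the prescribed degree of the valuations in the
  family.\<close>

locale augmentation_limit = valued_closure \<iota> v
  for \<iota> :: "'k::field \<Rightarrow> 'a::field" and v :: "'a \<Rightarrow> 'g::linordered_ab_group_add vinf" +
  fixes I :: "'i set" and R z \<rho> \<phi> \<gamma> \<mu>' \<chi> \<beta> m
  assumes order: "strict_linear_order_on I R" and z: "z \<in> I" "\<And>i. i \<in> I \<Longrightarrow> i \<noteq> z \<Longrightarrow> (z, i) \<in> R"
    and no_max: "\<And>i. i \<in> I \<Longrightarrow> \<exists>j\<in>I. (i, j) \<in> R"
    and \<rho>: "\<And>i. i \<in> I \<Longrightarrow> \<rho> i \<in> poly_valuations \<iota> v"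
    and aug: "\<And>i j. i \<in> I \<Longrightarrow> j \<in> I \<Longrightarrow> (i, j) \<in> R \<Longrightarrow>
       degree (\<chi> j) = m \<and> ordinary_augmentation (\<rho> i) (\<chi> j) (Fin (\<beta> j)) (\<rho> j)"
    and limit_key: "limit_key_polynomial I R \<rho> \<phi>" and gt: "\<And>i. i \<in> I \<Longrightarrow> \<rho> i \<phi> < \<gamma>"
    and expansions: "defined_on_expansions (stable_value I R \<rho>) \<phi> \<gamma> \<mu>'"
    and m: "0 < m" and \<mu>': "poly_valuation \<mu>'"
begin

lemma \<rho>_valuation: "i \<in> I \<Longrightarrow> poly_valuation (\<rho> i)"
  using \<rho> poly_valuation_of by blast

lemma \<rho>_mono: "i \<in> I \<Longrightarrow> j \<in> I \<Longrightarrow> (i, j) \<in> R \<Longrightarrow> \<rho> i f \<le> \<rho> j f"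
  using ordinary_augmentation_le[OF \<rho>_valuation \<rho>_valuation] aug m by metis

lemma common_upper: "i \<in> I \<Longrightarrow> j \<in> I \<Longrightarrow> \<exists>k\<in>I. (i, k) \<in> R \<and> (j, k) \<in> R"
  using order no_max unfolding strict_linear_order_on_def
  by (metis total_on_def transD)

lemma stable_valueI: 
  assumes "eventual_value I R \<rho> f c"
  shows "stable_value I R \<rho> f = c"
  unfolding stable_value_def
proof (rule the_equality)
  show "eventual_value I R \<rho> f c" by fact
  fix d assume "eventual_value I R \<rho> f d"
  with assms show "d = c" unfolding eventual_value_def using common_upper by metis
qed

lemma below_degree_eventual:
  assumes "degree f < degree \<phi>"
  obtains i where "i \<in> I" "\<And>j. j \<in> I \<Longrightarrow> (i, j) \<in> R \<Longrightarrow> \<rho> j f = \<mu>' f"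
proof -
  have "stable I R \<rho> f" using assms limit_key unfolding limit_key_polynomial_def by (metis not_le)
  then obtain c where c: "eventual_value I R \<rho> f c" unfolding stable_def by blast
  then have "\<mu>' f = c" using defined_on_expansions_const[OF expansions assms] stable_valueI by simp
  with c that show thesis unfolding eventual_value_def by blast
qed

text \<open>The counterpart of \<open>key_polynomial_mod_ge\<close> for limits. If it failed, then
  for all large j the value of \<open>q * \<phi>\<close> would equal the stable value of r. The
  values of q and of \<phi> increase with j, so both would become constant, and \<phi> would be
  stable.\<close>

lemma mod_value_ge:
  assumes i: "i \<in> I" and r: "degree r < degree \<phi>"
  shows "\<rho> i (q * \<phi> + r) \<le> \<mu>' r"
proof (rule ccontr)
  assume "\<not> \<rho> i (q * \<phi> + r) \<le> \<mu>' r"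
  then have less: "\<mu>' r < \<rho> i (q * \<phi> + r)" by simp
  obtain i1 where i1: "i1 \<in> I" "\<And>j. j \<in> I \<Longrightarrow> (i1, j) \<in> R \<Longrightarrow> \<rho> j r = \<mu>' r"
    using below_degree_eventual[OF r] by blast
  obtain j0 where j0: "j0 \<in> I" "(i, j0) \<in> R" "(i1, j0) \<in> R" using common_upper i i1(1) by blast
  have const: "\<rho> j q + \<rho> j \<phi> = \<mu>' r" if j: "j \<in> I" "(i, j) \<in> R" "(i1, j) \<in> R" for j
  proof -
    interpret \<rho>j: poly_valuation "\<rho> j" by (rule \<rho>_valuation[OF j(1)])
    have "\<rho> j r < \<rho> j (q * \<phi> + r)"
      using i1(2)[OF j(1,3)] less \<rho>_mono[OF i j(1,2)] by (metis order_less_le_trans)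
    then have "\<rho> j (- (q * \<phi>)) = \<rho> j r" 
      by (intro \<rho>j.eq_of_diff_gt) (simp add: add.commute)
    then show ?thesis using i1(2)[OF j(1,3)] by (simp add: \<rho>j.mult)
  qed
  have fin: "\<mu>' r \<noteq> \<infinity>" using less by auto
  have "\<rho> j \<phi> = \<rho> j0 \<phi>" if j: "j \<in> I" "(j0, j) \<in> R" for j
  proof -
    have tr: "trans R" using order unfolding strict_linear_order_on_def by blast
    then have "\<rho> j q + \<rho> j \<phi> = \<mu>' r" using const j j0 by (meson transD)
    then show ?thesis
      using vinf_add_squeeze[of "\<rho> j0 q" "\<rho> j0 \<phi>" "\<rho> j q" "\<rho> j \<phi>"] const[OF j0] \<rho>_mono[OF j0(1) j] fin by simp
  qed
  then have "stable I R \<rho> \<phi>" unfolding stable_def eventual_value_def using j0(1) by blast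
  then show False using limit_key unfolding limit_key_polynomial_def by blast
qed

lemma degree_pos: "0 < degree \<phi>"
proof (rule ccontr)
  assume "\<not> 0 < degree \<phi>"
  then have "\<rho> i \<phi> = v (\<iota> (poly.coeff \<phi> 0))" if "i \<in> I" for i
    using poly_valuations_const[OF \<rho>[OF that], of \<phi>] by simp
  then have "stable I R \<rho> \<phi>" unfolding stable_def eventual_value_def using z(1) by blast
  then show False using limit_key unfolding limit_key_polynomial_def by blast
qed

text \<open>As in the ordinary case, with one preliminary move: i is replaced by a larger j at which
  r has reached its stable value, so that \<open>mod_value_ge\<close> excludes cancellation under
  \<open>\<rho> j\<close>.\<close>

lemma limit_augmentation_le: "i \<in> I \<Longrightarrow> \<rho> i f \<le> \<mu>' f"
proof -
  interpret \<mu>': poly_valuation \<mu>' by (rule \<mu>')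
  show "i \<in> I \<Longrightarrow> \<rho> i f \<le> \<mu>' f"
    using degree_pos
  proof (induction f arbitrary: i rule: expansion_induct)
    case (step q r)
    obtain i1 where i1: "i1 \<in> I" "\<And>j. j \<in> I \<Longrightarrow> (i1, j) \<in> R \<Longrightarrow> \<rho> j r = \<mu>' r"
      using below_degree_eventual[OF step(2)] by blast
    obtain j where j: "j \<in> I" "(i, j) \<in> R" "(i1, j) \<in> R" using common_upper step(3) i1(1) by blast
    interpret \<rho>j: poly_valuation "\<rho> j" by (rule \<rho>_valuation[OF j(1)])
    have "\<rho> j (q * \<phi> + r) \<le> \<rho> j r" using mod_value_ge[OF j(1) step(2), of q] i1(2)[OF j(1,3)] by simp
    then have "\<rho> j (q * \<phi> + r) \<le> \<rho> j (q * \<phi> + r - r)" by (intro \<rho>j.diff_ge) auto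
    also have "\<dots> \<le> \<mu>' q + \<mu>' \<phi>"
      using step(1)[OF j(1)] gt[OF j(1)] defined_on_expansions_self[OF \<mu>' degree_pos expansions]
      by (auto simp: \<rho>j.mult intro!: add_mono)
    finally have "\<rho> j (q * \<phi> + r) \<le> \<mu>' (q * \<phi>)" by (simp add: \<mu>'.mult)
    moreover have "\<rho> j (q * \<phi> + r) \<le> \<mu>' r" by (rule mod_value_ge[OF j(1) step(2)])
    ultimately have "\<rho> j (q * \<phi> + r) \<le> \<mu>' (q * \<phi> + r)" by (intro \<mu>'.add_ge)
    then show ?case using \<rho>_mono[OF step(3) j(1,2), of "q * \<phi> + r"] by simp
  qed simp
qed

text \<open>
  The \<open>\<beta>\<^sub>j\<close> increase strictly, and \<open>\<nu>(\<chi>\<^sub>k) \<ge> \<beta>\<^sub>k\<close>; a monic \<open>h\<close> of the same degree with the largest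
  value \<open>\<nu>(h)\<close> satisfies \<open>\<nu>(h) = \<rho>\<^sub>j(h) \<le> \<beta>\<^sub>j\<close> for large \<open>j\<close>.
\<close>
lemma no_maximal_value:
  assumes d: "\<And>i. i \<in> I \<Longrightarrow> valuation_degree (\<rho> i) = degree h"
    and h: "0 < degree h" "degree h < degree \<phi>" "lead_coeff h = 1"
    and \<nu>: "\<And>f. \<mu>' f \<le> \<nu> f" "\<mu>' h = \<nu> h"
    and max: "\<And>g. degree g = degree h \<Longrightarrow> lead_coeff g = 1 \<Longrightarrow> \<nu> g \<le> \<nu> h"
  shows False
proof -
  have key: "\<chi> j \<in> key_polynomials (\<rho> i)" "lead_coeff (\<chi> j) = 1" "degree (\<chi> j) = m"
    "\<rho> i (\<chi> j) < Fin (\<beta> j)" "\<rho> j (\<chi> j) = Fin (\<beta> j)"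
    if "i \<in> I" "j \<in> I" "(i, j) \<in> R" for i j
  proof -
    show "\<chi> j \<in> key_polynomials (\<rho> i)" "\<rho> i (\<chi> j) < Fin (\<beta> j)" "degree (\<chi> j) = m"
      using aug[OF that] unfolding ordinary_augmentation_def by auto
    then show "lead_coeff (\<chi> j) = 1" unfolding key_polynomials_def by auto
    show "\<rho> j (\<chi> j) = Fin (\<beta> j)"
      using aug[OF that] m \<rho>_valuation[OF that(2)] unfolding ordinary_augmentation_def
      by (intro defined_on_expansions_self) auto
  qed
  \<comment> \<open>A key polynomial \<kappa> of \<open>\<rho> j\<close> of degree less than m would
    force \<open>\<rho> j\<close> \<le> \<open>\<rho> z\<close>, because the two valuations agree
    below degree m and hence on \<kappa> and on all remainders. But \<open>\<chi> j\<close> has a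
    strictly larger value under \<open>\<rho> j\<close>.\<close>
  have "degree h = m"
  proof (rule ccontr)
    assume neq: "degree h \<noteq> m"
    obtain j where j: "j \<in> I" "(z, j) \<in> R" using no_max z(1) by blast
    obtain k where k: "k \<in> I" "(j, k) \<in> R" using no_max j(1) by blast
    have "\<exists>\<kappa>\<in>key_polynomials (\<rho> j). degree \<kappa> = valuation_degree (\<rho> j)"
      unfolding valuation_degree_def by (rule LeastI_ex) (use key[OF j(1) k] in blast)
    then obtain \<kappa> where \<kappa>: "\<kappa> \<in> key_polynomials (\<rho> j)" "degree \<kappa> = degree h"
      using d[OF j(1)] by auto
    have "degree h \<le> m"
      unfolding d[OF j(1), symmetric] valuation_degree_def using key[OF j(1) k] by (intro Least_le) blast
    with neq have lt: "degree h < m" by simp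
    interpret \<rho>j: poly_valuation "\<rho> j" by (rule \<rho>_valuation[OF j(1)])
    interpret \<rho>z: poly_valuation "\<rho> z" by (rule \<rho>_valuation[OF z(1)])
    have eq: "\<rho> j r = \<rho> z r" if "degree r < m" for r
      using aug[OF z(1) j] that by (intro ordinary_augmentation_eq) auto
    have "\<rho> j f \<le> \<rho> z f" for f
      using h(1)[folded \<kappa>(2)]
    proof (induction f rule: expansion_induct)
      case (step q r)
      have r: "\<rho> j (q * \<kappa> + r) \<le> \<rho> j r" by (rule \<rho>j.key_polynomial_mod_ge[OF \<kappa>(1) step(2)])
      then have "\<rho> j (q * \<kappa> + r) \<le> \<rho> j (q * \<kappa> + r - r)" by (intro \<rho>j.diff_ge) auto
      also have "\<dots> \<le> \<rho> z (q * \<kappa>)"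
        using step(1) eq[of \<kappa>] lt \<kappa>(2) by (auto simp: \<rho>j.mult \<rho>z.mult intro: add_right_mono)
      finally show ?case using r eq[of r] step(2) lt \<kappa>(2) by (intro \<rho>z.add_ge) auto
    qed simp
    from this[of "\<chi> j"] key[OF z(1) j] show False by simp
  qed
  note key = key[folded this]
  obtain i where i: "i \<in> I" "\<And>j. j \<in> I \<Longrightarrow> (i, j) \<in> R \<Longrightarrow> \<rho> j h = \<mu>' h"
    using below_degree_eventual[OF h(2)] by blast
  obtain j where j: "j \<in> I" "(i, j) \<in> R" "(z, j) \<in> R" using common_upper i(1) z(1) by blast
  obtain k where k: "k \<in> I" "(j, k) \<in> R" using no_max j(1) by blast
  interpret \<rho>j: poly_valuation "\<rho> j" by (rule \<rho>_valuation[OF j(1)])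
  have small: "degree (f - g) < degree h"
    if "degree f = degree h" "degree g = degree h"
      "lead_coeff f = 1" "lead_coeff g = 1" for f g :: "'k poly"
    using that h(1) degree_diff_le[of f "degree h" g]
    by (metis coeff_diff diff_self le_neq_implies_less leading_coeff_0_iff degree_0 order_refl)
  have "\<nu> h = \<rho> j (1 * \<chi> j + (h - \<chi> j))" using i(2)[OF j(1,2)] \<nu>(2) by simp
  also have "\<dots> = min (\<rho> z (h - \<chi> j)) (\<rho> j 1 + Fin (\<beta> j))"
    using aug[OF z(1) j(1,3)] small[of h "\<chi> j"] key[OF z(1) j(1,3)] h unfolding ordinary_augmentation_def
    by (intro defined_on_expansions_step) auto
  finally have "\<nu> h \<le> Fin (\<beta> j)" by simp
  \<comment> \<open>Both polynomials are monic of the same degree, so the difference has smaller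
    degree. As \<open>\<chi> k\<close> is a key polynomial for \<open>\<rho> j\<close>, subtracting
    it from the difference cannot raise the value, and the result is \<open>- \<chi> j\<close>, of
    value \<open>\<beta> j\<close>.\<close>
  have "\<rho> j (\<chi> k) \<ge> Fin (\<beta> j)"
  proof -
    have deg: "degree (\<chi> k - \<chi> j) < degree (\<chi> k)"
      using small[of "\<chi> k" "\<chi> j"] key[OF z(1) j(1,3)] key[OF j(1) k] by simp
    show ?thesis
    proof (cases "\<rho> j (\<chi> k - \<chi> j) = \<infinity>")
      case False
      from \<rho>j.key_polynomial_not_divides[OF key(1)[OF j(1) k] deg False, of 1]
      have "\<rho> j (\<chi> k - \<chi> j) \<ge> Fin (\<beta> j)" using key[OF z(1) j(1,3)] by simp
      from \<rho>j.add_ge[OF this, of "\<chi> j"] show ?thesis using key[OF z(1) j(1,3)] by simp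
    next
      case True
      then show ?thesis using \<rho>j.add_ge[of "Fin (\<beta> j)" "\<chi> k - \<chi> j" "\<chi> j"] key[OF z(1) j(1,3)] by simp
    qed
  qed
  also have "\<rho> j (\<chi> k) < Fin (\<beta> k)" using key[OF j(1) k] by simp
  also have "Fin (\<beta> k) \<le> \<nu> (\<chi> k)"
    using key(5)[OF j(1) k] limit_augmentation_le[OF k(1), of "\<chi> k"] \<nu>(1)[of "\<chi> k"] by simp
  also have "\<nu> (\<chi> k) \<le> \<nu> h" using key[OF j(1) k] by (intro max) auto
  finally show False using \<open>\<nu> h \<le> Fin (\<beta> j)\<close> by simp
qed

end


section \<open>Uniqueness of the length\<close>

locale mlv_element = valued_closure \<iota> v
  for \<iota> :: "'k::field \<Rightarrow> 'a::field" and v :: "'a \<Rightarrow> 'g::linordered_ab_group_add vinf" +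
  fixes \<theta> :: 'a and n :: nat
  assumes minimal_degree: "\<And>p. is_minimal_polynomial \<iota> \<theta> p \<Longrightarrow> degree p = n"
    and max_attained: "\<And>d. 0 < d \<Longrightarrow> d < n \<Longrightarrow>
      \<exists>h. degree h = d \<and> lead_coeff h = 1 \<and>
        (\<forall>g. degree g = d \<longrightarrow> lead_coeff g = 1 \<longrightarrow>
             eval_valuation \<iota> v \<theta> g \<le> eval_valuation \<iota> v \<theta> h)"
begin

abbreviation "\<nu> \<equiv> eval_valuation \<iota> v \<theta>"

context
  fixes r \<mu> \<phi> \<gamma>
  assumes chain: "mlv_chain \<iota> v \<theta> r \<mu> \<phi> \<gamma>"
begin

lemma chain_valuation: "k \<le> r \<Longrightarrow> poly_valuation (\<mu> k)"
  using chain poly_valuation_of unfolding mlv_chain_def by blast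

lemma chain_degree_Suc: "k < r \<Longrightarrow> degree (\<phi> k) < degree (\<phi> (Suc k))"
  using chain unfolding mlv_chain_def by blast

lemma chain_degree_mono: "k \<le> l \<Longrightarrow> l \<le> r \<Longrightarrow> degree (\<phi> k) \<le> degree (\<phi> l)"
proof (induction l)
  case (Suc l)
  then show ?case using chain_degree_Suc[of l] by (cases "k = Suc l") auto
qed simp

lemma chain_degree_pos: "k \<le> r \<Longrightarrow> 0 < degree (\<phi> k)"
  using chain_degree_mono[of 0 k] chain unfolding mlv_chain_def by simp

lemma chain_last: "degree (\<phi> r) = n" "\<mu> r = \<nu>"
  using chain minimal_degree unfolding mlv_chain_def by auto

text \<open>The induction descends from the end of the chain because maximal values are known for
  \<open>\<nu>\<close> only. Once \<open>\<mu> (Suc k)\<close> is known to agree with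
  \<open>\<nu>\<close> in the degree of \<open>\<phi> k\<close>, a monic polynomial of largest value
  there excludes a limit step at k, and an ordinary step carries the agreement down to
  \<open>\<mu> k\<close>.\<close>

lemma chain_below:
  assumes "k \<le> r"
  shows "\<mu> k f \<le> \<nu> f \<and> (k = r \<or> degree f < degree (\<phi> (Suc k)) \<longrightarrow> \<mu> k f = \<nu> f) \<and>
    (k < r \<longrightarrow> ordinary_augmentation (\<mu> k) (\<phi> (Suc k)) (\<gamma> (Suc k)) (\<mu> (Suc k)))"
  using assms
proof (induction k arbitrary: f rule: inc_induct)
  case base
  then show ?case using chain_last by simp
next
  case (step k)
  then have k: "k < r" "k \<le> r" "Suc k \<le> r" by auto
  let ?d = "degree (\<phi> k)" and ?d' = "degree (\<phi> (Suc k))"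
  have dd': "0 < ?d" "?d < ?d'" using chain_degree_pos chain_degree_Suc k by auto
  have above: "\<mu> (Suc k) f \<le> \<nu> f" "degree f \<le> ?d' \<Longrightarrow> \<mu> (Suc k) f = \<nu> f" for f
  proof -
    show "\<mu> (Suc k) f \<le> \<nu> f" using step.IH by blast
    assume "degree f \<le> ?d'"
    then show "\<mu> (Suc k) f = \<nu> f" using step.IH[of f] chain_degree_Suc[of "Suc k"] k by (cases "Suc k = r") auto
  qed
  have "ordinary_augmentation (\<mu> k) (\<phi> (Suc k)) (\<gamma> (Suc k)) (\<mu> (Suc k))"
  proof (rule ccontr)
    assume "\<not> ?thesis"
    then obtain I :: "('k poly \<Rightarrow> 'g vinf) set" and R z \<rho> where lim:
      "limit_augmentation \<iota> v I R z \<rho> (\<phi> (Suc k)) (\<gamma> (Suc k)) (\<mu> (Suc k))"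
      "\<forall>i\<in>I. valuation_degree (\<rho> i) = ?d"
      using chain k unfolding mlv_chain_def by blast
    then obtain \<chi> \<beta> m where fam: "\<forall>i\<in>I. \<forall>j\<in>I. (i, j) \<in> R \<longrightarrow>
        \<beta> j \<in> value_group v UNIV \<and> degree (\<chi> j) = m \<and>
        ordinary_augmentation (\<rho> i) (\<chi> j) (Fin (\<beta> j)) (\<rho> j)"
      unfolding limit_augmentation_def augmentation_family_def by blast
    have I: "z \<in> I" "\<forall>i\<in>I. \<exists>j\<in>I. (i, j) \<in> R"
      using lim(1) unfolding limit_augmentation_def augmentation_family_def by auto
    then obtain j where j: "j \<in> I" "(z, j) \<in> R" by blast
    then have "\<chi> j \<in> key_polynomials (\<rho> z)" "degree (\<chi> j) = m"
      using fam I(1) unfolding ordinary_augmentation_def by auto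
    then have "valuation_degree (\<rho> z) \<le> m" unfolding valuation_degree_def by (intro Least_le) blast
    then have m: "0 < m" using lim(2) I(1) dd'(1) by auto
    interpret augmentation_limit \<iota> v I R z \<rho> "\<phi> (Suc k)" "\<gamma> (Suc k)" "\<mu> (Suc k)" \<chi> \<beta> m
      using lim(1) fam m chain_valuation[OF k(3)]
      unfolding limit_augmentation_def augmentation_family_def
      by (intro augmentation_limit.intro augmentation_limit_axioms.intro valued_closure_axioms) auto
    have "?d' \<le> n" using chain_degree_mono[of "Suc k" r] k chain_last by simp
    then obtain h where h: "degree h = ?d" "lead_coeff h = 1"
      "\<And>g. degree g = ?d \<Longrightarrow> lead_coeff g = 1 \<Longrightarrow> \<nu> g \<le> \<nu> h"
      using max_attained[of ?d] dd' by auto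
    show False
      using no_maximal_value[of h \<nu>] lim(2) h dd' above by simp
  qed
  moreover have "\<mu> k f \<le> \<mu> (Suc k) f" "degree f < ?d' \<Longrightarrow> \<mu> k f = \<mu> (Suc k) f"
    using ordinary_augmentation_le[OF chain_valuation[OF k(2)] chain_valuation[OF k(3)] _ calculation] dd'
      ordinary_augmentation_eq[OF calculation, of f] by auto
  ultimately show ?case using above[of f] k by auto
qed

lemma chain_key_value: "k \<le> r \<Longrightarrow> \<nu> (\<phi> k) = \<gamma> k \<and> \<mu> k (\<phi> k) = \<gamma> k"
proof -
  assume k: "k \<le> r"
  have eq: "\<mu> k (\<phi> k) = \<nu> (\<phi> k)" using chain_below[OF k, of "\<phi> k"] chain_degree_Suc[of k] k by (cases "k = r") auto
  obtain w where "defined_on_expansions w (\<phi> k) (\<gamma> k) (\<mu> k)"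
  proof (cases k)
    case 0
    then show ?thesis using chain that unfolding mlv_chain_def by blast
  next
    case (Suc l)
    then show ?thesis using chain_below[of l] k that unfolding ordinary_augmentation_def by auto
  qed
  from defined_on_expansions_self[OF chain_valuation[OF k] chain_degree_pos[OF k] this] eq
  show ?thesis by simp
qed

lemma chain_gt: "k < r \<Longrightarrow> \<mu> k (\<phi> (Suc k)) < \<nu> (\<phi> (Suc k))"
  using chain_below[of k] chain_key_value[of "Suc k"] unfolding ordinary_augmentation_def by auto

text \<open>The recursion for \<open>\<mu> k\<close> with every other datum of the chain replaced by
  \<open>\<nu>\<close>; in this form it can be compared with another chain.\<close>

lemma chain_step:
  assumes k: "k \<le> r" and s: "degree s < degree (\<phi> k)"
  shows "\<mu> k (q * \<phi> k + s) = min (\<nu> s) (\<mu> k q + \<nu> (\<phi> k))"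
proof (cases k)
  case 0
  have d: "defined_on_expansions (\<lambda>a. v (\<iota> (poly.coeff a 0))) (\<phi> 0) (\<gamma> 0) (\<mu> 0)"
    "degree (\<phi> 0) = 1" "\<mu> r \<in> poly_valuations \<iota> v"
    using chain unfolding mlv_chain_def by auto
  then have "v (\<iota> (poly.coeff s 0)) = \<nu> s"
    using poly_valuations_const[of "\<mu> r" s] s 0 chain_last by simp
  then show ?thesis
    using defined_on_expansions_step[OF d(1)] s 0 chain_key_value[OF k] by simp
next
  case (Suc l)
  then have l: "l < r" "l \<le> r" using k by auto
  then have d: "defined_on_expansions (\<mu> l) (\<phi> k) (\<gamma> k) (\<mu> k)"
    using chain_below[of l] Suc unfolding ordinary_augmentation_def by auto
  have "\<mu> l s = \<nu> s" using chain_below[OF l(2), of s] s Suc by simp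
  then show ?thesis
    using defined_on_expansions_step[OF d s] chain_key_value[OF k] by simp
qed

end

text \<open>Among the valuations that agree with \<open>\<nu>\<close> up to the degree of
  \<open>\<phi> k\<close>, the smallest is \<open>\<mu> k\<close>: the value of an expansion in
  \<open>\<phi> k\<close> is never below the minimum over its terms, and agreement fixes the values
  of these terms. The other chain supplies such a valuation as soon as the degrees coincide.\<close>

lemma chain_le:
  assumes c: "mlv_chain \<iota> v \<theta> r \<mu> \<phi> \<gamma>" and c': "mlv_chain \<iota> v \<theta> r' \<mu>' \<phi>' \<gamma>'"
    and k: "k \<le> r" "k \<le> r'" and deg: "degree (\<phi> k) = degree (\<phi>' k)"
  shows "\<mu> k f \<le> \<mu>' k f"
proof -
  interpret \<mu>': poly_valuation "\<mu>' k" by (rule chain_valuation[OF c' k(2)])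
  have eq: "\<mu>' k s = \<nu> s" if "degree s \<le> degree (\<phi> k)" for s
    using chain_below[OF c' k(2), of s] chain_degree_Suc[OF c', of k] that deg k by (cases "k = r'") auto
  show ?thesis
    using chain_degree_pos[OF c k(1)]
  proof (induction f rule: expansion_induct)
    case (step q s)
    have "\<mu> k q + \<nu> (\<phi> k) \<le> \<mu>' k (q * \<phi> k)"
      using step(1) eq[of "\<phi> k"] by (simp add: \<mu>'.mult add_right_mono)
    then have "min (\<nu> s) (\<mu> k q + \<nu> (\<phi> k)) \<le> \<mu>' k (q * \<phi> k + s)"
      using eq[of s] step(2) by (intro \<mu>'.add_ge) (auto simp: min.coboundedI2 min.coboundedI1)
    then show ?case by (simp add: chain_step[OF c k(1) step(2)])
  qed simp
qed

lemma chain_eq: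
  assumes c: "mlv_chain \<iota> v \<theta> r \<mu> \<phi> \<gamma>" and c': "mlv_chain \<iota> v \<theta> r' \<mu>' \<phi>' \<gamma>'"
    and k: "k \<le> r" "k \<le> r'"
  shows "degree (\<phi> k) = degree (\<phi>' k)"
  using k
proof (induction k)
  case 0
  then show ?case using c c' unfolding mlv_chain_def by simp
next
  case (Suc k)
  then have deg: "degree (\<phi> k) = degree (\<phi>' k)" by simp
  have eq: "\<mu> k = \<mu>' k"
    using chain_le[OF c c' _ _ deg] chain_le[OF c' c _ _ deg[symmetric]] Suc.prems
    by (intro ext order_antisym) auto
  show ?case
    using chain_gt[OF c, of k] chain_gt[OF c', of k] chain_below[OF c', of k "\<phi> (Suc k)"]
      chain_below[OF c, of k "\<phi>' (Suc k)"] Suc.prems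
    unfolding eq by (metis Suc_leD linorder_neqE_nat order_less_irrefl Suc_le_lessD)
qed

lemma chain_length_unique:
  assumes c: "mlv_chain \<iota> v \<theta> r \<mu> \<phi> \<gamma>" and c': "mlv_chain \<iota> v \<theta> r' \<mu>' \<phi>' \<gamma>'"
  shows "r \<le> r'"
proof (rule ccontr)
  assume "\<not> r \<le> r'"
  then have "degree (\<phi> r') < degree (\<phi> r)"
    using chain_degree_Suc[OF c, of r'] chain_degree_mono[OF c, of "Suc r'" r] by simp
  then show False using chain_eq[OF c c', of r'] \<open>\<not> r \<le> r'\<close> chain_last(1)[OF c] chain_last(1)[OF c'] by simp
qed

lemma depth_eq:
  assumes "mlv_chain \<iota> v \<theta> r \<mu> \<phi> \<gamma>"
  shows "depth \<iota> v \<theta> = r"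
  unfolding depth_def
  using assms chain_length_unique by (intro the_equality) (blast intro: order_antisym)+

end


section \<open>Monomial valuations\<close>

lemma nat_times_Fin: "n \<cdot> Fin a = Fin (\<Sum>i<n. a)" for a :: "'g::linordered_ab_group_add"
  by (induction n) (auto simp: zero_vinf_def)

lemma vinf_le_add_Fin_iff: "a \<le> x + Fin c \<longleftrightarrow> a + Fin (- c) \<le> x"
  for a x :: "'g::linordered_ab_group_add vinf"
  by (cases a; cases x) (auto simp: algebra_simps)

lemma vinf_less_add_Fin_iff: "a < x + Fin c \<longleftrightarrow> a + Fin (- c) < x"
  for a x :: "'g::linordered_ab_group_add vinf"
  by (cases a; cases x) (auto simp: algebra_simps)

context valued_closure
begin

text \<open>The variable gets the weight \<delta>. Coefficients lie in the closure and not only in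
  K, so that the variable may be translated by any element of the closure.\<close>

definition gauss :: "'g \<Rightarrow> 'a poly \<Rightarrow> 'g vinf" where
  "gauss \<delta> p = Min ((\<lambda>i. v (poly.coeff p i) + i \<cdot> Fin \<delta>) ` {..degree p})"

lemma gauss_attained: "\<exists>i. gauss \<delta> p = v (poly.coeff p i) + i \<cdot> Fin \<delta>"
proof -
  have "gauss \<delta> p \<in> (\<lambda>i. v (poly.coeff p i) + i \<cdot> Fin \<delta>) ` {..degree p}"
    unfolding gauss_def by (rule Min_in) auto
  then show ?thesis by blast
qed

lemma gauss_le: "gauss \<delta> p \<le> v (poly.coeff p i) + i \<cdot> Fin \<delta>"
proof (cases "i \<le> degree p")
  case True
  then show ?thesis unfolding gauss_def by (intro Min_le) auto
qed (simp add: coeff_eq_0)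

lemma gauss_ge: "(\<And>i. a \<le> v (poly.coeff p i) + i \<cdot> Fin \<delta>) \<Longrightarrow> a \<le> gauss \<delta> p"
  using gauss_attained[of \<delta> p] by metis

lemma gauss_infty_iff: "gauss \<delta> p = \<infinity> \<longleftrightarrow> p = 0"
proof
  assume *: "gauss \<delta> p = \<infinity>"
  have "poly.coeff p i = 0" for i
    using gauss_le[of \<delta> p i] unfolding * by simp
  then show "p = 0" by (intro poly_eqI) simp
qed (simp add: gauss_def)

lemma gauss_const [simp]: "gauss \<delta> [:c:] = v c"
  by (simp add: gauss_def)

text \<open>Gauss's lemma. Take for each factor the least index at which its minimum is attained; in
  the coefficient at the sum of these indices exactly one product has the smallest value.\<close>

lemma gauss_mult: "gauss \<delta> (p * q) = gauss \<delta> p + gauss \<delta> q"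
proof (cases "p = 0 \<or> q = 0")
  case False
  let ?w = "\<lambda>p i. v (poly.coeff p i) + i \<cdot> Fin \<delta>"
  have ex: "\<exists>i. ?w p i = gauss \<delta> p \<and> (\<forall>j<i. gauss \<delta> p < ?w p j)" for p
  proof -
    obtain i where "?w p i = gauss \<delta> p" using gauss_attained[of \<delta> p] by metis
    then have "?w p (LEAST i. ?w p i = gauss \<delta> p) = gauss \<delta> p" by (rule LeastI)
    moreover have "gauss \<delta> p < ?w p j" if "j < (LEAST i. ?w p i = gauss \<delta> p)" for j
      using not_less_Least[OF that] gauss_le[of \<delta> p j] by simp
    ultimately show ?thesis by blast
  qed
  obtain i where i: "?w p i = gauss \<delta> p" "\<And>j. j < i \<Longrightarrow> gauss \<delta> p < ?w p j" using ex by blast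
  obtain j where j: "?w q j = gauss \<delta> q" "\<And>k. k < j \<Longrightarrow> gauss \<delta> q < ?w q k" using ex by blast
  have fin: "gauss \<delta> p \<noteq> \<infinity>" "gauss \<delta> q \<noteq> \<infinity>" using False gauss_infty_iff by auto
  have term_eq: "v (poly.coeff p k * poly.coeff q l) + (k + l) \<cdot> Fin \<delta> = ?w p k + ?w q l" for k l
    by (simp add: v.mult nat_times_add ac_simps del: sum.lessThan_Suc)
  show ?thesis
  proof (rule antisym)
    show "gauss \<delta> p + gauss \<delta> q \<le> gauss \<delta> (p * q)"
    proof (rule gauss_ge)
      fix m
      have "gauss \<delta> p + gauss \<delta> q \<le> v (poly.coeff p k * poly.coeff q (m - k)) + m \<cdot> Fin \<delta>" if "k \<le> m" for k
      proof -
        have "gauss \<delta> p + gauss \<delta> q \<le> ?w p k + ?w q (m - k)" by (intro add_mono gauss_le)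
        then show ?thesis using term_eq[of k "m - k"] that by simp
      qed
      then show "gauss \<delta> p + gauss \<delta> q \<le> ?w (p * q) m"
        unfolding coeff_mult nat_times_Fin vinf_le_add_Fin_iff by (intro v.sum_ge) auto
    qed
    define s where "s = (\<Sum>k\<in>{..i + j} - {i}. poly.coeff p k * poly.coeff q (i + j - k))"
    have split: "poly.coeff (p * q) (i + j) = poly.coeff p i * poly.coeff q j + s"
      unfolding coeff_mult s_def by (subst sum.remove[of _ i]) auto
    have "gauss \<delta> p + gauss \<delta> q < v (poly.coeff p k * poly.coeff q (i + j - k)) + (i + j) \<cdot> Fin \<delta>"
      if k: "k \<le> i + j" "k \<noteq> i" for k
    proof -
      have "gauss \<delta> p + gauss \<delta> q < ?w p k + ?w q (i + j - k)"
      proof (cases "k < i")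
        case True
        then show ?thesis using i(2) gauss_le fin by (intro vinf_add_strict_mono) auto
      next
        case False
        then have "i + j - k < j" using k by simp
        then have "gauss \<delta> q + gauss \<delta> p < ?w q (i + j - k) + ?w p k"
          using j(2) gauss_le fin by (intro vinf_add_strict_mono) auto
        then show ?thesis by (simp add: add.commute)
      qed
      then show ?thesis using term_eq[of k "i + j - k"] k by simp
    qed
    then have "gauss \<delta> p + gauss \<delta> q + Fin (- (\<Sum>k<i+j. \<delta>)) < v s"
      unfolding s_def nat_times_Fin vinf_less_add_Fin_iff using fin by (intro v.sum_gt) auto
    then have "gauss \<delta> p + gauss \<delta> q < v s + (i + j) \<cdot> Fin \<delta>"
      unfolding nat_times_Fin vinf_less_add_Fin_iff .
    moreover have eq: "v (poly.coeff p i * poly.coeff q j) + (i + j) \<cdot> Fin \<delta> = gauss \<delta> p + gauss \<delta> q"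
      using term_eq[of i j] i(1) j(1) by simp
    ultimately have "v (poly.coeff p i * poly.coeff q j) < v s"
      unfolding nat_times_Fin by (metis add.commute vinf_add_less_cancel vinf.distinct(1))
    from v.add_eq[OF this] show "gauss \<delta> (p * q) \<le> gauss \<delta> p + gauss \<delta> q"
      using gauss_le[of \<delta> "p * q" "i + j"] unfolding split by (simp add: eq del: sum.lessThan_Suc)
  qed
qed (auto simp: gauss_infty_iff[THEN iffD2])

lemma gauss_add: "min (gauss \<delta> p) (gauss \<delta> q) \<le> gauss \<delta> (p + q)"
proof (rule gauss_ge)
  fix i
  have "min (gauss \<delta> p) (gauss \<delta> q) \<le> v (poly.coeff p i) + i \<cdot> Fin \<delta>"
       "min (gauss \<delta> p) (gauss \<delta> q) \<le> v (poly.coeff q i) + i \<cdot> Fin \<delta>"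
    using gauss_le by (auto intro: order_trans[OF min.cobounded1] order_trans[OF min.cobounded2])
  then show "min (gauss \<delta> p) (gauss \<delta> q) \<le> v (poly.coeff (p + q) i) + i \<cdot> Fin \<delta>"
    unfolding nat_times_Fin vinf_le_add_Fin_iff by (auto intro: v.add_ge)
qed

sublocale gauss: ring_valuation "gauss \<delta>" for \<delta>
  by unfold_locales (auto simp: gauss_mult gauss_add gauss_infty_iff one_pCons)

lemma gauss_pcompose_ge:
  assumes "\<And>i. t \<le> v (poly.coeff p i)" "0 \<le> gauss \<delta> q"
  shows "t \<le> gauss \<delta> (p \<circ>\<^sub>p q)"
  using assms(1)
proof (induction p)
  case (pCons a p)
  have "t \<le> v (poly.coeff p i)" for i using pCons(3)[of "Suc i"] by simp
  then have "t \<le> gauss \<delta> (p \<circ>\<^sub>p q)" by (rule pCons)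
  then have "t + 0 \<le> gauss \<delta> (p \<circ>\<^sub>p q) + gauss \<delta> q" using assms(2) by (rule add_mono)
  moreover have "t \<le> v a" using pCons(3)[of 0] by simp
  ultimately show ?case
    by (auto simp: pcompose_pCons gauss_mult add.commute intro!: gauss.add_ge)
qed simp

lemma gauss_linear: "0 \<le> v c \<Longrightarrow> 0 \<le> \<delta> \<Longrightarrow> 0 \<le> gauss \<delta> [:c, 1:]"
proof (rule gauss_ge)
  fix i assume *: "0 \<le> v c" "0 \<le> \<delta>"
  consider "i = 0" | "i = 1" | j where "i = Suc (Suc j)" by (metis One_nat_def not0_implies_Suc)
  then show "0 \<le> v (poly.coeff [:c, 1:] i) + i \<cdot> Fin \<delta>"
  proof cases
    case 2
    then show ?thesis using *(2) by (simp add: zero_vinf_def)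
  qed (use * in simp_all)
qed

lemma poly_value_ge:
  assumes "\<And>i. t \<le> v (poly.coeff p i)" "0 \<le> v x"
  shows "t \<le> v (poly p x)"
  using assms(1)
proof (induction p)
  case (pCons a p)
  have "t \<le> v (poly.coeff p i)" for i using pCons(3)[of "Suc i"] by simp
  then have "t \<le> v (poly p x)" by (rule pCons)
  then have "t + 0 \<le> v (poly p x) + v x" using assms(2) by (rule add_mono)
  moreover have "t \<le> v a" using pCons(3)[of 0] by simp
  ultimately show ?case
    by (auto simp: v.mult add.commute intro!: v.add_ge)
qed simp

text \<open>Taylor expansion at c: the difference is x - c times a polynomial in x - c. Translation
  by an integral c preserves the lower bound t of the coefficients, and the factor x - c makes the
  estimate strict.\<close>

lemma poly_value_diff_gt:
  assumes p: "\<And>i. t \<le> v (poly.coeff p i)" "t \<noteq> \<infinity>" and c: "0 \<le> v c" "0 < v (x - c)"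
  shows "t < v (poly p x - poly p c)"
proof -
  define q where "q = p \<circ>\<^sub>p [:c, 1:]"
  obtain a q' where q': "q = pCons a q'" by (cases q) auto
  have "t \<le> v (poly.coeff q (Suc i))" for i
  proof -
    have "t \<le> gauss 0 q" unfolding q_def using p(1) c(1) by (intro gauss_pcompose_ge gauss_linear) auto
    also have "\<dots> \<le> v (poly.coeff q (Suc i))" using gauss_le[of 0 q "Suc i"] by (simp add: nat_times_Fin del: sum.lessThan_Suc flip: zero_vinf_def)
    finally show ?thesis .
  qed
  then have "t \<le> v (poly q' (x - c))" using c by (intro poly_value_ge) (auto simp: q')
  then have "0 + t < v (x - c) + v (poly q' (x - c))" using c p(2) by (intro vinf_add_strict_mono) auto
  moreover have "poly p x - poly p c = (x - c) * poly q' (x - c)"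
  proof -
    have "poly q (x - c) = poly p x" "poly q 0 = poly p c" by (simp_all add: q_def poly_pcompose)
    moreover have "poly q (x - c) = poly q 0 + (x - c) * poly q' (x - c)" by (simp add: q')
    ultimately show ?thesis by (metis add_diff_cancel_left')
  qed
  ultimately show ?thesis by (simp add: v.mult)
qed

section \<open>Monomial valuations with arbitrary center, restricted to K[x]\<close>

abbreviation emb :: "'k poly \<Rightarrow> 'a poly" where "emb \<equiv> map_poly \<iota>"

lemma emb_simps [simp]: "emb (p + q) = emb p + emb q" "emb (p * q) = emb p * emb q"
  "emb 1 = 1" "emb [:c:] = [:\<iota> c:]" "emb (p - q) = emb p - emb q"
proof -
  have \<iota>_sum: "\<iota> (sum f A) = (\<Sum>x\<in>A. \<iota> (f x))" for f :: "nat \<Rightarrow> 'k" and A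
    by (induction A rule: infinite_finite_induct) auto
  show "emb (p + q) = emb p + emb q" "emb (p * q) = emb p * emb q" "emb (p - q) = emb p - emb q"
    by (auto intro!: poly_eqI simp: coeff_map_poly coeff_mult \<iota>_sum)
  show "emb 1 = 1" "emb [:c:] = [:\<iota> c:]" by (auto intro!: poly_eqI simp: coeff_map_poly coeff_pCons split: nat.split)
qed

lemma emb_eq_0_iff [simp]: "emb p = 0 \<longleftrightarrow> p = 0"
  by (auto simp: poly_eq_iff coeff_map_poly)

lemma degree_emb [simp]: "degree (emb p) = degree p"
  by (rule degree_map_poly) auto

text \<open>The minimum of v(a_i) + i \<delta> over the Taylor coefficients a_i of f at the center
  c. In particular \<open>mon 0 0\<close> is the Gauss valuation of K[x].\<close>

definition mon :: "'a \<Rightarrow> 'g \<Rightarrow> 'k poly \<Rightarrow> 'g vinf" where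
  "mon c \<delta> f = gauss \<delta> (emb f \<circ>\<^sub>p [:c, 1:])"

sublocale mon: poly_valuation "mon c \<delta>" for c \<delta>
  by unfold_locales (auto simp: mon_def gauss_mult pcompose_mult pcompose_add gauss_add pcompose_1)

lemma mon_infty_iff: "mon c \<delta> f = \<infinity> \<longleftrightarrow> f = 0"
  by (simp add: mon_def gauss_infty_iff pcompose_eq_0_iff)

lemma value_group_UNIV: "x \<noteq> 0 \<Longrightarrow> v x \<in> Fin ` value_group v UNIV"
  by (cases "v x") (auto simp: value_group_def)

lemma mon_in_poly_valuations:
  assumes "Fin \<delta> = v \<pi>"
  shows "mon c \<delta> \<in> poly_valuations \<iota> v"
  unfolding poly_valuations_def
proof (intro CollectI conjI allI)
  show "range (mon c \<delta>) \<subseteq> insert \<infinity> (Fin ` value_group v UNIV)"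
  proof
    fix x assume "x \<in> range (mon c \<delta>)"
    then obtain f i where "x = v (poly.coeff f i) + i \<cdot> Fin \<delta>" using gauss_attained unfolding mon_def by blast
    then have "x = v (poly.coeff f i * \<pi> ^ i)" by (simp add: v.mult v.power assms)
    then show "x \<in> insert \<infinity> (Fin ` value_group v UNIV)"
      using value_group_UNIV by (cases "poly.coeff f i * \<pi> ^ i = 0") (auto simp del: mult_eq_0_iff)
  qed
  show "mon c \<delta> [:a:] = v (\<iota> a)" for a by (simp add: mon_def)
qed (rule mon.mult mon.add)+

lemma eval_valuation_in_poly_valuations: "eval_valuation \<iota> v \<theta> \<in> poly_valuations \<iota> v"
  unfolding poly_valuations_def
proof (intro CollectI conjI allI)
  show "range (eval_valuation \<iota> v \<theta>) \<subseteq> insert \<infinity> (Fin ` value_group v UNIV)"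
  proof
    fix x assume "x \<in> range (eval_valuation \<iota> v \<theta>)"
    then obtain y where "x = v y" unfolding eval_valuation_def by blast
    then show "x \<in> insert \<infinity> (Fin ` value_group v UNIV)" using value_group_UNIV by (cases "y = 0") auto
  qed
qed (auto simp: eval_valuation_def v.mult v.add)

text \<open>A point of the ball with center c and radius \<delta> gives each Taylor term at least
  the value that enters the minimum.\<close>

lemma mon_le_eval:
  assumes "Fin \<delta> \<le> v (\<theta> - c)"
  shows "mon c \<delta> f \<le> eval_valuation \<iota> v \<theta> f"
proof -
  define q where "q = emb f \<circ>\<^sub>p [:c, 1:]"
  have mono: "i \<cdot> Fin \<delta> \<le> i \<cdot> v (\<theta> - c)" for i
    using assms by (intro sum_mono)
  have "gauss \<delta> q \<le> v (\<Sum>i\<le>degree q. poly.coeff q i * (\<theta> - c) ^ i)"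
  proof (rule v.sum_ge)
    fix i
    have "gauss \<delta> q \<le> v (poly.coeff q i) + i \<cdot> Fin \<delta>" by (rule gauss_le)
    also have "\<dots> \<le> v (poly.coeff q i) + i \<cdot> v (\<theta> - c)" using mono by (rule add_left_mono)
    finally show "gauss \<delta> q \<le> v (poly.coeff q i * (\<theta> - c) ^ i)" by (simp add: v.mult v.power)
  qed
  moreover have "poly q (\<theta> - c) = poly (emb f) \<theta>" by (simp add: q_def poly_pcompose)
  ultimately show ?thesis by (simp add: mon_def eval_valuation_def q_def poly_altdef)
qed

lemma mon_le_value_center: "mon c \<delta> f \<le> v (poly (emb f) c)"
proof -
  have "poly (emb f \<circ>\<^sub>p [:c, 1:]) 0 = poly (emb f) c" by (simp add: poly_pcompose)
  then show ?thesis
    using gauss_le[of \<delta> "emb f \<circ>\<^sub>p [:c, 1:]" 0] by (simp add: mon_def poly_0_coeff_0)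
qed

lemma mon_0_0_le_coeff: "mon 0 0 f \<le> v (\<iota> (poly.coeff f i))"
  using gauss_le[of 0 "emb f" i] by (simp add: mon_def pcompose_idR coeff_map_poly nat_times_Fin flip: zero_vinf_def)

lemma mon_0_0_attained: "\<exists>i. mon 0 0 f = v (\<iota> (poly.coeff f i))"
  using gauss_attained[of 0 "emb f"] by (simp add: mon_def pcompose_idR coeff_map_poly nat_times_Fin flip: zero_vinf_def)

text \<open>The unit ball contains the ball with integral center c and radius \<delta> \<ge> 0, and
  monomial valuations grow when the ball shrinks.\<close>

lemma mon_0_0_le_mon: "0 \<le> v c \<Longrightarrow> 0 \<le> \<delta> \<Longrightarrow> mon 0 0 f \<le> mon c \<delta> f"
  using mon_0_0_le_coeff[of f] unfolding mon_def[of c]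
  by (intro gauss_pcompose_ge gauss_linear) (auto simp: coeff_map_poly)

lemma mon_linear: "mon c \<delta> [:- d, 1:] = min (v (c - \<iota> d)) (Fin \<delta>)"
proof -
  have "emb [:- d, 1:] \<circ>\<^sub>p [:c, 1:] = [:c - \<iota> d, 1:]"
    by (simp add: map_poly_pCons pcompose_pCons)
  then show ?thesis by (simp add: mon_def gauss_def atMost_Suc atMost_0 insert_commute min.commute)
qed

lemma mon_0_0_defined_on_expansions:
  "defined_on_expansions (\<lambda>a. v (\<iota> (poly.coeff a 0))) [:0, 1:] 0 (mon 0 0)"
proof (rule mon.defined_on_expansionsI_le)
  show "mon 0 0 [:0, 1:] = 0" using mon_linear[of 0 0 0] by (simp add: zero_vinf_def)
  fix r :: "'k poly" assume "degree r < degree [:0, 1 :: 'k:]"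
  then obtain c where c: "r = [:c:]" by (auto elim: degree_eq_zeroE)
  show r: "mon 0 0 r = v (\<iota> (poly.coeff r 0))" by (simp add: c mon_def)
  show "mon 0 0 (q * [:0, 1:] + r) \<le> mon 0 0 r" for q
    using mon_le_value_center[of 0 0 "q * [:0, 1:] + r"] unfolding r by (simp add: c map_poly_pCons)
qed

end


section \<open>Construction of the chain\<close>

context valued_closure
begin

lemma value_group_base_diff:
  assumes "a \<in> value_group v (range \<iota>)" "b \<in> value_group v (range \<iota>)"
  shows "a - b \<in> value_group v (range \<iota>)"
proof -
  obtain x y where xy: "v (\<iota> x) = Fin a" "v (\<iota> y) = Fin b" using assms unfolding value_group_def by auto
  have "y \<noteq> 0" using xy by auto
  then have "v (\<iota> (x / y)) + v (\<iota> y) = v (\<iota> x)" by (simp flip: v.mult \<iota>_simps(2))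
  then have "v (\<iota> (x / y)) = Fin (a - b)" using xy by (cases "v (\<iota> (x / y))") auto
  then show ?thesis unfolding value_group_def by blast
qed

text \<open>A factor that vanishes at \<theta> has the full degree n, so the cofactor is a unit. The
  second conclusion concerns an arbitrary minimal polynomial because each chain brings its
  own.\<close>

lemma minimal_polynomialI:
  assumes nz: "\<And>g. g \<noteq> 0 \<Longrightarrow> degree g < n \<Longrightarrow> poly (emb g) \<theta> \<noteq> 0"
    and p: "lead_coeff p = 1" "degree p = n" "0 < n" "poly (emb p) \<theta> = 0"
  shows "is_minimal_polynomial \<iota> \<theta> p" "is_minimal_polynomial \<iota> \<theta> p' \<Longrightarrow> degree p' = n"
proof -
  have "p \<noteq> 0" using p by auto
  then have nu: "\<not> is_unit p" using p by (simp add: is_unit_iff_degree)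
  have "is_unit a \<or> is_unit b" if ab: "p = a * b" for a b
  proof -
    have *: "is_unit b" if "p = a * b" "poly (emb a) \<theta> = 0" for a b
    proof -
      have "a \<noteq> 0" "b \<noteq> 0" using that \<open>p \<noteq> 0\<close> by auto
      then have "n \<le> degree a" using nz that(2) by (meson not_le)
      moreover have "n = degree a + degree b"
        using that(1) p(2) \<open>a \<noteq> 0\<close> \<open>b \<noteq> 0\<close> by (simp add: degree_mult_eq)
      ultimately show ?thesis using \<open>b \<noteq> 0\<close> by (simp add: is_unit_iff_degree)
    qed
    have "poly (emb a) \<theta> = 0 \<or> poly (emb b) \<theta> = 0" using p(4) by (simp add: ab)
    then show ?thesis using *[of a b] *[of b a] ab by (auto simp: mult.commute)
  qed
  then have "Factorial_Ring.irreducible p"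
    using nu \<open>p \<noteq> 0\<close> by (intro Factorial_Ring.irreducibleI) auto
  then show "is_minimal_polynomial \<iota> \<theta> p" using p unfolding is_minimal_polynomial_def by auto
  assume p': "is_minimal_polynomial \<iota> \<theta> p'"
  have "poly (emb p') \<theta> = 0" using p' unfolding is_minimal_polynomial_def by simp
  then have "poly (emb (p' - p' div p * p)) \<theta> = 0" unfolding emb_simps using p(4) by simp
  then have "poly (emb (p' mod p)) \<theta> = 0" by (simp only: minus_div_mult_eq_mod)
  then have "p' mod p = 0" using nz[of "p' mod p"] degree_mod_less_pos[of p p'] p(2,3) by fastforce
  then have eq: "p' = p' div p * p" by (metis add.right_neutral div_mult_mod_eq)
  have "Factorial_Ring.irreducible p'" using p' unfolding is_minimal_polynomial_def by blast
  then have "is_unit (p' div p)" using eq nu by (metis Factorial_Ring.irreducibleD)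
  then have "p' div p \<noteq> 0" by auto
  then have "degree (p' div p) = 0" using is_unit_iff_degree \<open>is_unit (p' div p)\<close> by blast
  then show "degree p' = n"
    using eq p(2) \<open>p \<noteq> 0\<close> \<open>p' div p \<noteq> 0\<close> by (metis add_0 degree_mult_eq)
qed

lemma eval_defined_on_expansions:
  assumes "poly (emb p) \<theta> = 0"
    and "\<And>f. degree f < degree p \<Longrightarrow> eval_valuation \<iota> v \<theta> f = w f"
  shows "defined_on_expansions w p \<infinity> (eval_valuation \<iota> v \<theta>)"
proof -
  interpret \<nu>: poly_valuation "eval_valuation \<iota> v \<theta>"
    by (rule poly_valuation_of[OF eval_valuation_in_poly_valuations])
  show ?thesis using assms by (intro \<nu>.defined_on_expansionsI_le) (auto simp: eval_valuation_def)
qed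

text \<open>The monomial valuation is finite on \<open>p\<close> while evaluation at \<theta> gives
  \<infinity>, and the two agree in smaller degrees. So \<open>p\<close> has the least degree in
  which they differ, which is what makes it a key polynomial.\<close>

lemma eval_ordinary_augmentation:
  assumes p: "lead_coeff p = 1" "poly (emb p) \<theta> = 0"
    and le: "Fin \<delta> \<le> v (\<theta> - c)"
    and eq: "\<And>f. degree f < degree p \<Longrightarrow> mon c \<delta> f = eval_valuation \<iota> v \<theta> f"
  shows "ordinary_augmentation (mon c \<delta>) p \<infinity> (eval_valuation \<iota> v \<theta>)"
proof -
  have \<nu>: "poly_valuation (eval_valuation \<iota> v \<theta>)"
    by (rule poly_valuation_of[OF eval_valuation_in_poly_valuations])
  have "mon c \<delta> p < \<infinity>" using p(1) by (auto simp: mon_infty_iff)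
  then show ?thesis
    unfolding ordinary_augmentation_def
    using minimal_degree_key_polynomial[OF mon.poly_valuation_axioms \<nu> mon_le_eval[OF le] eq p(1)]
      eval_defined_on_expansions[OF p(2)] eq p(2)
    by (simp add: eval_valuation_def)
qed

end

text \<open>
  \<open>\<phi>\<close> is a monic integral polynomial with root \<open>\<eta>\<close>, whose reduction has a simple root at the residue
  of \<open>\<eta>\<close> and is the minimal polynomial of that residue.
\<close>
locale residual_root = valued_closure \<iota> v
  for \<iota> :: "'k::field \<Rightarrow> 'a::field" and v :: "'a \<Rightarrow> 'g::linordered_ab_group_add vinf" +
  fixes \<eta> :: 'a and \<phi> :: "'k poly" and Q :: "'a poly"
  assumes monic: "lead_coeff \<phi> = 1" and degree_pos: "0 < degree \<phi>"
    and integral: "0 \<le> v \<eta>" "\<And>i. 0 \<le> v (poly.coeff Q i)"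
    and factor: "map_poly \<iota> \<phi> = [:- \<eta>, 1:] * Q" and simple: "v (poly Q \<eta>) = 0"
    and residually_independent:
      "\<And>f i. degree f < degree \<phi> \<Longrightarrow> v (poly (map_poly \<iota> f) \<eta>) \<le> v (\<iota> (poly.coeff f i))"
begin

abbreviation "f\<^sub>0 \<equiv> degree \<phi>"

lemma root: "poly (emb \<phi>) \<eta> = 0"
  by (simp add: factor)

lemma value_center:
  assumes "degree f < f\<^sub>0"
  shows "v (poly (emb f) \<eta>) = mon 0 0 f"
proof (rule antisym)
  show "v (poly (emb f) \<eta>) \<le> mon 0 0 f"
    using mon_0_0_attained[of f] residually_independent[OF assms] by metis
  show "mon 0 0 f \<le> v (poly (emb f) \<eta>)"
    using mon_0_0_le_coeff[of f] integral by (intro poly_value_ge) (auto simp: coeff_map_poly)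
qed

lemma mon_center:
  assumes "degree f < f\<^sub>0" "0 \<le> \<delta>"
  shows "mon \<eta> \<delta> f = mon 0 0 f"
  using mon_0_0_le_mon[OF integral(1) assms(2)] mon_le_value_center[of \<eta> \<delta> f] value_center[OF assms(1)]
  by (metis antisym)

lemma value_near_center:
  assumes "degree f < f\<^sub>0" "0 < v (\<theta> - \<eta>)"
  shows "eval_valuation \<iota> v \<theta> f = mon 0 0 f"
proof (cases "f = 0")
  case False
  then have "mon 0 0 f \<noteq> \<infinity>" by (simp add: mon_infty_iff)
  then have "mon 0 0 f < v (poly (emb f) \<theta> - poly (emb f) \<eta>)"
    using mon_0_0_le_coeff[of f] integral assms(2) by (intro poly_value_diff_gt) (auto simp: coeff_map_poly)
  then have "v (poly (emb f) \<eta>) < v (poly (emb f) \<eta> - poly (emb f) \<theta>)"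
    using value_center[OF assms(1)] v.diff_commute by metis
  from v.eq_of_diff_gt[OF this] show ?thesis
    using value_center[OF assms(1)] by (simp add: eval_valuation_def)
qed (simp add: eval_valuation_def)

text \<open>Translated by \<eta>, the polynomial \<phi> becomes x times an integral polynomial whose
  constant term Q(\<eta>) is a unit. The second factor has value 0, and the value \<delta> is that
  of x.\<close>

lemma mon_key_value: "0 \<le> \<delta> \<Longrightarrow> mon \<eta> \<delta> \<phi> = Fin \<delta>"
proof -
  assume \<delta>: "0 \<le> \<delta>"
  have "emb \<phi> \<circ>\<^sub>p [:\<eta>, 1:] = [:0, 1:] * (Q \<circ>\<^sub>p [:\<eta>, 1:])"
    by (simp only: factor pcompose_mult) (simp add: pcompose_pCons)
  moreover have "gauss \<delta> [:0, 1:] = Fin \<delta>"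
    by (simp add: gauss_def atMost_Suc atMost_0 min_def)
  moreover have "gauss \<delta> (Q \<circ>\<^sub>p [:\<eta>, 1:]) = 0"
  proof (rule antisym)
    have "poly (Q \<circ>\<^sub>p [:\<eta>, 1:]) 0 = poly Q \<eta>" by (simp add: poly_pcompose)
    then show "gauss \<delta> (Q \<circ>\<^sub>p [:\<eta>, 1:]) \<le> 0"
      using gauss_le[of \<delta> "Q \<circ>\<^sub>p [:\<eta>, 1:]" 0] simple by (simp add: poly_0_coeff_0)
    show "0 \<le> gauss \<delta> (Q \<circ>\<^sub>p [:\<eta>, 1:])"
      using integral \<delta> by (intro gauss_pcompose_ge gauss_linear)
  qed
  ultimately show ?thesis by (simp only: mon_def gauss_mult) simp
qed

text \<open>Evaluation at \<eta> kills \<open>q * \<phi>\<close> and bounds the monomial valuation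
  from above, while on \<open>r\<close> the two coincide. This is the one-sided estimate that
  excludes cancellation.\<close>

lemma mon_defined_on_expansions:
  assumes "0 \<le> \<delta>"
  shows "defined_on_expansions (mon 0 0) \<phi> (Fin \<delta>) (mon \<eta> \<delta>)"
proof (rule mon.defined_on_expansionsI_le)
  fix q r :: "'k poly" assume r: "degree r < f\<^sub>0"
  then show "mon \<eta> \<delta> r = mon 0 0 r" using mon_center assms by blast
  then show "mon \<eta> \<delta> (q * \<phi> + r) \<le> mon \<eta> \<delta> r"
    using mon_le_value_center[of \<eta> \<delta> "q * \<phi> + r"] value_center[OF r] by (simp add: root)
qed (use mon_key_value assms in simp)

lemma mon_ordinary_augmentation:
  assumes "0 < \<delta>"
  shows "ordinary_augmentation (mon 0 0) \<phi> (Fin \<delta>) (mon \<eta> \<delta>)"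
proof -
  have "mon 0 0 \<phi> \<le> v (\<iota> (poly.coeff \<phi> f\<^sub>0))" by (rule mon_0_0_le_coeff)
  then have lt: "mon 0 0 \<phi> < Fin \<delta>" using monic assms by (simp add: zero_vinf_def) (meson less_vinf_simps(1) order_le_less_trans)
  have "\<phi> \<in> key_polynomials (mon 0 0)"
    using assms integral monic mon_0_0_le_mon mon_center mon_key_value lt
    by (intro minimal_degree_key_polynomial[where \<nu> = "mon \<eta> \<delta>"] mon.poly_valuation_axioms) auto
  then show ?thesis
    using lt mon_defined_on_expansions assms unfolding ordinary_augmentation_def by simp
qed

lemma monomial_value: "d < f\<^sub>0 \<Longrightarrow> mon 0 0 (monom 1 d) = 0"
  using mon_0_0_attained[of "monom 1 d"] mon_0_0_le_coeff[of "monom 1 d" d]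
  by (auto split: if_splits)

lemma monic_value_le: "lead_coeff g = 1 \<Longrightarrow> mon 0 0 g \<le> 0"
  using mon_0_0_le_coeff[of g "degree g"] by simp

lemma unramified_depth:
  assumes p: "lead_coeff p = 1" "degree p = f\<^sub>0" "poly (emb p) \<eta> = 0"
  shows "depth \<iota> v \<eta> \<le> 1"
proof -
  let ?\<nu> = "eval_valuation \<iota> v \<eta>"
  have \<nu>: "?\<nu> f = mon 0 0 f" if "degree f < f\<^sub>0" for f
    using that by (intro value_near_center) auto
  have nz: "poly (emb g) \<eta> \<noteq> 0" if "g \<noteq> 0" "degree g < f\<^sub>0" for g
    using \<nu>[OF that(2)] that(1) mon_infty_iff[of 0 0 g] by (auto simp: eval_valuation_def)
  note min = minimal_polynomialI[OF nz p(1,2) degree_pos p(3)]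
  interpret mlv: mlv_element \<iota> v \<eta> f\<^sub>0
  proof
    show "degree p' = f\<^sub>0" if "is_minimal_polynomial \<iota> \<eta> p'" for p'
      using min(2)[of p'] that by simp
    fix d assume d: "0 < d" "d < f\<^sub>0"
    show "\<exists>h. degree h = d \<and> lead_coeff h = 1 \<and>
      (\<forall>g. degree g = d \<longrightarrow> lead_coeff g = 1 \<longrightarrow> ?\<nu> g \<le> ?\<nu> h)"
      using d monomial_value monic_value_le by (intro exI[of _ "monom 1 d"]) (simp add: \<nu> degree_monom_eq)
  qed
  show ?thesis
  proof (cases "f\<^sub>0 = 1")
    \<comment> \<open>Degrees increase strictly along a chain, so a linear minimal polynomial leaves
      no room for the Gauss valuation on \<open>[:0, 1:]\<close>, and the chain has length
      0.\<close>
    case True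
    have "defined_on_expansions (\<lambda>a. v (\<iota> (poly.coeff a 0))) p \<infinity> ?\<nu>"
    proof (rule eval_defined_on_expansions[OF p(3)])
      fix f :: "'k poly" assume "degree f < degree p"
      then show "?\<nu> f = v (\<iota> (poly.coeff f 0))"
        using True p by (intro poly_valuations_const eval_valuation_in_poly_valuations) simp
    qed
    then have "mlv_chain \<iota> v \<eta> 0 (\<lambda>_. ?\<nu>) (\<lambda>_. p) (\<lambda>_. \<infinity>)"
      using p True min(1) eval_valuation_in_poly_valuations unfolding mlv_chain_def by simp
    from mlv.depth_eq[OF this] show ?thesis by simp
  next
    case False
    have "mon 0 0 \<in> poly_valuations \<iota> v" by (rule mon_in_poly_valuations[of 0 1]) (simp add: zero_vinf_def)
    moreover have "ordinary_augmentation (mon 0 0) p \<infinity> ?\<nu>"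
      using p integral(1) \<nu> by (intro eval_ordinary_augmentation) (auto simp: zero_vinf_def[symmetric])
    moreover have "(0 :: 'g vinf) \<in> Fin ` value_group v UNIV" using value_group_UNIV[of 1] by simp
    ultimately have "mlv_chain \<iota> v \<eta> 1 (\<lambda>k. if k = 0 then mon 0 0 else ?\<nu>) (\<lambda>k. if k = 0 then [:0, 1:] else p) (\<lambda>k. if k = 0 then 0 else \<infinity>)"
      using p False min(1) eval_valuation_in_poly_valuations mon_0_0_defined_on_expansions degree_pos
      unfolding mlv_chain_def by (auto simp: le_Suc_eq)
    from mlv.depth_eq[OF this] show ?thesis by simp
  qed
qed

context
  fixes \<delta> :: 'g and \<pi> \<theta> :: 'a and e :: nat
  assumes \<delta>: "0 < \<delta>" "v \<pi> = Fin \<delta>" and \<theta>: "\<theta> = \<eta> + \<pi>" and e: "0 < e"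
    and order: "\<And>i. 0 < i \<Longrightarrow> i < e \<Longrightarrow> (\<Sum>j<i. \<delta>) \<notin> value_group v (range \<iota>)"
begin

abbreviation (input) "\<nu> \<equiv> eval_valuation \<iota> v \<theta>"

lemma near: "0 < v (\<theta> - \<eta>)" "v (\<theta> - \<eta>) = Fin \<delta>"
  using \<delta> by (simp_all add: \<theta> zero_vinf_def)

text \<open>In \<phi>(\<theta>) = (\<theta> - \<eta>) Q(\<theta>) the second factor is still a unit:
  it differs from Q(\<eta>) by an element of positive value.\<close>

lemma key_value: "\<nu> \<phi> = Fin \<delta>"
proof -
  have "0 < v (poly Q \<theta> - poly Q \<eta>)"
    using integral near by (intro poly_value_diff_gt) auto
  then have "v (poly Q \<eta>) < v (poly Q \<eta> - poly Q \<theta>)" by (simp add: simple v.diff_commute)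
  then have "v (poly Q \<theta>) = 0" using v.eq_of_diff_gt simple by metis
  moreover have "poly (emb \<phi>) \<theta> = (\<theta> - \<eta>) * poly Q \<theta>" by (simp add: factor algebra_simps)
  ultimately show ?thesis using near by (simp add: eval_valuation_def v.mult)
qed

lemma eval_valuation_ring: "poly_valuation \<nu>"
  by (rule poly_valuation_of[OF eval_valuation_in_poly_valuations])

text \<open>The values of the terms of a \<open>\<phi>\<close>-expansion of length \<open>e\<close> lie in distinct cosets of \<open>vK\<close>.\<close>
lemma ramified_value:
  assumes "k \<le> e" "degree g < k * f\<^sub>0"
  shows "\<nu> g = mon \<eta> \<delta> g \<and> (g \<noteq> 0 \<longrightarrow> (\<exists>i<k. \<exists>c\<in>value_group v (range \<iota>). \<nu> g = Fin (c + (\<Sum>j<i. \<delta>))))"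
  using assms
proof (induction k arbitrary: g)
  case (Suc k)
  interpret \<nu>: poly_valuation \<nu> by (rule eval_valuation_ring)
  define q r where "q = g div \<phi>" and "r = g mod \<phi>"
  have g: "g = q * \<phi> + r" by (simp add: q_def r_def)
  have r: "degree r < f\<^sub>0" unfolding r_def by (rule degree_mod_less_pos[OF degree_pos])
  have \<nu>r: "\<nu> r = mon 0 0 r" by (rule value_near_center[OF r near(1)])
  have mon_g: "mon \<eta> \<delta> g = min (mon 0 0 r) (mon \<eta> \<delta> q + Fin \<delta>)"
    unfolding g using \<delta> by (intro defined_on_expansions_step[OF mon_defined_on_expansions r]) simp
  have val_r: "r \<noteq> 0 \<Longrightarrow> \<exists>c\<in>value_group v (range \<iota>). \<nu> r = Fin c"
  proof -
    assume "r \<noteq> 0"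
    obtain i where i: "mon 0 0 r = v (\<iota> (poly.coeff r i))" using mon_0_0_attained by blast
    moreover have "mon 0 0 r \<noteq> \<infinity>" using \<open>r \<noteq> 0\<close> by (simp add: mon_infty_iff)
    ultimately obtain c where "v (\<iota> (poly.coeff r i)) = Fin c" by (metis vinf.exhaust)
    then show ?thesis unfolding \<nu>r i value_group_def by blast
  qed
  show ?case
  proof (cases "q = 0")
    case True
    then have "g = r" by (simp add: g)
    moreover have "mon \<eta> \<delta> r = \<nu> r" using mon_center[OF r] \<delta> \<nu>r by simp
    ultimately show ?thesis using val_r by (auto intro!: exI[of _ 0])
  next
    case False
    have "\<phi> \<noteq> 0" using monic by auto
    then have dq: "degree (q * \<phi>) = degree q + f\<^sub>0" using False by (simp add: degree_mult_eq)
    have "degree g = degree (q * \<phi>)"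
      unfolding g using r dq by (intro degree_add_eq_left) simp
    then have "degree q < k * f\<^sub>0" using Suc.prems(2) dq by simp
    then obtain i c where ic: "\<nu> q = mon \<eta> \<delta> q" "i < k" "c \<in> value_group v (range \<iota>)" "\<nu> q = Fin (c + (\<Sum>j<i. \<delta>))"
      using Suc.IH[of q] Suc.prems(1) False by auto
    have \<nu>q: "\<nu> (q * \<phi>) = Fin (c + (\<Sum>j<Suc i. \<delta>))"
      unfolding \<nu>.mult key_value ic(4) by (simp add: add.assoc)
    \<comment> \<open>Equality would put (i + 1) \<delta> into vK. The multiple is covered by
      \<open>order\<close>, because i < k and k + 1 \<le> e give i + 1 < e.\<close>
    have neq: "\<nu> (q * \<phi>) \<noteq> \<nu> r"
    proof
      assume eq: "\<nu> (q * \<phi>) = \<nu> r"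
      then have "r \<noteq> 0" using \<nu>q by auto
      then obtain c' where c': "c' \<in> value_group v (range \<iota>)" "\<nu> r = Fin c'" using val_r by blast
      then have "(\<Sum>j<Suc i. \<delta>) = c' - c" using eq \<nu>q by (simp add: algebra_simps)
      then show False using order[of "Suc i"] value_group_base_diff[OF c'(1) ic(3)] ic(2) Suc.prems(1) by simp
    qed
    have \<nu>g: "\<nu> g = min (\<nu> (q * \<phi>)) (\<nu> r)" unfolding g by (rule \<nu>.add_neq[OF neq])
    then have "\<nu> g = mon \<eta> \<delta> g"
      using mon_g ic(1) key_value \<nu>r by (simp add: \<nu>.mult min.commute)
    moreover have "\<exists>i<Suc k. \<exists>c\<in>value_group v (range \<iota>). \<nu> g = Fin (c + (\<Sum>j<i. \<delta>))"
    proof (cases "\<nu> g = \<nu> (q * \<phi>)")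
      case True
      then show ?thesis using \<nu>q ic(2,3) by (intro exI[of _ "Suc i"]) auto
    next
      case False
      then have eq: "\<nu> g = \<nu> r" using \<nu>g by (auto simp: min_def split: if_splits)
      then have "r \<noteq> 0" using \<nu>g \<nu>q by (auto simp: min_def split: if_splits)
      then show ?thesis using val_r eq by (intro exI[of _ 0]) auto
    qed
    ultimately show ?thesis by blast
  qed
qed simp

lemma ramified_nonzero:
  assumes "g \<noteq> 0" "degree g < e * f\<^sub>0"
  shows "poly (emb g) \<theta> \<noteq> 0"
  using ramified_value[of e g] assms by (auto simp: eval_valuation_def)

text \<open>The maximum is attained at x^(d mod \<open>f\<^sub>0\<close>) \<phi>^(d div
  \<open>f\<^sub>0\<close>). For g = q \<phi> + r the minimum formula bounds the value of g by that
  of q plus \<delta>, and q is monic of degree d - \<open>f\<^sub>0\<close>, which reduces the claim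
  to smaller degree.\<close>

lemma ramified_max:
  assumes "d < e * f\<^sub>0"
  shows "\<exists>h. degree h = d \<and> lead_coeff h = 1 \<and>
      (\<forall>g. degree g = d \<longrightarrow> lead_coeff g = 1 \<longrightarrow> \<nu> g \<le> \<nu> h)"
  using assms
proof (induction d rule: less_induct)
  case (less d)
  interpret \<nu>: poly_valuation \<nu> by (rule eval_valuation_ring)
  show ?case
  proof (cases "d < f\<^sub>0")
    case True
    then show ?thesis using monomial_value monic_value_le value_near_center[OF _ near(1)]
      by (intro exI[of _ "monom 1 d"]) (simp add: degree_monom_eq)
  next
    case False
    then have "d - f\<^sub>0 < d" "d - f\<^sub>0 < e * f\<^sub>0" using degree_pos less.prems by auto
    then obtain h where h: "degree h = d - f\<^sub>0" "lead_coeff h = 1"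
      "\<And>g. degree g = d - f\<^sub>0 \<Longrightarrow> lead_coeff g = 1 \<Longrightarrow> \<nu> g \<le> \<nu> h"
      using less.IH by blast
    have nz: "h \<noteq> 0" "\<phi> \<noteq> 0" using h(2) monic by auto
    have "\<nu> g \<le> \<nu> (h * \<phi>)" if g: "degree g = d" "lead_coeff g = 1" for g
    proof -
      define q r where "q = g div \<phi>" and "r = g mod \<phi>"
      have gqr: "g = q * \<phi> + r" by (simp add: q_def r_def)
      have r: "degree r < f\<^sub>0" unfolding r_def by (rule degree_mod_less_pos[OF degree_pos])
      have q: "q \<noteq> 0" using gqr r g(1) False by auto
      have less: "degree r < degree (q * \<phi>)"
        using r q nz by (subst degree_mult_eq) auto
      have "degree g = degree (q * \<phi>)"
        unfolding gqr by (rule degree_add_eq_left[OF less])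
      then have dq: "degree q = d - f\<^sub>0" using g(1) q nz by (simp add: degree_mult_eq)
      have "lead_coeff g = lead_coeff (q * \<phi>)"
        unfolding gqr by (metis add.commute lead_coeff_add_le less)
      then have lq: "lead_coeff q = 1" using g(2) monic by (simp add: lead_coeff_mult)
      have dq': "degree q < e * f\<^sub>0" using dq less.prems by simp
      have "\<nu> g = mon \<eta> \<delta> g" using ramified_value[of e g] g(1) less.prems by simp
      also have "\<dots> \<le> mon \<eta> \<delta> q + Fin \<delta>"
        unfolding gqr using defined_on_expansions_step[OF mon_defined_on_expansions r, of \<delta> q] \<delta>(1) by simp
      also have "\<dots> = \<nu> q + Fin \<delta>" using ramified_value[of e q] dq' by simp
      also have "\<dots> \<le> \<nu> (h * \<phi>)" using h(3)[OF dq lq] key_value by (simp add: \<nu>.mult add_right_mono)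
      finally show ?thesis .
    qed
    moreover have "degree (h * \<phi>) = d" using h(1) nz False by (simp add: degree_mult_eq)
    moreover have "lead_coeff (h * \<phi>) = 1" using h(2) monic by (simp add: lead_coeff_mult)
    ultimately show ?thesis by blast
  qed
qed

lemma ramified_depth:
  assumes p: "lead_coeff p = 1" "degree p = e * f\<^sub>0" "poly (emb p) \<theta> = 0" and e1: "1 < e"
  shows "depth \<iota> v \<theta> \<le> 2"
proof -
  have pos: "0 < e * f\<^sub>0" using e degree_pos by simp
  note min = minimal_polynomialI[OF ramified_nonzero p(1,2) pos p(3)]
  interpret mlv: mlv_element \<iota> v \<theta> "e * f\<^sub>0"
    using min(2) ramified_max by unfold_locales auto
  have T: "mon 0 0 \<in> poly_valuations \<iota> v" "mon \<eta> \<delta> \<in> poly_valuations \<iota> v"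
    using mon_in_poly_valuations[of 0 1] mon_in_poly_valuations[of \<delta> \<pi>] \<delta> by (simp_all add: zero_vinf_def)
  have \<Gamma>: "(0 :: 'g vinf) \<in> Fin ` value_group v UNIV" "Fin \<delta> \<in> Fin ` value_group v UNIV"
    using value_group_UNIV[of 1] \<delta>(2) by (auto simp: zero_vinf_def value_group_def)
  have last: "ordinary_augmentation (mon \<eta> \<delta>) p \<infinity> \<nu>"
    using p near ramified_value[of e] by (intro eval_ordinary_augmentation) auto
  have f_lt: "f\<^sub>0 < e * f\<^sub>0" using e1 degree_pos by simp
  show ?thesis
  proof (cases "f\<^sub>0 = 1")
    \<comment> \<open>A linear \<phi> takes the place of the first polynomial of the chain, which
      therefore starts with the monomial valuation at \<eta> itself.\<close>
    case True
    have "defined_on_expansions (\<lambda>a. v (\<iota> (poly.coeff a 0))) \<phi> (Fin \<delta>) (mon \<eta> \<delta>)"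
    proof (rule mon.defined_on_expansionsI_le)
      fix q r :: "'k poly" assume r: "degree r < f\<^sub>0"
      show "mon \<eta> \<delta> r = v (\<iota> (poly.coeff r 0))"
        using r True by (intro poly_valuations_const T) simp
      show "mon \<eta> \<delta> (q * \<phi> + r) \<le> mon \<eta> \<delta> r"
        using mon_le_value_center[of \<eta> \<delta> "q * \<phi> + r"] value_center[OF r] mon_center[OF r] \<delta> by (simp add: root)
    qed (use mon_key_value \<delta> in simp)
    then have "mlv_chain \<iota> v \<theta> 1 (\<lambda>k. if k = 0 then mon \<eta> \<delta> else \<nu>) (\<lambda>k. if k = 0 then \<phi> else p) (\<lambda>k. if k = 0 then Fin \<delta> else \<infinity>)"
      using p True min(1) eval_valuation_in_poly_valuations T \<Gamma> monic last f_lt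
      unfolding mlv_chain_def by (auto simp: le_Suc_eq)
    from mlv.depth_eq[OF this] show ?thesis by simp
  next
    case False
    have "mlv_chain \<iota> v \<theta> 2 (\<lambda>k. if k = 0 then mon 0 0 else if k = 1 then mon \<eta> \<delta> else \<nu>)
      (\<lambda>k. if k = 0 then [:0, 1:] else if k = 1 then \<phi> else p) (\<lambda>k. if k = 0 then 0 else if k = 1 then Fin \<delta> else \<infinity>)"
      using p False min(1) eval_valuation_in_poly_valuations T \<Gamma> monic last f_lt degree_pos
        mon_0_0_defined_on_expansions mon_ordinary_augmentation[OF \<delta>(1)]
      unfolding mlv_chain_def by (auto simp: le_Suc_eq numeral_2_eq_2 less_Suc_eq)
    from mlv.depth_eq[OF this] show ?thesis by simp
  qed
qed

end

end


section \<open>The primitive element theorem\<close>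

lemma (in ring) finite_dimension_imp_finite:
  assumes "subfield K R" "finite K" "dimension n K E"
  shows "finite E"
proof -
  obtain Vs where Vs: "set Vs \<subseteq> carrier R" "Span K Vs = E"
    using exists_base[OF assms(1,3)] by blast
  have "E = (\<lambda>Ks. combine Ks Vs) ` {Ks. set Ks \<subseteq> K \<and> length Ks = length Vs}"
    unfolding Vs(2)[symmetric] Span_eq_combine_set_length_version[OF assms(1) Vs(1)] by blast
  then show ?thesis using finite_lists_length_eq[OF assms(2)] by simp
qed

locale closed_field = field +
  assumes closed: "p \<in> carrier (poly_ring R) \<Longrightarrow> 0 < length p - 1 \<Longrightarrow> \<exists>x. is_root p x"
begin

text \<open>The composition of p with \<zeta> - cX, built along the coefficient list, whose head
  belongs to the highest power. The calls of \<open>normalize\<close> are required because c or a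
  coefficient may vanish, and the list of a polynomial must not begin with zero.\<close>

lemma poly_affine_substitution:
  assumes M: "subfield M R" "\<zeta> \<in> M" "c \<in> M" and p: "set p \<subseteq> M"
  shows "\<exists>h\<in>carrier (M[X]). \<forall>y\<in>carrier R. eval h y = eval p (\<zeta> \<ominus> c \<otimes> y)"
proof -
  have MR: "subring M R" "M \<subseteq> carrier R" using subfieldE[OF M(1)] by auto
  then have mem: "a \<in> carrier R" if "a \<in> M" for a using that by blast
  interpret P: ring "M[X]" by (rule univ_poly_is_ring[OF MR(1)])
  have hom: "ring_hom_ring (M[X]) R (\<lambda>p. eval p y)" if "y \<in> carrier R" for y
    by (rule eval_ring_hom[OF MR(1) that])
  define l where "l = normalize [\<ominus> c, \<zeta>]"
  have "\<ominus> c \<in> M" using subringE(5)[OF MR(1) M(3)] .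
  then have l: "l \<in> carrier (M[X])" unfolding l_def univ_poly_carrier[symmetric]
    using M by (intro normalize_gives_polynomial) auto
  have el: "eval l y = \<zeta> \<ominus> c \<otimes> y" if "y \<in> carrier R" for y
    using that mem M \<open>\<ominus> c \<in> M\<close> unfolding l_def
    by (subst eval_normalize) (auto simp: a_minus_def l_minus a_comm)
  show ?thesis
    using p
  proof (induction p)
    case Nil
    then show ?case using P.zero_closed by (intro bexI[of _ "[]"]) (auto simp: univ_poly_zero)
  next
    case (Cons a p)
    then obtain h where h: "h \<in> carrier (M[X])" "\<And>y. y \<in> carrier R \<Longrightarrow> eval h y = eval p (\<zeta> \<ominus> c \<otimes> y)" by auto
    define k where "k = normalize [a]"
    have k: "k \<in> carrier (M[X])" unfolding k_def univ_poly_carrier[symmetric]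
      using Cons.prems by (intro normalize_gives_polynomial) auto
    have ek: "eval k y = a" if "y \<in> carrier R" for y
      using that Cons.prems mem unfolding k_def by (subst eval_normalize) auto
    let ?h = "k \<otimes>\<^bsub>M[X]\<^esub> (l [^]\<^bsub>M[X]\<^esub> length p) \<oplus>\<^bsub>M[X]\<^esub> h"
    have "eval ?h y = eval (a # p) (\<zeta> \<ominus> c \<otimes> y)" if y: "y \<in> carrier R" for y
    proof -
      interpret H: ring_hom_ring "M[X]" R "\<lambda>p. eval p y" by (rule hom[OF y])
      show ?thesis using k l h y by (simp add: ek el H.hom_nat_pow)
    qed
    moreover have "?h \<in> carrier (M[X])" using k l h by simp
    ultimately show ?case by blast
  qed
qed

text \<open>
  For infinite \<open>F\<close> take \<open>\<zeta> = \<alpha> + c\<beta>\<close> with \<open>c\<close> outside a finite set: over \<open>F(\<zeta>)\<close> the minimal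
  polynomial of \<open>\<beta>\<close> divides both that over \<open>F\<close> and \<open>Irr \<alpha>(\<zeta> - cX)\<close>, whose only common root is \<open>\<beta>\<close>.
\<close>
lemma primitive_element_pair:
  assumes F: "subfield F R" and E: "subfield E R" "F \<subseteq> E"
    and mem: "\<alpha> \<in> E" "\<beta> \<in> E" and alg: "(algebraic over F) \<alpha>" "(algebraic over F) \<beta>"
    and sep: "\<And>b. b \<in> carrier R \<Longrightarrow> alg_mult (Irr F \<beta>) b \<le> 1"
  shows "\<exists>\<zeta>\<in>E. \<alpha> \<in> simple_extension F \<zeta> \<and> \<beta> \<in> simple_extension F \<zeta>"
proof (cases "finite F")
  case True
  have in_R: "\<alpha> \<in> carrier R" "\<beta> \<in> carrier R" using mem subfieldE(3)[OF E(1)] by auto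
  have FR: "subring F R" using subfieldE(1)[OF F] .
  define A where "A = simple_extension F \<alpha>"
  have A: "subfield A R" "F \<subseteq> A" "\<alpha> \<in> A" "A \<subseteq> E"
    unfolding A_def using simple_extension_is_subfield[OF F in_R(1)] alg(1)
      simple_extension_incl[OF subfieldE(3)[OF F] in_R(1)] simple_extension_mem[OF FR in_R(1)]
      simple_extension_subring_incl[OF subfieldE(1)[OF E(1)] E(2) mem(1)] by auto
  define M where "M = simple_extension A \<beta>"
  have algA: "(algebraic over A) \<beta>" using algebraic_mono[OF A(2) alg(2)] .
  have M: "subfield M R" "A \<subseteq> M" "\<beta> \<in> M" "M \<subseteq> E"
    unfolding M_def using simple_extension_is_subfield[OF A(1) in_R(2)] algA
      simple_extension_incl[OF subfieldE(3)[OF A(1)] in_R(2)] simple_extension_mem[OF subfieldE(1)[OF A(1)] in_R(2)]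
      simple_extension_subring_incl[OF subfieldE(1)[OF E(1)] A(4) mem(2)] by auto
  have "finite A" using finite_dimension_imp_finite[OF F True] dimension_simple_extension[OF F in_R(1) alg(1)]
    unfolding A_def by blast
  then have fin: "finite M" using finite_dimension_imp_finite[OF A(1)] dimension_simple_extension[OF A(1) in_R(2) algA]
    unfolding M_def by blast
  interpret M: field "R\<lparr>carrier := M\<rparr>" by (rule subfield_iff(2)[OF M(1)])
  \<comment> \<open>Over a finite F the field F(\<alpha>, \<beta>) is finite, and a generator of its
    cyclic multiplicative group is primitive.\<close>
  obtain a where a: "a \<in> carrier (mult_of (R\<lparr>carrier := M\<rparr>))"
    "carrier (mult_of (R\<lparr>carrier := M\<rparr>)) = {a [^]\<^bsub>R\<lparr>carrier := M\<rparr>\<^esub> i | i::nat. i \<in> UNIV}"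
    using M.finite_field_mult_group_has_gen fin by auto
  then have aM: "a \<in> M" by simp
  then have aR: "a \<in> carrier R" using subfieldE(3)[OF M(1)] by blast
  have sub: "subring (simple_extension F a) R" by (rule simple_extension_is_subring[OF FR aR])
  have amem: "a \<in> simple_extension F a" by (rule simple_extension_mem[OF FR aR])
  have pow: "a [^]\<^bsub>R\<lparr>carrier := M\<rparr>\<^esub> (i::nat) \<in> simple_extension F a" for i
  proof (induction i)
    case 0
    then show ?case using subringE(3)[OF sub] by simp
  next
    case (Suc i)
    then show ?case using subringE(6)[OF sub Suc amem] by simp
  qed
  have "x \<in> simple_extension F a" if "x \<in> M" for x
  proof (cases "x = \<zero>")
    case True
    then show ?thesis using subringE(2)[OF sub] by simp
  next
    case False
    then have "x \<in> carrier (mult_of (R\<lparr>carrier := M\<rparr>))" using that by simp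
    then obtain i :: nat where "x = a [^]\<^bsub>R\<lparr>carrier := M\<rparr>\<^esub> i" unfolding a(2) by auto
    then show ?thesis using pow[of i] by simp
  qed
  then show ?thesis using aM A M by (intro bexI[of _ a]) auto
next
  case False
  have in_R: "\<alpha> \<in> carrier R" "\<beta> \<in> carrier R" using mem subfieldE(3)[OF E(1)] by auto
  have FR: "subring F R" "F \<subseteq> carrier R" using subfieldE[OF F] by auto
  have ER: "subring E R" using subfieldE[OF E(1)] by auto
  define p q where "p = Irr F \<alpha>" and "q = Irr F \<beta>"
  have p: "p \<in> carrier (F[X])" "pirreducible F p" "eval p \<alpha> = \<zero>"
    and q: "q \<in> carrier (F[X])" "pirreducible F q" "eval q \<beta> = \<zero>"
    using IrrE[OF F in_R(1) alg(1)] IrrE[OF F in_R(2) alg(2)] by (auto simp: p_def q_def)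
  have pne: "p \<noteq> []" "q \<noteq> []" using pirreducible_degree[OF F p(1,2)] pirreducible_degree[OF F q(1,2)] by auto
  have pR: "p \<in> carrier (poly_ring R)" "q \<in> carrier (poly_ring R)"
    using p(1) q(1) by (metis carrier_polynomial_shell[OF FR(1)])+
  \<comment> \<open>The excluded c are those for which \<zeta> - c b is again a root of p at some
    root b \<noteq> \<beta> of q: then \<zeta> - c b - \<alpha> = c (\<beta> - b), and c is the
    quotient.\<close>
  define S where "S = (\<lambda>(a, b). (a \<ominus> \<alpha>) \<otimes> inv (\<beta> \<ominus> b)) ` ({x. is_root p x} \<times> {x. is_root q x})"
  have "finite S" unfolding S_def using finite_number_of_roots pR by blast
  then obtain c where c: "c \<in> F" "c \<notin> S" using False by (metis finite_subset subsetI)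
  have cR: "c \<in> carrier R" using c FR by auto
  define \<zeta> where "\<zeta> = \<alpha> \<oplus> c \<otimes> \<beta>"
  have \<zeta>E: "\<zeta> \<in> E" unfolding \<zeta>_def
    by (rule subringE(7)[OF ER mem(1) subringE(6)[OF ER subsetD[OF E(2) c(1)] mem(2)]])
  have \<zeta>R: "\<zeta> \<in> carrier R" using in_R cR by (simp add: \<zeta>_def)
  have "subfield {x \<in> carrier R. (algebraic over F) x} R" by (rule subfield_of_algebraics[OF F])
  then have "subring {x \<in> carrier R. (algebraic over F) x} R" by (rule subfieldE)
  moreover have "(algebraic over F) c" using algebraic_self[OF FR(1) c(1)] .
  ultimately have \<zeta>alg: "(algebraic over F) \<zeta>"
    unfolding \<zeta>_def using in_R alg cR subringE(6,7)[of "{x \<in> carrier R. (algebraic over F) x}" R] by blast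
  define M where "M = simple_extension F \<zeta>"
  have M: "subfield M R" "F \<subseteq> M" "\<zeta> \<in> M"
    unfolding M_def using simple_extension_is_subfield[OF F \<zeta>R] \<zeta>alg
      simple_extension_incl[OF FR(2) \<zeta>R] simple_extension_mem[OF FR(1) \<zeta>R] by auto
  have MR: "subring M R" "M \<subseteq> carrier R" using subfieldE[OF M(1)] by auto
  have F_M: "carrier (F[X]) \<subseteq> carrier (M[X])"
    using M(2) unfolding univ_poly_def polynomial_def by auto
  have algM: "(algebraic over M) \<beta>" using algebraic_mono[OF M(2) alg(2)] .
  define m where "m = Irr M \<beta>"
  have m: "m \<in> carrier (M[X])" "pirreducible M m" "eval m \<beta> = \<zero>" "hd m = \<one>"
    using IrrE[OF M(1) in_R(2) algM] by (auto simp: m_def)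
  have mR: "m \<in> carrier (poly_ring R)" using m(1) by (rule carrier_polynomial_shell[OF MR(1)])
  have "set p \<subseteq> M" using p(1) M(2) unfolding univ_poly_carrier[symmetric] polynomial_def by auto
  then obtain h where h: "h \<in> carrier (M[X])" "\<And>y. y \<in> carrier R \<Longrightarrow> eval h y = eval p (\<zeta> \<ominus> c \<otimes> y)"
    using poly_affine_substitution[OF M(1,3)] c(1) M(2) by blast
  have "\<zeta> \<ominus> c \<otimes> \<beta> = \<alpha>" unfolding \<zeta>_def using in_R cR by algebra
  then have "eval h \<beta> = \<zero>" using h(2) in_R p(3) by simp
  then have mh: "m pdivides h" unfolding m_def by (rule Irr_minimal[OF M(1) in_R(2) algM h(1)])
  have mq: "m pdivides q" unfolding m_def
    using F_M q by (intro Irr_minimal[OF M(1) in_R(2) algM]) auto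
  have only: "b = \<beta>" if b: "is_root m b" for b
  proof (rule ccontr)
    assume neq: "b \<noteq> \<beta>"
    have bR: "b \<in> carrier R" "eval m b = \<zero>" using b unfolding is_root_def by auto
    have "eval q b = \<zero>" "eval h b = \<zero>"
      using pdivides_imp_root_sharing[OF mR _ bR(1) bR(2)] mh mq by auto
    then have "is_root q b" "is_root p (\<zeta> \<ominus> c \<otimes> b)"
      using h(2) bR pne cR \<zeta>R unfolding is_root_def by auto
    then have "((\<zeta> \<ominus> c \<otimes> b) \<ominus> \<alpha>) \<otimes> inv (\<beta> \<ominus> b) \<in> S" unfolding S_def by force
    moreover have "(\<zeta> \<ominus> c \<otimes> b) \<ominus> \<alpha> = c \<otimes> (\<beta> \<ominus> b)"
      unfolding \<zeta>_def using in_R cR bR by algebra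
    moreover have "\<beta> \<ominus> b \<noteq> \<zero>" using neq in_R bR r_right_minus_eq by auto
    ultimately have "c \<in> S" using in_R bR cR by (simp add: m_assoc field_Units)
    then show False using c by blast
  qed
  \<comment> \<open>All roots of m equal \<beta>. In degree greater than one, closedness would split
    off X - \<beta> twice from m, and hence from q, contrary to separability.\<close>
  have "length m - 1 = 1"
  proof (rule ccontr)
    assume "length m - 1 \<noteq> 1"
    then have len: "length m - 1 > 1" using pirreducible_degree[OF M(1) m(1,2)] by simp
    then have "m \<noteq> []" by auto
    interpret P: domain "poly_ring R" by (rule univ_poly_is_domain[OF carrier_is_subring])
    have lin: "[\<one>, \<ominus> \<beta>] \<in> carrier (poly_ring R)"
      unfolding univ_poly_carrier[symmetric] polynomial_def using in_R by auto
    have "is_root m \<beta>" using m(3) in_R \<open>m \<noteq> []\<close> unfolding is_root_def by blast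
    then have "[\<one>, \<ominus> \<beta>] pdivides m" by (rule is_root_imp_pdivides[OF mR])
    then obtain s where s: "s \<in> carrier (poly_ring R)" "m = [\<one>, \<ominus> \<beta>] \<otimes>\<^bsub>poly_ring R\<^esub> s"
      unfolding pdivides_def factor_def by blast
    have "s \<noteq> []" using s \<open>m \<noteq> []\<close> P.r_null[OF lin] by (auto simp: univ_poly_zero)
    then have "length m - 1 = 1 + (length s - 1)"
      using poly_mult_degree_eq[OF carrier_is_subring, of "[\<one>, \<ominus> \<beta>]" s] lin s
      by (simp add: univ_poly_carrier univ_poly_mult)
    then obtain b where b: "is_root s b" using closed[OF s(1)] len by auto
    then have bR: "b \<in> carrier R" "eval s b = \<zero>" unfolding is_root_def by auto
    have "eval m b = eval [\<one>, \<ominus> \<beta>] b \<otimes> eval s b"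
      using ring_hom_memE(2)[OF eval_is_hom[OF carrier_is_subring bR(1)] lin s(1)] s(2) by simp
    then have "eval m b = \<zero>" using bR in_R by simp
    then have "b = \<beta>" using only bR \<open>m \<noteq> []\<close> unfolding is_root_def by blast
    then have "[\<one>, \<ominus> \<beta>] pdivides s" using is_root_imp_pdivides[OF s(1)] b by simp
    then obtain t where t: "t \<in> carrier (poly_ring R)" "s = [\<one>, \<ominus> \<beta>] \<otimes>\<^bsub>poly_ring R\<^esub> t"
      unfolding pdivides_def factor_def by blast
    obtain u where u: "u \<in> carrier (poly_ring R)" "q = m \<otimes>\<^bsub>poly_ring R\<^esub> u"
      using mq unfolding pdivides_def factor_def by blast
    have "q = [\<one>, \<ominus> \<beta>] [^]\<^bsub>poly_ring R\<^esub> (2::nat) \<otimes>\<^bsub>poly_ring R\<^esub> (t \<otimes>\<^bsub>poly_ring R\<^esub> u)"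
      using lin t u s by (simp add: numeral_2_eq_2 P.m_assoc)
    then have "[\<one>, \<ominus> \<beta>] [^]\<^bsub>poly_ring R\<^esub> (2::nat) pdivides q"
      using t u unfolding pdivides_def factor_def by blast
    then have "2 \<le> alg_mult q \<beta>" by (rule alg_multE(2)[OF in_R(2) pR(2) pne(2)])
    then show False using sep[OF in_R(2)] unfolding q_def by simp
  qed
  then have "\<exists>a k. k \<in> M \<and> m = [a, k]" by (rule degree_oneE[OF m(1)]) blast
  then obtain a k where ak: "k \<in> M" "m = [a, k]" by blast
  then have k: "k \<in> M" "m = [\<one>, k]" using m(4) by auto
  then have kR: "k \<in> carrier R" using MR by blast
  have "\<beta> \<oplus> k = \<zero>" using m(3) k in_R kR by simp
  then have "\<beta> = \<ominus> k" using in_R kR by (simp add: minus_equality)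
  then have \<beta>M: "\<beta> \<in> M" using subringE(5)[OF MR(1) k(1)] by simp
  have "\<alpha> = \<zeta> \<ominus> c \<otimes> \<beta>" unfolding \<zeta>_def using in_R cR by algebra
  also have "\<dots> \<in> M" unfolding a_minus_def
    by (rule subringE(7)[OF MR(1) M(3) subringE(5)[OF MR(1) subringE(6)[OF MR(1) subsetD[OF M(2) c(1)] \<beta>M]]])
  finally show ?thesis using \<zeta>E \<beta>M unfolding M_def by blast
qed

text \<open>Choose \<zeta> with minimal polynomial of the largest degree, which exists because the
  degrees are bounded. For any \<beta>, a common generator \<xi> of \<zeta> and \<beta> has degree
  at most that of \<zeta>, so the powers of \<zeta> already span F(\<xi>).\<close>

theorem primitive_element:
  assumes F: "subfield F R" and E: "subfield E R" "F \<subseteq> E"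
    and alg: "\<And>a. a \<in> E \<Longrightarrow> (algebraic over F) a"
    and sep: "\<And>a b. a \<in> E \<Longrightarrow> b \<in> carrier R \<Longrightarrow> alg_mult (Irr F a) b \<le> 1"
    and bound: "\<And>a. a \<in> E \<Longrightarrow> length (Irr F a) - 1 \<le> N"
  shows "\<exists>\<zeta>\<in>E. E = simple_extension F \<zeta>"
proof -
  have ER: "subring E R" "E \<subseteq> carrier R" using subfieldE[OF E(1)] by auto
  define D where "D = (\<lambda>a. length (Irr F a) - 1) ` E"
  have "finite D" by (rule finite_subset[of _ "{..N}"]) (use bound in \<open>auto simp: D_def\<close>)
  moreover have "D \<noteq> {}" unfolding D_def using subringE(2)[OF ER(1)] by blast
  ultimately have "Max D \<in> D" by (rule Max_in)
  moreover have "d \<le> Max D" if "d \<in> D" for d using \<open>finite D\<close> that by (rule Max_ge)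
  ultimately obtain \<zeta> where \<zeta>: "\<zeta> \<in> E" "\<And>a. a \<in> E \<Longrightarrow> length (Irr F a) - 1 \<le> length (Irr F \<zeta>) - 1"
    unfolding D_def by auto
  have \<zeta>R: "\<zeta> \<in> carrier R" using \<zeta> ER by auto
  have "\<beta> \<in> simple_extension F \<zeta>" if \<beta>: "\<beta> \<in> E" for \<beta>
  proof -
    obtain \<xi> where \<xi>: "\<xi> \<in> E" "\<zeta> \<in> simple_extension F \<xi>" "\<beta> \<in> simple_extension F \<xi>"
      using primitive_element_pair[OF F E \<zeta>(1) \<beta> alg[OF \<zeta>(1)] alg[OF \<beta>] sep[OF \<beta>]] by blast
    have \<xi>R: "\<xi> \<in> carrier R" using \<xi> ER by auto
    let ?n = "length (Irr F \<xi>) - 1"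
    have dim: "dimension ?n F (simple_extension F \<xi>)"
      by (rule dimension_simple_extension[OF F \<xi>R alg[OF \<xi>(1)]])
    have sub: "subring (simple_extension F \<xi>) R" by (rule simple_extension_is_subring[OF subfieldE(1)[OF F] \<xi>R])
    have "\<zeta> [^] (i::nat) \<in> simple_extension F \<xi>" for i
      by (induction i) (use \<xi>(2) subringE(3,6)[OF sub] in auto)
    then have set: "set (exp_base \<zeta> (length (Irr F \<zeta>) - 1)) \<subseteq> simple_extension F \<xi>" by (auto simp: exp_base_def)
    have indep: "independent F (exp_base \<zeta> (length (Irr F \<zeta>) - 1))"
      by (rule exp_base_independent[OF F \<zeta>R alg[OF \<zeta>(1)]])
    have "length (exp_base \<zeta> (length (Irr F \<zeta>) - 1)) = ?n"
      using independent_length_le_dimension[OF F dim indep set] \<zeta>(2)[OF \<xi>(1)] by (simp add: exp_base_def)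
    then have "simple_extension F \<zeta> = simple_extension F \<xi>"
      using independent_length_eq_dimension[OF F dim indep set] Span_exp_base[OF F \<zeta>R alg[OF \<zeta>(1)]] by simp
    then show ?thesis using \<xi> by simp
  qed
  then show ?thesis
    using simple_extension_subring_incl[OF ER(1) E(2)] \<zeta>(1) by (intro bexI[of _ \<zeta>]) auto
qed

end


section \<open>Chevalley's extension theorem\<close>

lemma subring_closure_iff:
  "subring A \<Omega> \<longleftrightarrow> 1 \<in> A \<and> (\<forall>x\<in>A. - x \<in> A) \<and> (\<forall>x\<in>A. \<forall>y\<in>A. x + y \<in> A \<and> x * y \<in> A)"
  for A :: "'a::field set"
proof -
  interpret F: field "\<Omega> :: 'a ring" by (rule field_from_type_algebra)
  have uminus: "\<ominus>\<^bsub>\<Omega>\<^esub> x = - x" for x :: 'a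
    by (rule F.minus_equality) (auto simp: ring_of_type_algebra_def)
  show ?thesis
  proof
    assume A: "subring A \<Omega>"
    show "1 \<in> A \<and> (\<forall>x\<in>A. - x \<in> A) \<and> (\<forall>x\<in>A. \<forall>y\<in>A. x + y \<in> A \<and> x * y \<in> A)"
      using subringE(3,5,6,7)[OF A] unfolding uminus by (simp add: ring_of_type_algebra_def)
  next
    assume "1 \<in> A \<and> (\<forall>x\<in>A. - x \<in> A) \<and> (\<forall>x\<in>A. \<forall>y\<in>A. x + y \<in> A \<and> x * y \<in> A)"
    then show "subring A \<Omega>"
      by (intro F.subringI) (auto simp: uminus, auto simp: ring_of_type_algebra_def)
  qed
qed

context
  fixes A :: "'a::field set"
  assumes A: "subring A \<Omega>"
begin

lemma subring_one: "1 \<in> A" and subring_uminus: "x \<in> A \<Longrightarrow> - x \<in> A"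
  and subring_add: "x \<in> A \<Longrightarrow> y \<in> A \<Longrightarrow> x + y \<in> A" and subring_mult: "x \<in> A \<Longrightarrow> y \<in> A \<Longrightarrow> x * y \<in> A"
  using A unfolding subring_closure_iff by auto

lemma subring_zero: "0 \<in> A"
  using subring_add[OF subring_one subring_uminus[OF subring_one]] by simp

lemma subring_diff: "x \<in> A \<Longrightarrow> y \<in> A \<Longrightarrow> x - y \<in> A"
  using subring_add[of x "- y"] subring_uminus[of y] by simp

lemma subring_sum: "(\<And>i. i \<in> S \<Longrightarrow> f i \<in> A) \<Longrightarrow> sum f S \<in> A"
  by (induction S rule: infinite_finite_induct) (auto intro: subring_add subring_zero)

end

definition polys_over :: "'a::field set \<Rightarrow> 'a poly set" where
  "polys_over A = {q. \<forall>i. poly.coeff q i \<in> A}"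

lemma polys_over_pCons: "0 \<in> A \<Longrightarrow> pCons a q \<in> polys_over A \<longleftrightarrow> a \<in> A \<and> q \<in> polys_over A"
  unfolding polys_over_def by (auto simp: coeff_pCons split: nat.split)

context
  fixes A :: "'a::field set"
  assumes A: "subring A \<Omega>"
begin

lemma polys_over_add: "p \<in> polys_over A \<Longrightarrow> q \<in> polys_over A \<Longrightarrow> p + q \<in> polys_over A"
  and polys_over_uminus: "p \<in> polys_over A \<Longrightarrow> - p \<in> polys_over A"
  and polys_over_diff: "p \<in> polys_over A \<Longrightarrow> q \<in> polys_over A \<Longrightarrow> p - q \<in> polys_over A"
  and polys_over_mult: "p \<in> polys_over A \<Longrightarrow> q \<in> polys_over A \<Longrightarrow> p * q \<in> polys_over A"
  and polys_over_smult: "a \<in> A \<Longrightarrow> p \<in> polys_over A \<Longrightarrow> smult a p \<in> polys_over A"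
  and polys_over_one: "1 \<in> polys_over A"
  unfolding polys_over_def
  by (auto simp: coeff_1 coeff_mult intro: subring_add[OF A] subring_uminus[OF A] subring_diff[OF A] subring_zero[OF A]
      subring_one[OF A] intro!: subring_mult[OF A] subring_sum[OF A])

lemma polys_over_pcompose: "p \<in> polys_over A \<Longrightarrow> q \<in> polys_over A \<Longrightarrow> p \<circ>\<^sub>p q \<in> polys_over A"
proof (induction p)
  case (pCons a p)
  then have "a \<in> A" "p \<in> polys_over A" using polys_over_pCons[OF subring_zero[OF A]] by auto
  moreover have "[:a:] \<in> polys_over A"
    using \<open>a \<in> A\<close> subring_zero[OF A] by (auto simp: polys_over_def coeff_pCons split: nat.split)
  ultimately show ?case
    unfolding pcompose_pCons using pCons by (intro polys_over_add polys_over_mult) auto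
qed simp

lemma subring_adjoin: "subring ((\<lambda>q. poly q u) ` polys_over A) \<Omega>"
  unfolding subring_closure_iff
proof (intro conjI ballI)
  show "1 \<in> (\<lambda>q. poly q u) ` polys_over A" using polys_over_one by (intro image_eqI[of _ _ 1]) auto
  fix x assume "x \<in> (\<lambda>q. poly q u) ` polys_over A"
  then obtain p where p: "p \<in> polys_over A" "x = poly p u" by blast
  show "- x \<in> (\<lambda>q. poly q u) ` polys_over A"
    using p polys_over_uminus by (intro image_eqI[of _ _ "- p"]) auto
  fix y assume "y \<in> (\<lambda>q. poly q u) ` polys_over A"
  then obtain q where q: "q \<in> polys_over A" "y = poly q u" by blast
  show "x + y \<in> (\<lambda>q. poly q u) ` polys_over A" "x * y \<in> (\<lambda>q. poly q u) ` polys_over A"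
    using p q polys_over_add polys_over_mult
    by (intro image_eqI[of _ _ "p + q"] image_eqI[of _ _ "p * q"]; simp)+
qed

lemma subring_adjoin_incl: "A \<subseteq> (\<lambda>q. poly q u) ` polys_over A"
proof
  fix a assume "a \<in> A"
  then show "a \<in> (\<lambda>q. poly q u) ` polys_over A"
    using subring_zero[OF A] by (intro image_eqI[of _ _ "[:a:]"]) (auto simp: polys_over_def coeff_pCons split: nat.split)
qed

lemma subring_adjoin_mem: "u \<in> (\<lambda>q. poly q u) ` polys_over A"
  using subring_zero[OF A] subring_one[OF A]
  by (intro image_eqI[of _ _ "[:0, 1:]"]) (auto simp: polys_over_def coeff_pCons split: nat.split)

end

text \<open>The ideal generated by J in A, for an arbitrary set A. With J fixed it is monotone in A,
  and an element of the ideal over the union of a chain already lies in the ideal over one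
  member.\<close>

inductive_set ideal_span :: "'a::field set \<Rightarrow> 'a set \<Rightarrow> 'a set" for J A where
  zero: "0 \<in> ideal_span J A"
| step: "x \<in> ideal_span J A \<Longrightarrow> j \<in> J \<Longrightarrow> a \<in> A \<Longrightarrow> x + j * a \<in> ideal_span J A"

lemma ideal_span_mono: "A \<subseteq> B \<Longrightarrow> x \<in> ideal_span J A \<Longrightarrow> x \<in> ideal_span J B"
proof -
  assume "A \<subseteq> B"
  show "x \<in> ideal_span J A \<Longrightarrow> x \<in> ideal_span J B"
    by (induction rule: ideal_span.induct) (use \<open>A \<subseteq> B\<close> in \<open>auto intro: ideal_span.intros\<close>)
qed

lemma ideal_span_add: "x \<in> ideal_span J A \<Longrightarrow> y \<in> ideal_span J A \<Longrightarrow> x + y \<in> ideal_span J A"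
proof -
  assume "x \<in> ideal_span J A"
  show "y \<in> ideal_span J A \<Longrightarrow> x + y \<in> ideal_span J A"
    by (induction rule: ideal_span.induct)
      (use \<open>x \<in> ideal_span J A\<close> in \<open>auto simp: add.assoc[symmetric] intro: ideal_span.step\<close>)
qed

lemma ideal_span_sum: "(\<And>i. i \<in> S \<Longrightarrow> f i \<in> ideal_span J A) \<Longrightarrow> sum f S \<in> ideal_span J A"
  by (induction S rule: infinite_finite_induct) (auto intro: ideal_span_add ideal_span.zero)

lemma ideal_span_mult:
  assumes "subring A \<Omega>" "b \<in> A" "x \<in> ideal_span J A"
  shows "b * x \<in> ideal_span J A"
  using assms(3)
proof induction
  case (step x j a)
  have "b * x + j * (b * a) \<in> ideal_span J A"
    using step subring_mult[OF assms(1,2)] by (intro ideal_span.step) auto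
  then show ?case by (simp add: algebra_simps)
qed (simp add: ideal_span.zero)

lemma ideal_span_subset:
  assumes "subring A \<Omega>" "J \<subseteq> A" "x \<in> ideal_span J A"
  shows "x \<in> A"
  using assms(3) by induction (use assms(2) subring_zero[OF assms(1)] in \<open>auto intro!: subring_add[OF assms(1)] subring_mult[OF assms(1)]\<close>)

text \<open>Collect a combination with coefficients in A[u] by powers of u: the new coefficients are
  combinations over A.\<close>

lemma ideal_span_adjoin:
  assumes A: "subring A \<Omega>" and "x \<in> ideal_span J ((\<lambda>q. poly q u) ` polys_over A)"
  shows "\<exists>q\<in>polys_over (ideal_span J A). poly q u = x"
  using assms(2)
proof induction
  case zero
  then show ?case by (intro bexI[of _ 0]) (auto simp: polys_over_def ideal_span.zero)
next
  case (step x j a)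
  then obtain q p where q: "q \<in> polys_over (ideal_span J A)" "poly q u = x" and p: "p \<in> polys_over A" "a = poly p u" by blast
  have "q + smult j p \<in> polys_over (ideal_span J A)"
    using q(1) p(1) \<open>j \<in> J\<close> by (auto simp: polys_over_def intro: ideal_span.step)
  then show ?case using q p by (intro bexI[of _ "q + smult j p"]) auto
qed

text \<open>
  Of two relations \<open>q(u) = 1\<close> and \<open>q'(1/u) = 1\<close>, the one of larger degree can be shortened by means of
  the other.
\<close>
lemma ideal_span_one:
  fixes q q' :: "'a::field poly"
  assumes A: "subring A \<Omega>" "J \<subseteq> A"
    and "u \<noteq> 0" "q \<in> polys_over (ideal_span J A)" "q' \<in> polys_over (ideal_span J A)"
      "poly q u = 1" "poly q' (inverse u) = 1"
  shows "1 \<in> ideal_span J A"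
  using assms(3-)
proof (induction "degree q + degree q'" arbitrary: q q' u rule: less_induct)
  case less
  let ?I = "ideal_span J A"
  have main: "1 \<in> ?I"
    if qq: "degree q' \<le> degree q" "u \<noteq> 0" "q \<in> polys_over ?I" "q' \<in> polys_over ?I"
      "poly q u = 1" "poly q' (inverse u) = 1"
      and IH: "\<And>r. degree r < degree q \<Longrightarrow> r \<in> polys_over ?I \<Longrightarrow> poly r u = 1 \<Longrightarrow> 1 \<in> ?I"
    for q q' u
  proof (cases "degree q = 0")
    case True
    then obtain c where "q = [:c:]" by (elim degree_eq_zeroE)
    then show ?thesis using qq(3,5) unfolding polys_over_def by (auto dest: spec[of _ 0])
  next
    case False
    let ?n = "degree q" and ?m = "degree q'"
    let ?a = "poly.coeff q ?n" and ?b = "poly.coeff q'"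
    define s where "s = (\<Sum>i\<in>{1..?m}. monom (?b i) (?n - i))"
    \<comment> \<open>Write n for the degree of q, a for its leading coefficient and b_i for the
      coefficients of q'. The second relation gives (1 - b_0) u^n = \<Sum> b_i u^(n - i), the value
      of s at u. Multiplying the first relation by 1 - b_0 and replacing its top term a u^n in this
      way gives r(u) = 1 with degree less than n.\<close>
    define r where "r = [:?b 0:] + smult (1 - ?b 0) (q - monom ?a ?n) + smult ?a s"
    have bI: "?b i \<in> ?I" "poly.coeff q i \<in> ?I" for i using qq(3,4) by (auto simp: polys_over_def)
    then have bA: "?b i \<in> A" "poly.coeff q i \<in> A" for i using ideal_span_subset[OF A] by auto
    have "poly q' (inverse u) = ?b 0 + (\<Sum>i\<in>{1..?m}. ?b i * inverse u ^ i)"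
      unfolding poly_altdef by (subst sum.atMost_shift) (simp add: sum.atLeast1_atMost_eq lessThan_Suc_atMost)
    then have s1: "(\<Sum>i\<in>{1..?m}. ?b i * inverse u ^ i) = 1 - ?b 0" using qq(6) by (simp add: eq_diff_eq add.commute)
    have "poly s u = (\<Sum>i\<in>{1..?m}. u ^ ?n * (?b i * inverse u ^ i))"
      unfolding s_def poly_sum
    proof (rule sum.cong)
      fix i assume "i \<in> {1..?m}"
      then have "u ^ ?n = u ^ (?n - i) * u ^ i" using qq(1) by (simp flip: power_add)
      then show "poly (monom (?b i) (?n - i)) u = u ^ ?n * (?b i * inverse u ^ i)"
        using qq(2) by (simp add: poly_monom field_simps)
    qed simp
    also have "\<dots> = u ^ ?n * (1 - ?b 0)" by (simp only: s1 flip: sum_distrib_left)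
    finally have ps: "poly s u = u ^ ?n * (1 - ?b 0)" .
    have "poly r u = 1" using qq(5) by (simp add: r_def ps poly_monom algebra_simps)
    moreover have "r \<in> polys_over ?I"
      unfolding polys_over_def
    proof (intro CollectI allI)
      fix i
      have "poly.coeff [:?b 0:] i \<in> ?I" using bI ideal_span.zero by (auto simp: coeff_pCons split: nat.split)
      moreover have "(1 - ?b 0) * poly.coeff (q - monom ?a ?n) i \<in> ?I"
        using bI bA subring_diff[OF A(1) subring_one[OF A(1)]] ideal_span.zero
        by (intro ideal_span_mult[OF A(1)]) auto
      moreover have "?a * poly.coeff s i \<in> ?I"
        unfolding s_def coeff_sum using bI bA ideal_span.zero
        by (intro ideal_span_mult[OF A(1)] ideal_span_sum) auto
      ultimately show "poly.coeff r i \<in> ?I" unfolding r_def by (auto intro!: ideal_span_add)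
    qed
    moreover have "degree r < ?n"
    proof -
      have "poly.coeff r i = 0" if i: "?n \<le> i" for i
      proof -
        have "poly.coeff (q - monom ?a ?n) i = 0" using i by (cases "i = ?n") (auto simp: coeff_eq_0)
        moreover have "poly.coeff s i = 0" unfolding s_def coeff_sum using i False by (intro sum.neutral) auto
        moreover have "poly.coeff [:?b 0:] i = 0" using i False by (cases i) auto
        ultimately show ?thesis by (simp add: r_def)
      qed
      then show ?thesis using False by (metis degree_0 gr0I leading_coeff_0_iff not_le)
    qed
    ultimately show ?thesis using IH by blast
  qed
  show ?case
  proof (cases "degree q' \<le> degree q")
    case True
    show ?thesis
    proof (rule main[OF True less.prems])
      fix r assume "degree r < degree q" "r \<in> polys_over ?I" "poly r u = 1"
      then show "1 \<in> ?I" using less.prems by (intro less.hyps[of r q' u]) auto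
    qed
  next
    case False
    show ?thesis
    proof (rule main[of q q' "inverse u"])
      fix r assume "degree r < degree q'" "r \<in> polys_over ?I" "poly r (inverse u) = 1"
      then show "1 \<in> ?I" using less.prems by (intro less.hyps[of q r u]) auto
    qed (use False less.prems in auto)
  qed
qed

text \<open>Zorn's lemma gives a maximal subring above A in which J still generates a proper ideal.
  If neither u nor its inverse belonged to it, adjoining either would make J generate the unit
  ideal, and the two resulting relations contradict \<open>ideal_span_one\<close>.\<close>

theorem chevalley_extension:
  fixes A :: "'a::field set"
  assumes A: "subring A \<Omega>" "J \<subseteq> A" "1 \<notin> ideal_span J A"
  shows "\<exists>B. is_valuation_ring B \<and> A \<subseteq> B \<and> 1 \<notin> ideal_span J B"
proof -
  define S where "S = {B. subring B \<Omega> \<and> A \<subseteq> B \<and> 1 \<notin> ideal_span J B}"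
  have "\<exists>B\<in>S. \<forall>U\<in>S. B \<subseteq> U \<longrightarrow> U = B"
  proof (rule subset_Zorn_nonempty)
    show "S \<noteq> {}" using A by (auto simp: S_def)
    fix C assume C: "C \<noteq> {}" "subset.chain S C"
    then have CS: "C \<subseteq> S" and tot: "\<And>U Y. U \<in> C \<Longrightarrow> Y \<in> C \<Longrightarrow> U \<subseteq> Y \<or> Y \<subseteq> U"
      by (auto simp: subset.chain_def)
    have two: "\<exists>U\<in>C. x \<in> U \<and> y \<in> U" if "x \<in> \<Union>C" "y \<in> \<Union>C" for x y using that tot by blast
    have sub: "subring U \<Omega>" if "U \<in> C" for U using CS that by (auto simp: S_def)
    have "subring (\<Union>C) \<Omega>"
      unfolding subring_closure_iff
    proof (intro conjI ballI)
      show "1 \<in> \<Union>C" using C(1) sub subring_one by blast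
      fix x assume x: "x \<in> \<Union>C"
      then show "- x \<in> \<Union>C" using sub subring_uminus by blast
      fix y assume y: "y \<in> \<Union>C"
      show "x + y \<in> \<Union>C" "x * y \<in> \<Union>C" using two[OF x y] sub subring_add subring_mult by blast+
    qed
    moreover have "A \<subseteq> \<Union>C" using C(1) CS by (auto simp: S_def)
    moreover have "\<exists>U\<in>C. x \<in> ideal_span J U" if "x \<in> ideal_span J (\<Union>C)" for x
      using that
    proof induction
      case zero
      then show ?case using C(1) ideal_span.zero by blast
    next
      case (step x j a)
      then obtain U Y where XY: "U \<in> C" "x \<in> ideal_span J U" "Y \<in> C" "a \<in> Y" by blast
      then obtain Z where Z: "Z \<in> C" "U \<subseteq> Z" "Y \<subseteq> Z" using tot[of U Y] by blast
      then have "x + j * a \<in> ideal_span J Z"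
        using XY \<open>j \<in> J\<close> ideal_span_mono by (intro ideal_span.step) blast+
      then show ?case using Z by blast
    qed
    then have "1 \<notin> ideal_span J (\<Union>C)" using CS by (auto simp: S_def)
    ultimately show "\<Union>C \<in> S" by (simp add: S_def)
  qed
  then obtain B where B: "subring B \<Omega>" "A \<subseteq> B" "1 \<notin> ideal_span J B"
    and max: "\<And>U. U \<in> S \<Longrightarrow> B \<subseteq> U \<Longrightarrow> U = B" by (auto simp: S_def)
  have ext: "\<exists>q\<in>polys_over (ideal_span J B). poly q u = 1" if "u \<notin> B" for u
  proof -
    let ?U = "(\<lambda>q. poly q u) ` polys_over B"
    have "B \<subseteq> ?U" "?U \<noteq> B" "subring ?U \<Omega>"
      using subring_adjoin_incl[OF B(1)] subring_adjoin_mem[OF B(1), of u] subring_adjoin[OF B(1)] that by auto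
    then have "1 \<in> ideal_span J ?U" using max[of ?U] B(2) by (auto simp: S_def)
    from ideal_span_adjoin[OF B(1) this] show ?thesis .
  qed
  have "u \<in> B \<or> inverse u \<in> B" for u
  proof (rule ccontr)
    assume *: "\<not> (u \<in> B \<or> inverse u \<in> B)"
    then have "u \<noteq> 0" using subring_zero[OF B(1)] by auto
    then show False using ideal_span_one[OF B(1)] ext[of u] ext[of "inverse u"] * A(2) B(2,3) by blast
  qed
  then show ?thesis using B unfolding is_valuation_ring_def by blast
qed


section \<open>Hensel's lemma\<close>

text \<open>Division in \<open>'a poly\<close> is over the whole closure; the point here is that
  quotient and remainder keep their coefficients in L.\<close>

lemma polys_over_subfield_division:
  fixes L :: "'a::field set"
  assumes L: "subring L \<Omega>" "\<And>x. x \<in> L \<Longrightarrow> inverse x \<in> L"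
    and p: "p \<in> polys_over L" and g: "g \<in> polys_over L" "g \<noteq> 0"
  shows "\<exists>q\<in>polys_over L. \<exists>r\<in>polys_over L. p = q * g + r \<and> (r = 0 \<or> degree r < degree g)"
  using p
proof (induction p)
  case 0
  then show ?case by (intro bexI[of _ 0]) auto
next
  case (pCons a p)
  note z = subring_zero[OF L(1)]
  have "a \<in> L" "p \<in> polys_over L" using pCons.prems polys_over_pCons[OF z] by auto
  then obtain q r where qr: "q \<in> polys_over L" "r \<in> polys_over L" "p = q * g + r"
    "r = 0 \<or> degree r < degree g" using pCons.IH by blast
  let ?n = "degree g"
  define b where "b = poly.coeff (pCons a r) ?n / poly.coeff g ?n"
  have ar: "pCons a r \<in> polys_over L" using polys_over_pCons[OF z] qr(2) \<open>a \<in> L\<close> by blast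
  have b: "b \<in> L" unfolding b_def divide_inverse
    using ar g(1) L(2) by (intro subring_mult[OF L(1)]) (auto simp: polys_over_def)
  define s where "s = pCons a r - smult b g"
  have s: "s \<in> polys_over L" unfolding s_def using ar g(1) b
    by (intro polys_over_diff[OF L(1)] polys_over_smult[OF L(1)])
  have "degree (pCons a r) \<le> ?n" using qr(4) by (auto simp: degree_pCons_eq_if)
  then have "degree s \<le> ?n" unfolding s_def
    by (intro degree_diff_le) (auto intro: order_trans[OF degree_smult_le])
  moreover have "poly.coeff s ?n = 0" using g(2) by (simp add: s_def b_def)
  ultimately have "s = 0 \<or> degree s < ?n"
    by (metis leading_coeff_0_iff le_neq_implies_less)
  moreover have "pCons a p = (pCons b q) * g + s" by (simp add: s_def qr(3) algebra_simps)
  moreover have "pCons b q \<in> polys_over L" using polys_over_pCons[OF z] b qr(1) by blast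
  ultimately show ?case using s by blast
qed

locale henselian_closure = valued_closure \<iota> v
  for \<iota> :: "'k::field \<Rightarrow> 'a::alg_closed_field" and v :: "'a \<Rightarrow> 'g::linordered_ab_group_add vinf" +
  assumes henselian: "henselian \<iota> v"
begin

lemma valuation_ring_subring: "subring (valuation_ring v) \<Omega>"
  unfolding subring_closure_iff valuation_ring_def
  by (auto simp: v.mult intro: v.add_ge)

text \<open>
  The residue ring of \<open>\<O>\<^sub>L[y]\<close> modulo the ideal generated by \<open>y - c\<close> and \<open>\<mm>\<^sub>L\<close> is nonzero, as \<open>y\<close>
  satisfies no relation over \<open>L\<close> that \<open>x\<close> does not satisfy; by uniqueness of the extension, the valuation
  ring of \<open>v\<close> dominates it.
\<close>
lemma conjugate_value:
  assumes L: "subring L \<Omega>" "range \<iota> \<subseteq> L" "c \<in> L"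
    and conj: "\<And>p. p \<in> polys_over L \<Longrightarrow> poly p y = 0 \<Longrightarrow> poly p x = 0"
    and x: "0 < v (x - c)"
  shows "0 < v (y - c)"
proof -
  define O_L where "O_L = L \<inter> valuation_ring v"
  \<comment> \<open>The nonzero elements of J cannot be units in a ring where J generates a proper
    ideal; including y - c among them is what finally makes its value positive.\<close>
  define J where "J = insert (y - c) {l \<in> L. 0 < v l}"
  define A where "A = (\<lambda>q. poly q (y - c)) ` polys_over O_L"
  have O_L: "subring O_L \<Omega>"
    using L(1) valuation_ring_subring unfolding O_L_def subring_closure_iff by auto
  have A: "subring A \<Omega>" "O_L \<subseteq> A" "y - c \<in> A"
    unfolding A_def using subring_adjoin[OF O_L] subring_adjoin_incl[OF O_L] subring_adjoin_mem[OF O_L] by auto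
  have JA: "J \<subseteq> A" using A unfolding J_def O_L_def valuation_ring_def by auto
  have span: "\<exists>q\<in>polys_over O_L. poly q (y - c) = z \<and> 0 < v (poly.coeff q 0)" if "z \<in> ideal_span J A" for z
    using that
  proof induction
    case zero
    then show ?case using subring_zero[OF O_L] by (intro bexI[of _ 0]) (auto simp: polys_over_def)
  next
    case (step z j a)
    then obtain q p where q: "q \<in> polys_over O_L" "poly q (y - c) = z" "0 < v (poly.coeff q 0)"
      and p: "p \<in> polys_over O_L" "a = poly p (y - c)" unfolding A_def by blast
    show ?case
    proof (cases "j = y - c")
      case True
      have "q + pCons 0 p \<in> polys_over O_L"
        using q p subring_zero[OF O_L] polys_over_pCons[of O_L 0 p] by (intro polys_over_add[OF O_L]) auto
      then show ?thesis using q p True by (intro bexI[of _ "q + pCons 0 p"]) (auto simp: algebra_simps)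
    next
      case False
      then have j: "j \<in> L" "0 < v j" using step.hyps unfolding J_def by auto
      then have "q + smult j p \<in> polys_over O_L"
        using q p by (intro polys_over_add[OF O_L] polys_over_smult[OF O_L]) (auto simp: O_L_def valuation_ring_def)
      moreover have "0 \<le> v (poly.coeff p 0)" using p(1) by (auto simp: polys_over_def O_L_def valuation_ring_def)
      then have "0 < v (poly.coeff (q + smult j p) 0)"
        using q(3) j(2) vinf_add_strict_mono[of 0 "v j" 0 "v (poly.coeff p 0)"]
        by (auto simp: v.mult intro!: v.add_gt)
      ultimately show ?thesis using q p by (intro bexI[of _ "q + smult j p"]) auto
    qed
  qed
  have "1 \<notin> ideal_span J A"
  proof
    assume "1 \<in> ideal_span J A"
    then obtain q where q: "q \<in> polys_over O_L" "poly q (y - c) = 1" "0 < v (poly.coeff q 0)" using span by blast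
    \<comment> \<open>The relation q(y - c) = 1 is a relation over L for y and so also holds for x.
      There it is impossible: x - c and the constant term of q both have positive value.\<close>
    define p where "p = (q \<circ>\<^sub>p [:- c, 1:]) - 1"
    have "q \<in> polys_over L" using q(1) by (auto simp: polys_over_def O_L_def)
    moreover have "[:- c, 1:] \<in> polys_over L"
      using L(3) subring_uminus[OF L(1)] subring_one[OF L(1)] subring_zero[OF L(1)]
      by (auto simp: polys_over_def coeff_pCons split: nat.split)
    ultimately have "p \<in> polys_over L"
      unfolding p_def by (intro polys_over_diff[OF L(1)] polys_over_pcompose[OF L(1)] polys_over_one[OF L(1)])
    then have "poly p x = 0" using q(2) by (intro conj) (auto simp: p_def poly_pcompose)
    then have "poly q (x - c) = 1" by (simp add: p_def poly_pcompose)
    moreover have "0 < v (poly q (x - c))"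
    proof -
      obtain a q' where q': "q = pCons a q'" by (cases q) auto
      have "0 \<le> v (poly.coeff q i)" for i using q(1) by (auto simp: polys_over_def O_L_def valuation_ring_def)
      then have "0 \<le> v (poly.coeff q' i)" for i unfolding q' by (metis coeff_pCons_Suc)
      then have "0 \<le> v (poly q' (x - c))" using x by (intro poly_value_ge) auto
      then have "0 < v ((x - c) * poly q' (x - c))"
        using x vinf_add_strict_mono[of 0 "v (x - c)" 0 "v (poly q' (x - c))"] by (simp add: v.mult)
      then show ?thesis using q(3) by (auto simp: q' intro!: v.add_gt)
    qed
    ultimately show False by simp
  qed
  from chevalley_extension[OF A(1) JA this]
  obtain B where B: "is_valuation_ring B" "A \<subseteq> B" "1 \<notin> ideal_span J B" by blast
  have subB: "subring B \<Omega>" using B(1) unfolding is_valuation_ring_def by blast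
  have unit: "inverse j \<notin> B" if "j \<in> J" "j \<noteq> 0" for j
    using ideal_span.step[OF ideal_span.zero that(1), of "inverse j" B] B(3) that(2) by auto
  \<comment> \<open>If an element of K in B had negative value, its inverse would belong to J and be
    a unit of B.\<close>
  have "B \<inter> range \<iota> = valuation_ring v \<inter> range \<iota>"
  proof (intro equalityI subsetI IntI)
    fix a assume a: "a \<in> B \<inter> range \<iota>"
    then show "a \<in> range \<iota>" by simp
    show "a \<in> valuation_ring v"
    proof (rule ccontr)
      assume "a \<notin> valuation_ring v"
      then have neg: "v a < 0" by (simp add: valuation_ring_def)
      then have "a \<noteq> 0" by auto
      then have sum: "v (inverse a) + v a = 0" by (simp flip: v.mult)
      have "0 < v (inverse a)"
        using sum neg by (cases "v a"; cases "v (inverse a)") (auto simp: zero_vinf_def add_eq_0_iff)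
      moreover have "inverse a \<in> L" using a L(2) \<iota>_inverse by (metis IntE image_subset_iff imageE rangeI)
      ultimately have "inverse a \<in> J" by (simp add: J_def)
      then show False using unit[of "inverse a"] a \<open>a \<noteq> 0\<close> by simp
    qed
  next
    fix a assume a: "a \<in> valuation_ring v \<inter> range \<iota>"
    then show "a \<in> range \<iota>" by simp
    show "a \<in> B" using a L(2) A(2) B(2) unfolding O_L_def by blast
  qed
  then have Bv: "B = valuation_ring v" using henselian B(1) unfolding henselian_def by blast
  show ?thesis
  proof (cases "y = c")
    case False
    have "0 \<le> v (y - c)" using A(3) B(2) Bv by (auto simp: valuation_ring_def)
    moreover have "v (y - c) \<noteq> 0"
    proof
      assume 0: "v (y - c) = 0"
      have "v (inverse (y - c)) + v (y - c) = 0" using False by (simp flip: v.mult)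
      then have "inverse (y - c) \<in> B" using 0 by (simp add: Bv valuation_ring_def)
      then show False using unit[of "y - c"] False by (simp add: J_def)
    qed
    ultimately show ?thesis by simp
  qed simp
qed

text \<open>By Gauss's lemma the value of P is the sum of the values of its two factors. Both
  factors are monic, so neither value is positive; as the sum is nonnegative, both are 0.\<close>

lemma linear_quotient_integral:
  assumes "P = [:- a, 1:] * Q" "\<And>i. 0 \<le> v (poly.coeff P i)" "lead_coeff P = 1"
  shows "0 \<le> v a" "\<And>i. 0 \<le> v (poly.coeff Q i)"
proof -
  have val: "v x = v x + 0 \<cdot> Fin 0" "v x = v x + i \<cdot> Fin 0" for x i by (simp_all add: nat_times_Fin flip: zero_vinf_def)
  have ge: "0 \<le> gauss 0 P" using assms(2) val(2) by (metis gauss_ge)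
  have lin: "gauss 0 [:- a, 1:] = min (v a) 0"
    by (simp add: gauss_def atMost_Suc atMost_0 nat_times_Fin min.commute flip: zero_vinf_def)
  have sum: "gauss 0 P = min (v a) 0 + gauss 0 Q" unfolding assms(1) gauss_mult lin ..
  have "lead_coeff Q = 1" using assms(1,3) by (simp add: lead_coeff_mult del: mult_pCons_left)
  then have Q: "gauss 0 Q \<le> 0" using gauss_le[of 0 Q "degree Q"] val(2) by (metis v.one)
  have "0 \<le> min (v a) 0 + gauss 0 Q" using ge sum by simp
  also have "\<dots> \<le> min (v a) 0 + 0" using Q by (rule add_left_mono)
  finally show a: "0 \<le> v a" by simp
  then have "0 \<le> gauss 0 Q" using ge unfolding sum by (simp add: min_def split: if_splits)
  then show "0 \<le> v (poly.coeff Q i)" for i using gauss_le[of 0 Q i] val(2) by (metis order_trans)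
qed

text \<open>As P(c) is the product of the c - x over the roots x, some root a satisfies v(a - c) >
  0. If the least relation g of a over L were not linear, the cofactor of X - a in g would have a
  root b, and \<open>conjugate_value\<close> would put b near c and hence near a. This contradicts
  the residual simplicity of a; the case b = a is included.\<close>

theorem hensel_root:
  assumes L: "subring L \<Omega>" "\<And>x. x \<in> L \<Longrightarrow> inverse x \<in> L" "range \<iota> \<subseteq> L"
    and P: "P \<in> polys_over L" "lead_coeff P = 1" "\<And>i. 0 \<le> v (poly.coeff P i)"
    and simple: "\<And>a Q. P = [:- a, 1:] * Q \<Longrightarrow> v (poly Q a) = 0"
    and c: "c \<in> L" "0 < v (poly P c)"
  shows "\<exists>a\<in>L. poly P a = 0 \<and> 0 < v (a - c)"
proof -
  obtain A where A: "size A = degree P" "P = smult 1 (\<Prod>x\<in>#A. [:- x, 1:])"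
    using alg_closed_imp_factorization[of P] P(2) by (metis leading_coeff_0_iff zero_neq_one)
  have "\<exists>a. poly P a = 0 \<and> 0 < v (a - c)"
  proof (rule ccontr)
    assume none: "\<not> ?thesis"
    have "v (\<Prod>x\<in>#B. (c - x)) \<le> 0" if "B \<subseteq># A" for B
      using that
    proof (induction B)
      case (add x B)
      then have "x \<in># A" by (meson mset_subset_eqD union_single_eq_member)
      then have "poly P x = 0" by (auto simp: A(2) poly_prod_mset)
      then have "v (c - x) \<le> 0" using none v.diff_commute[of c x] by (metis not_le)
      moreover have "B \<subseteq># A" using add.prems by (metis insert_subset_eq_iff subset_mset.order_trans diff_subset_eq_self)
      then have "v (\<Prod>x\<in>#B. (c - x)) \<le> 0" by (rule add.IH)
      ultimately have "v (c - x) + v (\<Prod>x\<in>#B. (c - x)) \<le> 0 + 0" by (rule add_mono)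
      then show ?case by (simp add: v.mult)
    qed simp
    from this[of A] show False using c(2) by (simp add: A(2) poly_prod_mset)
  qed
  then obtain a where a: "poly P a = 0" "0 < v (a - c)" by blast
  define rel where "rel z p \<longleftrightarrow> p \<in> polys_over L \<and> p \<noteq> 0 \<and> poly p z = 0" for z p
  have least: "\<exists>g. rel z g \<and> (\<forall>p\<in>polys_over L. poly p z = 0 \<longrightarrow> (\<exists>q\<in>polys_over L. p = q * g))
     \<and> (\<forall>p. rel z p \<longrightarrow> degree g \<le> degree p)" if ex: "rel z p0" for z p0
  proof -
    obtain g where g: "rel z g" "\<And>p. rel z p \<Longrightarrow> degree g \<le> degree p"
      using ex_has_least_nat[of "rel z" p0 degree] ex by blast
    have "\<exists>q\<in>polys_over L. p = q * g" if p: "p \<in> polys_over L" "poly p z = 0" for p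
    proof -
      obtain q r where qr: "q \<in> polys_over L" "r \<in> polys_over L" "p = q * g + r"
        "r = 0 \<or> degree r < degree g"
        using polys_over_subfield_division[OF L(1,2) p(1)] g(1) unfolding rel_def by blast
      have "poly r z = 0" using p(2) g(1) qr(3) unfolding rel_def by simp
      then have "r = 0" using g(2)[of r] qr(2,4) unfolding rel_def by fastforce
      then show ?thesis using qr by auto
    qed
    then show ?thesis using g by blast
  qed
  have "P \<noteq> 0" using P(2) by auto
  then obtain g where g: "rel a g" "\<And>p. p \<in> polys_over L \<Longrightarrow> poly p a = 0 \<Longrightarrow> \<exists>q\<in>polys_over L. p = q * g"
    "\<And>p. rel a p \<Longrightarrow> degree g \<le> degree p"
    using least[of a P] P(1) a(1) unfolding rel_def by blast
  obtain s where s: "P = s * g" using g(2)[OF P(1) a(1)] by blast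
  obtain g' where g': "g = [:- a, 1:] * g'" using g(1) unfolding rel_def by (metis dvdE poly_eq_0_iff_dvd)
  have "g \<noteq> 0" using g(1) rel_def by blast
  then have "g' \<noteq> 0" using g' by auto
  then have dg: "degree g = Suc (degree g')" unfolding g' by (subst degree_mult_eq) auto
  have PQ: "P = [:- a, 1:] * (s * g')" using s g' by (simp only: ac_simps)
  have Qa: "v (poly (s * g') a) = 0" by (rule simple[OF PQ])
  have "degree g' = 0"
  proof (rule ccontr)
    assume "degree g' \<noteq> 0"
    then obtain b where b: "poly g' b = 0" using alg_closed_imp_poly_has_root[of g'] by auto
    then have gb: "poly g b = 0" unfolding g' by simp
    \<comment> \<open>Irreducibility of g enters here: in g = k h the cofactor k has smaller degree
      than g and cannot vanish at a, so h does, and every relation of b over L holds for a.\<close>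
    then obtain h where h: "rel b h" "\<And>p. p \<in> polys_over L \<Longrightarrow> poly p b = 0 \<Longrightarrow> \<exists>q\<in>polys_over L. p = q * h"
      using least[of b g] g(1) unfolding rel_def by blast
    obtain k where k: "k \<in> polys_over L" "g = k * h" using h(2)[of g] gb g(1) unfolding rel_def by blast
    have nz: "k \<noteq> 0" "h \<noteq> 0" using k \<open>g \<noteq> 0\<close> by auto
    have "degree h \<noteq> 0"
    proof
      assume "degree h = 0"
      then obtain e where "h = [:e:]" by (elim degree_eq_zeroE)
      then show False using h(1) unfolding rel_def by simp
    qed
    then have "degree k < degree g" using k nz by (simp add: degree_mult_eq)
    then have "poly k a \<noteq> 0" using g(3)[of k] k nz unfolding rel_def by auto
    then have ha: "poly h a = 0" using g(1) k(2) unfolding rel_def by auto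
    have "0 < v (b - c)"
    proof (rule conjugate_value[OF L(1,3) c(1) _ a(2)])
      fix p assume "p \<in> polys_over L" "poly p b = 0"
      then obtain q where "p = q * h" using h(2) by blast
      then show "poly p a = 0" using ha by simp
    qed
    then have "0 < v (a - b)" using v.diff_gt[OF a(2), of "b - c"] by simp
    moreover have int: "0 \<le> v a" "0 \<le> v (poly.coeff (s * g') i)" for i
      using linear_quotient_integral[OF PQ P(3,2)] by auto
    moreover have "0 \<le> v b"
    proof -
      obtain Q where "P = [:- b, 1:] * Q"
        using s gb by (metis dvdE mult_zero_right poly_eq_0_iff_dvd poly_mult)
      from linear_quotient_integral(1)[OF this P(3,2)] show ?thesis .
    qed
    ultimately have "0 < v (poly (s * g') a - poly (s * g') b)"
      by (intro poly_value_diff_gt) auto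
    then show False using Qa b by simp
  qed
  then obtain d where d: "g' = [:d:]" by (elim degree_eq_zeroE)
  have "d \<noteq> 0" using \<open>g' \<noteq> 0\<close> d by auto
  have "g \<in> polys_over L" using g(1) rel_def by blast
  then have "poly.coeff g 0 \<in> L" "poly.coeff g 1 \<in> L" unfolding polys_over_def by blast+
  then have "- (a * d) \<in> L" "d \<in> L" by (simp_all add: g' d mult.commute[of a])
  then have "- (- (a * d)) * inverse d \<in> L" using subring_mult[OF L(1) subring_uminus[OF L(1)] L(2)] by blast
  then have "a \<in> L" using \<open>d \<noteq> 0\<close> by (simp add: mult.assoc)
  then show ?thesis using a by blast
qed

end


section \<open>The residue field\<close>

lemma closure_ring_simps [simp]:
  "x \<otimes>\<^bsub>\<Omega>\<^esub> y = x * y" "x \<oplus>\<^bsub>\<Omega>\<^esub> y = x + y" "\<one>\<^bsub>\<Omega>\<^esub> = 1" "\<zero>\<^bsub>\<Omega>\<^esub> = 0" "carrier \<Omega> = UNIV"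
  by (simp_all add: ring_of_type_algebra_def)

section \<open>Coefficient lists, leading coefficient first, and polynomials\<close>

lemma coeffs_Poly_rev: "cs \<noteq> [] \<Longrightarrow> hd cs \<noteq> 0 \<Longrightarrow> coeffs (Poly (rev cs)) = rev cs"
  by (cases cs) auto

lemma degree_Poly_rev: "cs \<noteq> [] \<Longrightarrow> hd cs \<noteq> 0 \<Longrightarrow> degree (Poly (rev cs)) = length cs - 1"
  by (metis coeffs_Poly_rev degree_eq_length_coeffs length_rev)

lemma lead_coeff_Poly_rev: "cs \<noteq> [] \<Longrightarrow> hd cs \<noteq> 0 \<Longrightarrow> lead_coeff (Poly (rev cs)) = hd cs"
  by (simp add: degree_Poly_rev nth_default_def rev_nth hd_conv_nth)

lemma Poly_coeff_cases: "poly.coeff (Poly cs) i \<in> insert 0 (set cs)"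
  by (simp add: nth_default_def)

lemma list_lift: "set p \<subseteq> h ` A \<Longrightarrow> \<exists>cs. set cs \<subseteq> A \<and> map h cs = p"
proof (induction p)
  case (Cons a p)
  then obtain cs c where "set cs \<subseteq> A" "map h cs = p" "c \<in> A" "a = h c" by auto
  then show ?case by (intro exI[of _ "c # cs"]) auto
qed simp

context henselian_closure
begin

abbreviation "\<O> \<equiv> valuation_ring v"
abbreviation "VR \<equiv> \<Omega>\<lparr>carrier := \<O>\<rparr>"
abbreviation "\<mm> \<equiv> {x. 0 < v x}"
abbreviation "RR \<equiv> residue_ring v"
abbreviation "res x \<equiv> \<mm> +>\<^bsub>VR\<^esub> x"

lemma in_\<O>_iff: "x \<in> \<O> \<longleftrightarrow> 0 \<le> v x"
  by (simp add: valuation_ring_def)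

lemma VR_cring: "cring VR"
proof -
  interpret Om: field "\<Omega> :: 'a ring" by (rule field_from_type_algebra)
  have "subcring \<O> \<Omega>" by (rule Om.subcringI'[OF valuation_ring_subring])
  then show ?thesis by (rule Om.subcring_iff[THEN iffD1, rotated]) (simp add: ring_of_type_algebra_def)
qed

interpretation VR: cring VR by (rule VR_cring)

lemma VR_pow: "x [^]\<^bsub>VR\<^esub> (n::nat) = x ^ n"
  by (induction n) (simp_all add: mult.commute)

lemma VR_minus: "x \<in> \<O> \<Longrightarrow> \<ominus>\<^bsub>VR\<^esub> x = - x"
  by (rule VR.minus_equality) (auto simp: in_\<O>_iff)

lemma \<mm>_maximal: "maximalideal \<mm> VR"
proof (rule maximalidealI)
  show "ideal \<mm> VR"
  proof (rule idealI)
    show "ring VR" by (rule VR.ring_axioms)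
    show "subgroup \<mm> (add_monoid VR)"
    proof (rule VR.add.subgroupI)
      show "\<mm> \<subseteq> carrier VR" by (auto simp: in_\<O>_iff)
      show "\<mm> \<noteq> {}" by (auto intro: exI[of _ 0])
      show "\<ominus>\<^bsub>VR\<^esub> a \<in> \<mm>" if "a \<in> \<mm>" for a using that VR_minus[of a] by (simp add: in_\<O>_iff)
      show "a \<oplus>\<^bsub>VR\<^esub> b \<in> \<mm>" if "a \<in> \<mm>" "b \<in> \<mm>" for a b using that by (auto intro: v.add_gt)
    qed
    show "x \<otimes>\<^bsub>VR\<^esub> a \<in> \<mm>" "a \<otimes>\<^bsub>VR\<^esub> x \<in> \<mm>" if "a \<in> \<mm>" "x \<in> carrier VR" for a x
      using that vinf_add_strict_mono[of 0 "v a" 0 "v x"] by (auto simp: v.mult in_\<O>_iff add.commute)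
  qed
  show "carrier VR \<noteq> \<mm>" using v.one by (auto simp: in_\<O>_iff set_eq_iff intro!: exI[of _ 1])
  fix J assume J: "ideal J VR" "\<mm> \<subseteq> J" "J \<subseteq> carrier VR"
  show "J = \<mm> \<or> J = carrier VR"
  proof (cases "J \<subseteq> \<mm>")
    case False
    then obtain u where u: "u \<in> J" "\<not> 0 < v u" by blast
    then have "v u = 0" using J(3) by (auto simp: in_\<O>_iff)
    then have "u \<noteq> 0" by auto
    then have "v (inverse u) + v u = 0" by (simp flip: v.mult)
    then have "inverse u \<in> carrier VR" using \<open>v u = 0\<close> by (simp add: in_\<O>_iff)
    then have "u \<otimes>\<^bsub>VR\<^esub> inverse u \<in> J" by (rule ideal.I_r_closed[OF J(1) u(1)])
    then have "\<one>\<^bsub>VR\<^esub> \<in> J" using \<open>u \<noteq> 0\<close> by simp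
    then show ?thesis using ideal.one_imp_carrier[OF J(1)] by blast
  qed (use J in blast)
qed

lemma RR_field: "field RR"
  unfolding residue_ring_def by (rule maximalideal.quotient_is_field[OF \<mm>_maximal VR_cring])

interpretation RR: field RR by (rule RR_field)

lemma \<mm>_ideal: "ideal \<mm> VR"
  using \<mm>_maximal maximalideal.axioms(1) by blast

lemma res_hom: "ring_hom_ring VR RR (\<lambda>x. res x)"
  unfolding residue_ring_def by (rule ideal.rcos_ring_hom_ring[OF \<mm>_ideal])

interpretation res: ring_hom_ring VR RR "\<lambda>x. res x" by (rule res_hom)

lemma res_carrier: "x \<in> \<O> \<Longrightarrow> res x \<in> carrier RR"
  using res.hom_closed by simp

lemma carrier_RR: "carrier RR = (\<lambda>x. res x) ` \<O>"
  unfolding residue_ring_def by (auto simp: FactRing_def A_RCOSETS_def')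

lemma res_eq_zero_iff: "x \<in> \<O> \<Longrightarrow> res x = \<zero>\<^bsub>RR\<^esub> \<longleftrightarrow> 0 < v x"
proof -
  assume x: "x \<in> \<O>"
  have z: "\<zero>\<^bsub>RR\<^esub> = \<mm>" by (simp add: residue_ring_def FactRing_def)
  show ?thesis
  proof
    assume "res x = \<zero>\<^bsub>RR\<^esub>"
    then have "x \<in> \<mm>" using x by (intro ideal.rcos_const_imp_mem[OF \<mm>_ideal]) (simp_all add: z)
    then show "0 < v x" by simp
  next
    assume "0 < v x"
    then show "res x = \<zero>\<^bsub>RR\<^esub>"
      unfolding z by (intro abelian_subgroup.a_rcos_const abelian_subgroupI3)
        (auto intro: ideal.axioms(1)[OF \<mm>_ideal] VR.abelian_group_axioms)
  qed
qed

lemma res_diff: "x \<in> \<O> \<Longrightarrow> y \<in> \<O> \<Longrightarrow> res (x - y) = res x \<ominus>\<^bsub>RR\<^esub> res y"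
  using res.hom_add[of x "- y"] res.hom_a_inv[of y] VR_minus[of y]
  by (simp add: a_minus_def in_\<O>_iff)

lemma res_eq_iff: "x \<in> \<O> \<Longrightarrow> y \<in> \<O> \<Longrightarrow> res x = res y \<longleftrightarrow> 0 < v (x - y)"
  using res_eq_zero_iff[of "x - y"] res_diff[of x y] res_carrier
  by (metis RR.r_right_minus_eq in_\<O>_iff v.diff_ge)

lemma VR_eval: "VR.eval cs x = poly (Poly (rev cs)) x"
  by (induction cs) (simp_all add: Poly_snoc poly_monom VR_pow add.commute)

lemma res_eval:
  "set cs \<subseteq> \<O> \<Longrightarrow> x \<in> \<O> \<Longrightarrow> RR.eval (map (\<lambda>x. res x) cs) (res x) = res (poly (Poly (rev cs)) x)"
  using res.eval_hom'[of x cs] VR_eval by simp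

text \<open>Lift the coefficients. The leading one lifts to a unit; after division by it the
  polynomial is monic and integral, so a root in the closure is integral and its residue is a
  root.\<close>

sublocale RR: closed_field RR
proof
  fix p assume p: "p \<in> carrier (poly_ring RR)" "0 < length p - 1"
  then have p': "p \<noteq> []" "set p \<subseteq> carrier RR" "hd p \<noteq> \<zero>\<^bsub>RR\<^esub>"
    unfolding univ_poly_carrier[symmetric] polynomial_def by auto
  then obtain cs where cs: "set cs \<subseteq> \<O>" "map (\<lambda>x. res x) cs = p"
    using list_lift unfolding carrier_RR by metis
  then have ne: "cs \<noteq> []" "length cs = length p" using p' by auto
  define c where "c = hd cs"
  have cO: "c \<in> \<O>" using cs ne by (auto simp: c_def)
  have "res c \<noteq> \<zero>\<^bsub>RR\<^esub>" using p'(3) cs ne by (auto simp: c_def hd_map)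
  then have vc: "v c = 0" using cO res_eq_zero_iff by (auto simp: in_\<O>_iff)
  then have c0: "c \<noteq> 0" by auto
  let ?P = "Poly (rev cs)"
  have deg: "degree ?P = length p - 1" "lead_coeff ?P = c"
    using degree_Poly_rev[of cs] lead_coeff_Poly_rev[of cs] ne c0 by (auto simp: c_def)
  then obtain z where z: "poly ?P z = 0" using alg_closed_imp_poly_has_root[of ?P] p(2) by auto
  have "poly (smult (inverse c) ?P) z = 0" using z by simp
  then obtain Q where Q: "smult (inverse c) ?P = [:- z, 1:] * Q" by (metis dvdE poly_eq_0_iff_dvd)
  have "0 \<le> v (poly.coeff (smult (inverse c) ?P) i)" for i
  proof -
    have "poly.coeff ?P i \<in> insert 0 (set (rev cs))" by (rule Poly_coeff_cases)
    then have ge: "0 \<le> v (poly.coeff ?P i)" using cs(1) by (auto simp: in_\<O>_iff)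
    have "v (inverse c) + v c = 0" using c0 by (simp flip: v.mult)
    then have "v (inverse c) = 0" using vc by simp
    then show ?thesis using ge by (simp add: v.mult del: coeff_Poly_eq)
  qed
  moreover have "lead_coeff (smult (inverse c) ?P) = 1" using deg c0 by simp
  ultimately have "z \<in> \<O>" using linear_quotient_integral(1)[OF Q] by (simp add: in_\<O>_iff)
  then have "RR.is_root p (res z)"
    using res_eval[OF cs(1)] z cs(2) p'(1) res_carrier res.hom_zero unfolding RR.is_root_def by simp
  then show "\<exists>x. RR.is_root p x" by blast
qed

lemma res_inverse: "x \<in> \<O> \<Longrightarrow> res x \<noteq> \<zero>\<^bsub>RR\<^esub> \<Longrightarrow> inverse x \<in> \<O> \<and> inv\<^bsub>RR\<^esub> (res x) = res (inverse x)"
proof -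
  assume x: "x \<in> \<O>" "res x \<noteq> \<zero>\<^bsub>RR\<^esub>"
  then have vx: "v x = 0" using res_eq_zero_iff by (auto simp: in_\<O>_iff)
  then have "x \<noteq> 0" by auto
  then have "v (inverse x) + v x = 0" by (simp flip: v.mult)
  then have i: "inverse x \<in> \<O>" using vx by (simp add: in_\<O>_iff)
  then have "res x \<otimes>\<^bsub>RR\<^esub> res (inverse x) = \<one>\<^bsub>RR\<^esub>"
    using res.hom_mult[of x "inverse x"] res.hom_one x \<open>x \<noteq> 0\<close> by simp
  then show ?thesis using i RR.comm_inv_char[OF res_carrier[OF x(1)] res_carrier[OF i]] by blast
qed

lemma residue_field_eq: "residue_field v L = (\<lambda>x. res x) ` (L \<inter> \<O>)"
  by (simp add: residue_field_def)

lemma residue_subfield: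
  assumes L: "subring L \<Omega>" "\<And>x. x \<in> L \<Longrightarrow> inverse x \<in> L"
  shows "subfield (residue_field v L) RR"
proof (rule RR.subfieldI')
  have "subring (L \<inter> \<O>) VR"
    by (rule VR.subringI)
      (use L valuation_ring_subring VR_minus in \<open>auto simp: subring_closure_iff\<close>)
  then show "subring (residue_field v L) RR"
    unfolding residue_field_eq by (rule res.img_is_subring)
  fix k assume "k \<in> residue_field v L - {\<zero>\<^bsub>RR\<^esub>}"
  then obtain x where "x \<in> L" "x \<in> \<O>" "k = res x" "res x \<noteq> \<zero>\<^bsub>RR\<^esub>" unfolding residue_field_eq by auto
  then show "inv\<^bsub>RR\<^esub> k \<in> residue_field v L"
    using res_inverse[of x] L(2) unfolding residue_field_eq by auto
qed

abbreviation "F \<equiv> residue_field v (range \<iota>)"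

lemma base_subring: "subring (range \<iota>) \<Omega>" and base_inverse: "x \<in> range \<iota> \<Longrightarrow> inverse x \<in> range \<iota>"
proof -
  show "subring (range \<iota>) \<Omega>"
    unfolding subring_closure_iff
    by (auto simp flip: \<iota>_simps(1,2) \<iota>_minus intro: range_eqI[of _ _ 1])
  show "x \<in> range \<iota> \<Longrightarrow> inverse x \<in> range \<iota>" by (auto simp flip: \<iota>_inverse)
qed

lemma base_residue_subfield: "subfield F RR"
  by (rule residue_subfield[OF base_subring base_inverse])

text \<open>Divide f by a coefficient c of least value: the result is integral with one coefficient
  equal to 1. If f(\<eta>) had a larger value than c, its reduction would be a nonzero polynomial
  over Kv vanishing at the residue of \<eta>, of degree too small for the minimal
  polynomial.\<close>

lemma residually_independent:
  assumes \<eta>: "\<eta> \<in> \<O>" "RR.algebraic F (res \<eta>)"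
    and f: "degree f < length (RR.Irr F (res \<eta>)) - 1"
  shows "v (poly (emb f) \<eta>) \<le> v (\<iota> (poly.coeff f i))"
proof (rule ccontr)
  assume *: "\<not> ?thesis"
  obtain j where j: "mon 0 0 f = v (\<iota> (poly.coeff f j))" using mon_0_0_attained by blast
  define c where "c = poly.coeff f j"
  have gt: "v (\<iota> c) < v (poly (emb f) \<eta>)" using * j mon_0_0_le_coeff[of f i] by (auto simp: c_def)
  then have c0: "c \<noteq> 0" by auto
  define g where "g = smult (inverse c) f"
  have inv: "v (inverse (\<iota> c)) + v (\<iota> c) = 0" using c0 by (simp flip: v.mult)
  then have fin: "v (inverse (\<iota> c)) \<noteq> \<infinity>" by auto
  have eg: "emb g = smult (inverse (\<iota> c)) (emb f)"
    by (rule poly_eqI) (simp add: g_def coeff_map_poly)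
  have integral: "0 \<le> v (\<iota> (poly.coeff g k))" for k
  proof -
    have "v (\<iota> c) \<le> v (\<iota> (poly.coeff f k))" using mon_0_0_le_coeff[of f k] j by (simp add: c_def)
    then have "v (inverse (\<iota> c)) + v (\<iota> c) \<le> v (inverse (\<iota> c)) + v (\<iota> (poly.coeff f k))" by (rule add_left_mono)
    then show ?thesis using inv by (simp add: g_def v.mult)
  qed
  have "v (inverse (\<iota> c)) + v (\<iota> c) < v (inverse (\<iota> c)) + v (poly (emb f) \<eta>)"
    using gt fin by simp
  then have pos: "0 < v (poly (emb g) \<eta>)" using inv by (simp add: eg v.mult)
  define cs where "cs = rev (coeffs (emb g))"
  have "g \<noteq> 0" using c0 by (auto simp: g_def c_def)
  then have len: "length cs = Suc (degree f)" using c0 by (simp add: cs_def length_coeffs g_def)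
  have set: "set cs \<subseteq> range \<iota> \<inter> \<O>"
    using integral by (auto simp: cs_def coeffs_def coeff_map_poly in_\<O>_iff)
  define p where "p = map (\<lambda>x. res x) cs"
  have pF: "set p \<subseteq> F" using set by (auto simp: p_def residue_field_eq)
  have FR: "F \<subseteq> carrier RR" using subfieldE(3)[OF base_residue_subfield] .
  have "RR.eval p (res \<eta>) = res (poly (emb g) \<eta>)"
    unfolding p_def using res_eval[of cs \<eta>] set \<eta>(1) by (simp add: cs_def)
  also have "\<dots> = \<zero>\<^bsub>RR\<^esub>" using pos by (intro res_eq_zero_iff[THEN iffD2]) (auto simp: in_\<O>_iff)
  finally have "RR.eval (RR.normalize p) (res \<eta>) = \<zero>\<^bsub>RR\<^esub>"
    using pF FR res_carrier[OF \<eta>(1)] by (subst RR.eval_normalize) auto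
  moreover have carr: "RR.normalize p \<in> carrier (F[X]\<^bsub>RR\<^esub>)"
    unfolding univ_poly_carrier[symmetric] by (rule RR.normalize_gives_polynomial[OF pF])
  ultimately have div: "RR.Irr F (res \<eta>) pdivides\<^bsub>RR\<^esub> RR.normalize p"
    using \<eta>(2) by (intro RR.Irr_minimal base_residue_subfield res_carrier \<eta>(1)) (auto simp: over_def)
  have "RR.normalize p \<noteq> []"
  proof
    assume "RR.normalize p = []"
    then have "RR.coeff p = (\<lambda>_. \<zero>\<^bsub>RR\<^esub>)" using RR.normalize_coeff[of p] by simp
    then have "set p \<subseteq> {\<zero>\<^bsub>RR\<^esub>}" using RR.coeff_img_restrict[of p] by auto
    moreover have "poly.coeff (emb g) j = 1" using c0 by (simp add: coeff_map_poly g_def c_def)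
    then have "1 \<in> set cs"
      unfolding cs_def set_rev by (metis coeff_in_coeffs zero_neq_one le_degree degree_emb emb_eq_0_iff \<open>g \<noteq> 0\<close>)
    then have "res 1 \<in> set p" by (auto simp: p_def)
    ultimately show False using res.hom_one by auto
  qed
  then have "length (RR.Irr F (res \<eta>)) - 1 \<le> length (RR.normalize p) - 1"
    using RR.pdivides_imp_degree_le[OF RR.carrier_is_subring _ _ _ div]
      RR.IrrE(1)[OF base_residue_subfield res_carrier[OF \<eta>(1)]] \<eta>(2) carr
      RR.carrier_polynomial_shell[OF subfieldE(1)[OF base_residue_subfield]] by (auto simp: over_def)
  also have "\<dots> \<le> length p - 1" using RR.normalize_length_le[of p] by simp
  finally show False using f len by (simp add: p_def)
qed

text \<open>Reduction to a list with the leading coefficient first. No normalization takes place: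
  for a monic integral P the head is already one.\<close>

definition red :: "'a poly \<Rightarrow> 'a set list" where
  "red P = map (\<lambda>x. res x) (rev (coeffs P))"

lemma red_coeff: "RR.coeff (red P) i = res (poly.coeff P i)"
proof (cases "i < length (coeffs P)")
  case True
  then have "RR.coeff (red P) i = res (coeffs P ! i)"
    by (subst RR.coeff_nth) (auto simp: red_def rev_nth)
  moreover have "P \<noteq> 0" using True by auto
  ultimately show ?thesis using True coeffs_nth[of P i] by (simp add: length_coeffs)
next
  case False
  then have "poly.coeff P i = 0" by (metis coeff_eq_0 length_coeffs Suc_eq_plus1 coeff_0 linorder_not_less less_Suc_eq_le)
  then show ?thesis using False RR.coeff_length[of "red P" i] res.hom_zero by (simp add: red_def)
qed

lemma red_in:
  assumes "lead_coeff P = 1" "\<And>i. 0 \<le> v (poly.coeff P i)"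
  shows "polynomial\<^bsub>RR\<^esub> (carrier RR) (red P)" "hd (red P) = \<one>\<^bsub>RR\<^esub>" "red P \<noteq> []"
proof -
  have "P \<noteq> 0" using assms(1) by auto
  then have ne: "coeffs P \<noteq> []" by simp
  then show "red P \<noteq> []" by (simp add: red_def)
  have "hd (rev (coeffs P)) = 1" using ne assms(1) \<open>P \<noteq> 0\<close> by (simp add: hd_rev last_coeffs_eq_coeff_degree)
  then show hd: "hd (red P) = \<one>\<^bsub>RR\<^esub>" using ne res.hom_one by (simp add: red_def hd_map)
  have "set (coeffs P) \<subseteq> \<O>" using assms(2) by (auto simp: coeffs_def in_\<O>_iff)
  then show "polynomial\<^bsub>RR\<^esub> (carrier RR) (red P)"
    unfolding polynomial_def using hd res_carrier by (auto simp: red_def)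
qed

lemma res_sum: "(\<And>k::nat. 0 \<le> v (f k)) \<Longrightarrow> res (\<Sum>k\<le>n. f k) = (\<Oplus>\<^bsub>RR\<^esub>k\<in>{..n}. res (f k))"
proof (induction n)
  case 0
  then show ?case using res_carrier by (simp add: in_\<O>_iff)
next
  case (Suc n)
  have "(\<Sum>k\<le>n. f k) \<in> \<O>" "f (Suc n) \<in> \<O>" using Suc.prems by (auto simp: in_\<O>_iff intro: v.sum_ge)
  then have "res (f (Suc n) + (\<Sum>k\<le>n. f k)) = res (f (Suc n)) \<oplus>\<^bsub>RR\<^esub> res (\<Sum>k\<le>n. f k)"
    using res.hom_add by simp
  then show ?case using Suc res_carrier by (simp add: in_\<O>_iff add.commute)
qed

lemma red_mult:
  assumes P: "lead_coeff P = 1" "\<And>i. 0 \<le> v (poly.coeff P i)"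
    and Q: "lead_coeff Q = 1" "\<And>i. 0 \<le> v (poly.coeff Q i)"
  shows "red (P * Q) = red P \<otimes>\<^bsub>poly_ring RR\<^esub> red Q"
proof -
  have int: "0 \<le> v (poly.coeff P k * poly.coeff Q l)" for k l
    using add_mono[OF P(2) Q(2)] by (simp add: v.mult)
  have "lead_coeff (P * Q) = 1" unfolding lead_coeff_mult using P Q by simp
  moreover have "0 \<le> v (poly.coeff (P * Q) i)" for i
    unfolding coeff_mult using int by (intro v.sum_ge) auto
  ultimately have PQ: "lead_coeff (P * Q) = 1" "\<And>i. 0 \<le> v (poly.coeff (P * Q) i)" by blast+
  have pp: "polynomial\<^bsub>RR\<^esub> (carrier RR) (RR.poly_mult (red P) (red Q))"
    by (rule RR.poly_mult_closed[OF RR.carrier_is_subring red_in(1)[OF P] red_in(1)[OF Q]])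
  have set: "set (red P) \<subseteq> carrier RR" "set (red Q) \<subseteq> carrier RR"
    using red_in(1)[OF P] red_in(1)[OF Q] by (auto intro: RR.polynomial_in_carrier[OF RR.carrier_is_subring, THEN subsetD])
  have "RR.coeff (red (P * Q)) = RR.coeff (RR.poly_mult (red P) (red Q))"
  proof
    fix i
    have "RR.coeff (RR.poly_mult (red P) (red Q)) i = (\<Oplus>\<^bsub>RR\<^esub>k\<in>{..i}. res (poly.coeff P k) \<otimes>\<^bsub>RR\<^esub> res (poly.coeff Q (i - k)))"
      by (simp add: RR.poly_mult_coeff[OF set] red_coeff)
    also have "\<dots> = (\<Oplus>\<^bsub>RR\<^esub>k\<in>{..i}. res (poly.coeff P k * poly.coeff Q (i - k)))"
      using P(2) Q(2) res.hom_mult int res_carrier by (intro RR.finsum_cong') (auto simp: in_\<O>_iff)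
    also have "\<dots> = res (poly.coeff (P * Q) i)" using int by (simp add: res_sum coeff_mult)
    finally show "RR.coeff (red (P * Q)) i = RR.coeff (RR.poly_mult (red P) (red Q)) i" by (simp add: red_coeff)
  qed
  then show ?thesis
    using RR.coeff_iff_polynomial_cond[OF red_in(1)[OF PQ] pp] by (simp add: univ_poly_mult)
qed

text \<open>If Q(a) had positive value, the residue of a would be a root of the reduction of Q, and
  the reduction of P would contain the same linear factor twice.\<close>

lemma red_simple_root:
  assumes P: "lead_coeff P = 1" "\<And>i. 0 \<le> v (poly.coeff P i)"
    and sep: "\<And>b. b \<in> carrier RR \<Longrightarrow> RR.alg_mult (red P) b \<le> 1"
    and PQ: "P = [:- a, 1:] * Q"
  shows "v (poly Q a) = 0"
proof (rule ccontr)
  assume nz: "v (poly Q a) \<noteq> 0"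
  have a: "a \<in> \<O>" and Q: "\<And>i. 0 \<le> v (poly.coeff Q i)"
    using linear_quotient_integral[OF PQ P(2,1)] by (auto simp: in_\<O>_iff)
  have lQ: "lead_coeff Q = 1" using P(1) PQ by (simp add: lead_coeff_mult del: mult_pCons_left)
  have "0 \<le> v (poly Q a)" using Q a by (intro poly_value_ge) (auto simp: in_\<O>_iff)
  then have pos: "0 < v (poly Q a)" using nz by simp
  have lin: "0 \<le> v (poly.coeff [:- a, 1:] i)" for i using a by (auto simp: coeff_pCons in_\<O>_iff split: nat.split)
  interpret PR: domain "poly_ring RR" by (rule RR.univ_poly_is_domain[OF RR.carrier_is_subring])
  have redlin: "red [:- a, 1:] = [\<one>\<^bsub>RR\<^esub>, \<ominus>\<^bsub>RR\<^esub> res a]"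
    using res.hom_one res.hom_a_inv[of a] VR_minus[OF a] a by (simp add: red_def)
  let ?l = "[\<one>\<^bsub>RR\<^esub>, \<ominus>\<^bsub>RR\<^esub> res a]"
  have l: "?l \<in> carrier (poly_ring RR)"
    using red_in(1)[of "[:- a, 1:]"] lin unfolding redlin univ_poly_carrier by simp
  have q: "red Q \<in> carrier (poly_ring RR)" "red Q \<noteq> []"
    using red_in[OF lQ Q] unfolding univ_poly_carrier by auto
  have "set (rev (coeffs Q)) \<subseteq> \<O>" using Q by (auto simp: coeffs_def in_\<O>_iff)
  then have "RR.eval (red Q) (res a) = res (poly Q a)"
    using res_eval[of "rev (coeffs Q)" a] a by (simp add: red_def)
  also have "\<dots> = \<zero>\<^bsub>RR\<^esub>" using pos by (intro res_eq_zero_iff[THEN iffD2]) (auto simp: in_\<O>_iff)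
  finally have "RR.is_root (red Q) (res a)" using q res_carrier[OF a] unfolding RR.is_root_def by simp
  then obtain t where t: "t \<in> carrier (poly_ring RR)" "red Q = ?l \<otimes>\<^bsub>poly_ring RR\<^esub> t"
    using RR.is_root_imp_pdivides[OF q(1)] unfolding pdivides_def factor_def by blast
  have "red P = ?l \<otimes>\<^bsub>poly_ring RR\<^esub> red Q"
    unfolding PQ redlin[symmetric] using lin lQ Q by (intro red_mult) auto
  then have "red P = ?l [^]\<^bsub>poly_ring RR\<^esub> (2::nat) \<otimes>\<^bsub>poly_ring RR\<^esub> t"
    using l t by (simp add: numeral_2_eq_2 PR.m_assoc)
  then have "?l [^]\<^bsub>poly_ring RR\<^esub> (2::nat) pdivides\<^bsub>RR\<^esub> red P"
    using t unfolding pdivides_def factor_def by blast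
  then have "2 \<le> RR.alg_mult (red P) (res a)"
    using red_in[OF P] by (intro RR.alg_multE(2) res_carrier a) (auto simp: univ_poly_carrier)
  then show False using sep[OF res_carrier[OF a]] by simp
qed

lemma lift_polynomial:
  assumes l: "set l \<subseteq> F" "l \<noteq> []" "hd l = \<one>\<^bsub>RR\<^esub>"
  shows "\<exists>\<phi>. lead_coeff \<phi> = 1 \<and> degree \<phi> = length l - 1 \<and>
    (\<forall>i. 0 \<le> v (poly.coeff (emb \<phi>) i)) \<and> red (emb \<phi>) = l"
proof -
  have "set (tl l) \<subseteq> (\<lambda>k. res (\<iota> k)) ` {k. \<iota> k \<in> \<O>}"
    using l(1,2) list.set_sel(2)[of l] unfolding residue_field_eq by blast
  then obtain ks where ks: "set ks \<subseteq> {k. \<iota> k \<in> \<O>}" "map (\<lambda>k. res (\<iota> k)) ks = tl l"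
    using list_lift[of "tl l" "\<lambda>k. res (\<iota> k)" "{k. \<iota> k \<in> \<O>}"] by blast
  \<comment> \<open>The tail is lifted arbitrarily, but the leading coefficient is taken to be
    exactly 1, so that the lift is monic.\<close>
  let ?ks = "1 # ks"
  define \<phi> where "\<phi> = Poly (rev ?ks)"
  have cf: "coeffs \<phi> = rev ?ks" unfolding \<phi>_def by (rule coeffs_Poly_rev) auto
  have lc: "lead_coeff \<phi> = 1" unfolding \<phi>_def using lead_coeff_Poly_rev[of ?ks] by simp
  have "coeffs (emb \<phi>) = map \<iota> (coeffs \<phi>)" using lc by (intro coeffs_map_poly') simp
  then have "red (emb \<phi>) = res 1 # map (\<lambda>k. res (\<iota> k)) ks" unfolding red_def cf by (simp add: rev_map)
  then have "red (emb \<phi>) = l" using ks(2) hd_Cons_tl[OF l(2)] l(3) res.hom_one by simp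
  moreover have "degree \<phi> = length l - 1"
    using degree_Poly_rev[of ?ks] arg_cong[OF ks(2), of length] by (simp add: \<phi>_def del: rev.simps)
  moreover have "0 \<le> v (poly.coeff (emb \<phi>) i)" for i
  proof -
    have "poly.coeff \<phi> i \<in> insert 0 (set (rev ?ks))" unfolding \<phi>_def by (rule Poly_coeff_cases)
    then show ?thesis using ks(1) by (auto simp: coeff_map_poly in_\<O>_iff)
  qed
  ultimately show ?thesis using lc by blast
qed

end


section \<open>Generators and dimensions\<close>

context henselian_closure
begin

interpretation Om: field "\<Omega> :: 'a ring" by (rule field_from_type_algebra)
interpretation RR: field RR by (rule RR_field)

lemma Om_pow: "x [^]\<^bsub>\<Omega>\<^esub> (n::nat) = x ^ n" for x :: 'a
  by (induction n) (simp_all add: mult.commute)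

lemma Om_inv: "x \<noteq> 0 \<Longrightarrow> inv\<^bsub>\<Omega>\<^esub> x = inverse x" for x :: 'a
  by (rule Om.comm_inv_char) auto

lemma Om_eval: "Om.eval cs x = poly (Poly (rev cs)) x" for x :: 'a
  by (induction cs) (simp_all add: Poly_snoc poly_monom Om_pow add.commute)

lemma subfield_\<Omega>I: "subring L \<Omega> \<Longrightarrow> (\<And>x. x \<in> L \<Longrightarrow> inverse x \<in> L) \<Longrightarrow> subfield L \<Omega>" for L :: "'a set"
  by (rule Om.subfieldI') (auto simp: Om_inv)

lemma subfield_inverse: "subfield L \<Omega> \<Longrightarrow> x \<in> L \<Longrightarrow> inverse x \<in> L" for L :: "'a set"
  using Om.subfield_m_inv(1)[of L x] subring_zero[OF subfieldE(1), of L] by (cases "x = 0") (auto simp: Om_inv)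

lemma base_subfield: "subfield (range \<iota>) \<Omega>"
  by (rule subfield_\<Omega>I[OF base_subring base_inverse])

lemma emb_Poly: "emb (Poly xs) = Poly (map \<iota> xs)"
  by (rule poly_eqI) (simp add: coeff_map_poly nth_default_map_eq)

lemma poly_mem_subring:
  assumes "subring L \<Omega>" "p \<in> polys_over L" "x \<in> L"
  shows "poly p x \<in> L"
  using assms(2)
proof (induction p)
  case (pCons a p)
  then have "a \<in> L" "p \<in> polys_over L" using polys_over_pCons[OF subring_zero[OF assms(1)]] by auto
  then show ?case using pCons by (auto intro: subring_add[OF assms(1)] subring_mult[OF assms(1)] assms(3))
qed (simp add: subring_zero[OF assms(1)])

lemma powers_independent:
  assumes nz: "\<And>f. f \<noteq> 0 \<Longrightarrow> degree f < d \<Longrightarrow> poly (emb f) \<zeta> \<noteq> 0"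
  shows "Om.independent (range \<iota>) (Om.exp_base \<zeta> d)"
proof (rule Om.trivial_combine_imp_independent[OF base_subfield])
  show "set (Om.exp_base \<zeta> d) \<subseteq> carrier \<Omega>" by simp
  fix Ks :: "'a list" assume Ks: "set Ks \<subseteq> range \<iota>" "Om.combine Ks (Om.exp_base \<zeta> d) = \<zero>\<^bsub>\<Omega>\<^esub>"
  have len: "length (Om.exp_base \<zeta> d) = d" by (simp add: Om.exp_base_def)
  \<comment> \<open>\<open>combine\<close> stops at the end of the shorter list. Cutting or padding
    Ks to length d makes it coincide with evaluation at \<zeta>.\<close>
  define Ms where "Ms = take d Ks @ replicate (d - length (take d Ks)) 0"
  have "set (take d Ks) \<subseteq> range \<iota>" using Ks(1) set_take_subset[of d Ks] by blast
  moreover have "set (replicate (d - length (take d Ks)) 0) \<subseteq> range \<iota>" by (auto intro: range_eqI[of _ _ 0])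
  ultimately have "set Ms \<subseteq> \<iota> ` UNIV" unfolding Ms_def by simp
  then obtain ks where ks: "map \<iota> ks = Ms" using list_lift by metis
  have lenM: "length Ms = d" by (simp add: Ms_def)
  have "Om.combine Ms (Om.exp_base \<zeta> d) = 0"
    using Ks(2) Om.combine_append_replicate[of "Om.exp_base \<zeta> d" "take d Ks"] Om.combine_take[of "Om.exp_base \<zeta> d" Ks] len
    by (simp add: Ms_def)
  then have "Om.eval Ms \<zeta> = 0" using Om.combine_eq_eval[of Ms \<zeta>] lenM by simp
  then have "poly (emb (Poly (rev ks))) \<zeta> = 0" by (simp add: Om_eval emb_Poly rev_map ks[symmetric])
  moreover have "degree (Poly (rev ks)) < d" if "Poly (rev ks) \<noteq> 0"
  proof (rule ccontr)
    assume "\<not> ?thesis"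
    then have "poly.coeff (Poly (rev ks)) (degree (Poly (rev ks))) = 0"
      using lenM ks by (auto simp: nth_default_def)
    then show False using that leading_coeff_0_iff by blast
  qed
  ultimately have "Poly (rev ks) = 0" using nz by blast
  then obtain m where "rev ks = replicate m 0" unfolding Poly_eq_0 by blast
  from arg_cong[OF this, of set] have "set ks \<subseteq> {0}" by auto
  then have "set Ms \<subseteq> {0}" unfolding ks[symmetric] by auto
  then show "set (take (length (Om.exp_base \<zeta> d)) Ks) \<subseteq> {\<zero>\<^bsub>\<Omega>\<^esub>}" by (simp add: len Ms_def)
qed

text \<open>As many independent powers as the dimension form a basis of L. Expanding the next power
  \<theta>^n gives the monic relation, and expanding an arbitrary element shows that it lies in
  K(\<theta>).\<close>

lemma full_degree_generates:
  assumes L: "subfield L \<Omega>" "range \<iota> \<subseteq> L" and dim: "Om.dimension n (range \<iota>) L" and n: "0 < n"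
    and \<theta>: "\<theta> \<in> L" and nz: "\<And>f. f \<noteq> 0 \<Longrightarrow> degree f < n \<Longrightarrow> poly (emb f) \<theta> \<noteq> 0"
  shows "\<exists>p. lead_coeff p = 1 \<and> degree p = n \<and> poly (emb p) \<theta> = 0" "L = adjoin \<iota> \<theta>"
proof -
  have LR: "subring L \<Omega>" using subfieldE(1)[OF L(1)] .
  have pow: "\<theta> ^ i \<in> L" for i by (induction i) (auto intro: subring_one[OF LR] subring_mult[OF LR] \<theta>)
  then have set: "set (Om.exp_base \<theta> n) \<subseteq> L" by (auto simp: Om.exp_base_def Om_pow)
  have "Om.independent (range \<iota>) (Om.exp_base \<theta> n)" by (rule powers_independent[OF nz])
  moreover have "length (Om.exp_base \<theta> n) = n" by (simp add: Om.exp_base_def)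
  ultimately have span: "Om.Span (range \<iota>) (Om.exp_base \<theta> n) = L"
    using Om.independent_length_eq_dimension[OF base_subfield dim _ set] by blast
  have ex: "\<exists>f. (\<forall>i\<ge>n. poly.coeff f i = 0) \<and> x = poly (emb f) \<theta>" if "x \<in> L" for x
  proof -
    have "x \<in> Om.Span (range \<iota>) (Om.exp_base \<theta> n)" using that span by simp
    then obtain Ks where Ks: "set Ks \<subseteq> range \<iota>" "length Ks = n" "x = Om.combine Ks (Om.exp_base \<theta> n)"
      by (subst (asm) Om.Span_mem_iff_length_version[OF base_subfield]) (auto simp: Om.exp_base_def)
    then obtain ks where ks: "map \<iota> ks = Ks" using list_lift[of Ks \<iota> UNIV] by auto
    have "x = poly (emb (Poly (rev ks))) \<theta>"
      using Ks(2,3) Om.combine_eq_eval[of Ks \<theta>] by (simp add: Om_eval emb_Poly rev_map ks[symmetric])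
    moreover have "poly.coeff (Poly (rev ks)) i = 0" if "n \<le> i" for i
      using Ks(2) ks that by (auto simp: nth_default_def)
    ultimately show ?thesis by blast
  qed
  obtain f where f: "\<And>i. i \<ge> n \<Longrightarrow> poly.coeff f i = 0" "\<theta> ^ n = poly (emb f) \<theta>"
    using ex[OF pow[of n]] by blast
  define p where "p = monom 1 n - f"
  have "poly.coeff p n = 1" "\<And>i. i > n \<Longrightarrow> poly.coeff p i = 0" using f(1) by (simp_all add: p_def)
  then have "degree p = n"
    using le_degree[of p n] degree_le[of n p] by (intro order_antisym) auto
  moreover have "emb (monom 1 n) = monom 1 n"
    by (rule poly_eqI) (simp add: coeff_map_poly)
  then have "poly (emb p) \<theta> = 0" using f(2) by (simp add: p_def poly_monom)
  ultimately show "\<exists>p. lead_coeff p = 1 \<and> degree p = n \<and> poly (emb p) \<theta> = 0"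
    using \<open>poly.coeff p n = 1\<close> by blast
  show "L = adjoin \<iota> \<theta>"
  proof
    show "adjoin \<iota> \<theta> \<subseteq> L"
      unfolding adjoin_def using L \<theta> by (intro Om.generate_field_min_subfield1) auto
    have A: "subring (adjoin \<iota> \<theta>) \<Omega>"
      unfolding adjoin_def by (intro subfieldE(1) Om.generate_field_is_subfield) simp
    have "insert \<theta> (range \<iota>) \<subseteq> adjoin \<iota> \<theta>" unfolding adjoin_def
      by (rule subsetI) (rule generate_field.incl)
    then have "poly (emb f) \<theta> \<in> adjoin \<iota> \<theta>" for f
      by (intro poly_mem_subring[OF A]) (auto simp: polys_over_def coeff_map_poly)
    then show "L \<subseteq> adjoin \<iota> \<theta>" using ex by blast
  qed
qed

lemma residual_root_exists:
  assumes L: "subfield L \<Omega>" "range \<iota> \<subseteq> L" and dim: "Om.dimension n (range \<iota>) L"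
    and sep: "separable_extension_in RR F (residue_field v L)"
  shows "\<exists>\<eta> \<phi> Q. \<eta> \<in> L \<and> residual_root \<iota> v \<eta> \<phi> Q \<and> degree \<phi> = inertia_degree v L (range \<iota>)"
proof -
  have LR: "subring L \<Omega>" and inv: "\<And>x. x \<in> L \<Longrightarrow> inverse x \<in> L"
    using subfieldE(1)[OF L(1)] subfield_inverse[OF L(1)] by auto
  let ?E = "residue_field v L"
  have E: "subfield ?E RR" "F \<subseteq> ?E" using residue_subfield[OF LR inv] L(2) by (auto simp: residue_field_eq)
  have F: "subfield F RR" by (rule base_residue_subfield)
  have alg: "RR.algebraic F a" and mult: "b \<in> carrier RR \<Longrightarrow> RR.alg_mult (RR.Irr F a) b \<le> 1" if "a \<in> ?E" for a b
    using sep that unfolding separable_extension_in_def by auto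
  \<comment> \<open>Residual independence makes the powers of a lift independent over K, so degrees
    over Kv are bounded by [L:K]. This supplies the bound required by the primitive element
    theorem.\<close>
  have bound: "length (RR.Irr F a) - 1 \<le> n" if "a \<in> ?E" for a
  proof -
    obtain \<zeta> where \<zeta>: "\<zeta> \<in> L" "\<zeta> \<in> \<O>" "a = res \<zeta>" using \<open>a \<in> ?E\<close> unfolding residue_field_eq by blast
    let ?d = "length (RR.Irr F a) - 1"
    have nz: "poly (emb f) \<zeta> \<noteq> 0" if "f \<noteq> 0" "degree f < ?d" for f
    proof
      assume "poly (emb f) \<zeta> = 0"
      then have "\<infinity> \<le> v (\<iota> (poly.coeff f i))" for i
        using residually_independent[OF \<zeta>(2), of f i] alg[OF \<open>a \<in> ?E\<close>] that(2) \<zeta>(3) by simp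
      then show False using that(1) by (simp add: poly_eq_iff)
    qed
    have "\<zeta> ^ i \<in> L" for i by (induction i) (auto intro: subring_one[OF LR] subring_mult[OF LR] \<zeta>(1))
    then have "set (Om.exp_base \<zeta> ?d) \<subseteq> L" by (auto simp: Om.exp_base_def Om_pow)
    from Om.independent_length_le_dimension[OF base_subfield dim powers_independent[OF nz] this]
    show ?thesis by (simp add: Om.exp_base_def)
  qed
  have "\<exists>\<zeta>\<in>?E. ?E = RR.simple_extension F \<zeta>"
    using alg mult bound by (intro RR.primitive_element[OF F E]) (auto simp: over_def)
  then obtain c where c: "c \<in> L" "c \<in> \<O>" and ext: "?E = RR.simple_extension F (res c)"
    unfolding residue_field_eq[of L] by auto
  have cE: "res c \<in> ?E" using c by (auto simp: residue_field_eq)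
  define l where "l = RR.Irr F (res c)"
  have algc: "(RR.algebraic over F) (res c)" using alg[OF cE] by (simp add: over_def)
  have l: "l \<in> carrier (F[X]\<^bsub>RR\<^esub>)" "pirreducible\<^bsub>RR\<^esub> F l" "hd l = \<one>\<^bsub>RR\<^esub>" "RR.eval l (res c) = \<zero>\<^bsub>RR\<^esub>"
    unfolding l_def by (rule RR.IrrE[OF F res_carrier[OF c(2)] algc])+
  have deg: "1 \<le> length l - 1" by (rule RR.pirreducible_degree[OF F l(1,2)])
  then have "l \<noteq> []" by auto
  moreover have "set l \<subseteq> F" using l(1) unfolding univ_poly_carrier[symmetric] polynomial_def by auto
  ultimately obtain \<phi> where \<phi>: "lead_coeff \<phi> = 1" "degree \<phi> = length l - 1"
    "\<And>i. 0 \<le> v (poly.coeff (emb \<phi>) i)" "red (emb \<phi>) = l"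
    using lift_polynomial l(3) by blast
  have lead: "lead_coeff (emb \<phi>) = 1" using \<phi>(1) by (simp add: coeff_map_poly)
  have simple: "v (poly Q a) = 0" if "emb \<phi> = [:- a, 1:] * Q" for a Q
    using mult[OF cE] \<phi>(4) by (intro red_simple_root[OF lead \<phi>(3) _ that]) (simp add: l_def)
  have "0 < v (poly (emb \<phi>) c)"
  proof -
    have "set (rev (coeffs (emb \<phi>))) \<subseteq> \<O>" using \<phi>(3) by (auto simp: coeffs_def in_\<O>_iff)
    then have "res (poly (emb \<phi>) c) = \<zero>\<^bsub>RR\<^esub>"
      using res_eval[of "rev (coeffs (emb \<phi>))" c] c(2) l(4) \<phi>(4) by (simp add: red_def)
    moreover have "poly (emb \<phi>) c \<in> \<O>"
      using \<phi>(3) c(2) unfolding in_\<O>_iff by (rule poly_value_ge)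
    ultimately show ?thesis using res_eq_zero_iff by blast
  qed
  moreover have "emb \<phi> \<in> polys_over L" using L(2) by (auto simp: polys_over_def coeff_map_poly)
  \<comment> \<open>Hensel's lemma is applied over L, which contains the approximate root c,
    although the coefficients of \<phi> lie in K. The root keeps the residue of c, so the degree of
    \<phi> is that of the residue extension.\<close>
  ultimately obtain \<eta> where \<eta>: "\<eta> \<in> L" "poly (emb \<phi>) \<eta> = 0" "0 < v (\<eta> - c)"
    using hensel_root[OF LR inv L(2) _ lead \<phi>(3) simple c(1)] by blast
  then obtain Q where Q: "emb \<phi> = [:- \<eta>, 1:] * Q" by (metis dvdE poly_eq_0_iff_dvd)
  have int: "0 \<le> v \<eta>" "\<And>i. 0 \<le> v (poly.coeff Q i)" using linear_quotient_integral[OF Q \<phi>(3) lead] by auto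
  then have \<eta>O: "\<eta> \<in> \<O>" by (simp add: in_\<O>_iff)
  then have res: "res \<eta> = res c" using res_eq_iff[OF _ c(2)] \<eta>(3) by blast
  have "residual_root \<iota> v \<eta> \<phi> Q"
  proof
    show "lead_coeff \<phi> = 1" "map_poly \<iota> \<phi> = [:- \<eta>, 1:] * Q" "v (poly Q \<eta>) = 0"
      using \<phi>(1) Q simple[OF Q] by auto
    show "0 < degree \<phi>" using \<phi>(2) deg by simp
    show "v (poly (map_poly \<iota> f) \<eta>) \<le> v (\<iota> (poly.coeff f i))" if "degree f < degree \<phi>" for f i
      using that \<phi>(2) alg[OF cE] by (intro residually_independent[OF \<eta>O]) (auto simp: res l_def)
  qed (use int in auto)
  moreover have "degree \<phi> = inertia_degree v L (range \<iota>)"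
    using RR.simple_extension_dim[OF F res_carrier[OF c(2)] algc] ext \<phi>(2)
    by (simp add: inertia_degree_def l_def over_def)
  ultimately show ?thesis using \<eta>(1) by blast
qed

end


section \<open>Cyclic value groups\<close>

lemma sum_const_neg: "0 < n \<Longrightarrow> a < 0 \<Longrightarrow> (\<Sum>i<n. a) < 0" for a :: "'g::linordered_ab_group_add" and n :: nat
proof (induction n)
  case (Suc n)
  then show ?case by (cases n) (auto intro: add_neg_neg)
qed simp

lemma (in valued_closure) value_group_closed:
  assumes L: "subring L \<Omega>" "\<And>x. x \<in> L \<Longrightarrow> inverse x \<in> L"
  shows "0 \<in> value_group v L" "a \<in> value_group v L \<Longrightarrow> b \<in> value_group v L \<Longrightarrow> a - b \<in> value_group v L"
proof -
  show "0 \<in> value_group v L"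
    using subring_one[OF L(1)] unfolding value_group_def by (auto intro!: bexI[of _ 1] simp: zero_vinf_def)
  assume "a \<in> value_group v L" "b \<in> value_group v L"
  then obtain x y where xy: "x \<in> L" "v x = Fin a" "y \<in> L" "v y = Fin b" unfolding value_group_def by auto
  then have "y \<noteq> 0" by auto
  then have "v (x * inverse y) + v y = v x" by (simp add: mult.assoc flip: v.mult)
  then have "v (x * inverse y) = Fin (a - b)" using xy by (cases "v (x * inverse y)") auto
  moreover have "x * inverse y \<in> L" using xy L by (auto intro: subring_mult)
  ultimately show "a - b \<in> value_group v L" unfolding value_group_def by blast
qed

lemma cyclic_quotient_generator:
  fixes A B :: "'g::linordered_ab_group_add set"
  assumes A: "0 \<in> A" "\<And>a b. a \<in> A \<Longrightarrow> b \<in> A \<Longrightarrow> a - b \<in> A"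
    and B: "0 \<in> B" "\<And>a b. a \<in> B \<Longrightarrow> b \<in> B \<Longrightarrow> a - b \<in> B" "B \<subseteq> A"
    and cyc: "cyclic_group (\<lparr>carrier = A, monoid.mult = (+), one = 0\<rparr> Mod B)"
    and e: "Coset.order (\<lparr>carrier = A, monoid.mult = (+), one = 0\<rparr> Mod B) = e" "1 < e"
  shows "\<exists>\<delta>\<in>A. 0 < \<delta> \<and> (\<forall>i. 0 < i \<longrightarrow> i < e \<longrightarrow> (\<Sum>j<i. \<delta>) \<notin> B)"
proof -
  let ?G = "\<lparr>carrier = A, monoid.mult = (+), one = 0\<rparr> :: 'g monoid"
  have neg: "- a \<in> A" if "a \<in> A" for a using A(2)[OF A(1) that] by simp
  have negB: "- a \<in> B" if "a \<in> B" for a using B(2)[OF B(1) that] by simp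
  have plus: "a + b \<in> A" if "a \<in> A" "b \<in> A" for a b using A(2)[OF that(1) neg[OF that(2)]] by simp
  have plusB: "a + b \<in> B" if "a \<in> B" "b \<in> B" for a b using B(2)[OF that(1) negB[OF that(2)]] by simp
  have nsumA: "(\<Sum>j<i. a) \<in> A" if "a \<in> A" for a and i :: nat by (induction i) (auto intro: A plus that)
  have nsumB: "(\<Sum>j<i. a) \<in> B" if "a \<in> B" for a and i :: nat by (induction i) (auto intro: B plusB that)
  interpret G: comm_group ?G
    by (rule comm_groupI) (auto simp: A plus ac_simps intro!: bexI[of _ "- _"] neg)
  have invG: "inv\<^bsub>?G\<^esub> a = - a" if "a \<in> A" for a
    using that neg by (intro G.inv_equality) auto
  have "subgroup B ?G" using B negB plusB invG by (intro G.subgroupI) auto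
  then interpret N: normal B ?G by (rule G.subgroup_imp_normal)
  let ?Q = "?G Mod B"
  interpret Q: group ?Q by (rule N.factorgroup_is_group)
  obtain x where x: "x \<in> carrier ?Q" "carrier ?Q = range (\<lambda>n::int. x [^]\<^bsub>?Q\<^esub> n)"
    using cyc Q.cyclic_group by blast
  obtain \<delta>\<^sub>0 where \<delta>\<^sub>0: "\<delta>\<^sub>0 \<in> A" "x = B #>\<^bsub>?G\<^esub> \<delta>\<^sub>0" using x(1) by (auto simp: carrier_FactGroup)
  have hom: "(\<lambda>a. B #>\<^bsub>?G\<^esub> a) \<in> hom ?G ?Q" by (rule N.r_coset_hom_Mod)
  have "Q.ord x = e"
    using Q.generate_pow_card[OF x(1)] Q.generate_pow[OF x(1)] x(2) e(1)
    by (simp add: Coset.order_def full_SetCompr_eq)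
  then have ord: "x [^]\<^bsub>?Q\<^esub> i = \<one>\<^bsub>?Q\<^esub> \<longleftrightarrow> e dvd i" for i :: nat using Q.pow_eq_id[OF x(1)] by simp
  have self: "B #>\<^bsub>?G\<^esub> 0 = B" using N.subset by (intro G.coset_join2) (auto simp: A B N.subgroup_axioms)
  have pow: "x [^]\<^bsub>?Q\<^esub> i = B #>\<^bsub>?G\<^esub> (\<Sum>j<i. \<delta>\<^sub>0)" for i :: nat
  proof (induction i)
    case 0
    then show ?case using self by simp
  next
    case (Suc i)
    then show ?case using hom_mult[OF hom, of "\<Sum>j<i. \<delta>\<^sub>0" \<delta>\<^sub>0] \<delta>\<^sub>0 nsumA by simp
  qed
  have mem: "(\<Sum>j<i. \<delta>\<^sub>0) \<in> B \<longleftrightarrow> e dvd i" for i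
  proof -
    have "(\<Sum>j<i. \<delta>\<^sub>0) \<in> B \<longleftrightarrow> B #>\<^bsub>?G\<^esub> (\<Sum>j<i. \<delta>\<^sub>0) = B"
      using G.coset_join1[OF _ _ N.subgroup_axioms, of "\<Sum>j<i. \<delta>\<^sub>0"]
        G.coset_join2[OF _ N.subgroup_axioms, of "\<Sum>j<i. \<delta>\<^sub>0"] nsumA[OF \<delta>\<^sub>0(1)] by auto
    also have "\<dots> \<longleftrightarrow> e dvd i" using ord[of i] pow[of i] by simp
    finally show ?thesis .
  qed
  have "\<delta>\<^sub>0 \<noteq> 0" using mem[of 1] B(1) e(2) by auto
  then consider "0 < \<delta>\<^sub>0" | "\<delta>\<^sub>0 < 0" by (meson neqE)
  then show ?thesis
  proof cases
    case 1
    then show ?thesis using \<delta>\<^sub>0 mem by (intro bexI[of _ \<delta>\<^sub>0]) (auto dest: dvd_imp_le)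
  next
    case 2
    \<comment> \<open>A negative generator is moved within its coset by its e-th multiple, which
      lies in B. The result is -(e - 1) times the generator and is positive because e > 1.\<close>
    define s where "s = (\<Sum>j<e. \<delta>\<^sub>0)"
    have s: "s \<in> B" using mem[of e] by (simp add: s_def)
    obtain k where k: "e = Suc k" "0 < k" using e(2) by (cases e) auto
    have "\<delta>\<^sub>0 - s = - (\<Sum>j<k. \<delta>\<^sub>0)" by (simp add: s_def k)
    then have "0 < \<delta>\<^sub>0 - s" using sum_const_neg[OF k(2) 2] by simp
    moreover have "(\<Sum>j<i. \<delta>\<^sub>0 - s) \<notin> B" if "0 < i" "i < e" for i
    proof
      assume "(\<Sum>j<i. \<delta>\<^sub>0 - s) \<in> B"
      then have "(\<Sum>j<i. \<delta>\<^sub>0 - s) + (\<Sum>j<i. s) \<in> B" using nsumB[OF s] plusB by blast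
      then have "(\<Sum>j<i. \<delta>\<^sub>0) \<in> B" by (simp add: sum_subtractf)
      then show False using mem that by (auto dest: dvd_imp_le)
    qed
    moreover have "\<delta>\<^sub>0 - s \<in> A" using A(2) \<delta>\<^sub>0(1) s B(3) by blast
    ultimately show ?thesis by blast
  qed
qed


theorem theorem3p1:
  fixes \<iota> :: "'k::field \<Rightarrow> 'a::alg_closed_field"
    and v :: "'a \<Rightarrow> 'g::linordered_ab_group_add vinf"
    and L :: "'a set"
  assumes "is_algebraic_closure \<iota>"
    and "is_valuation v"
    and "henselian \<iota> v"
    and "finite_simple_extension \<iota> L"
    and "defectless v L (range \<iota>)"
    and "cyclic_group (value_quotient v L (range \<iota>))"
    and "separable_extension_in (residue_ring v) (residue_field v (range \<iota>)) (residue_field v L)"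
  shows "extension_depth \<iota> v L \<le> 2"
proof -
  interpret henselian_closure \<iota> v
    using assms(1-3) by unfold_locales (auto simp: is_algebraic_closure_def)
  interpret Om: field "\<Omega> :: 'a ring" by (rule field_from_type_algebra)
  let ?K = "range \<iota>"
  obtain \<theta>\<^sub>0 where \<theta>\<^sub>0: "L = adjoin \<iota> \<theta>\<^sub>0" and fin: "Om.finite_dimension ?K L"
    using assms(4) unfolding finite_simple_extension_def by blast
  have L: "subfield L \<Omega>" "?K \<subseteq> L"
    unfolding \<theta>\<^sub>0 adjoin_def by (auto intro: Om.generate_field_is_subfield generate_field.incl)
  have LR: "subring L \<Omega>" using subfieldE(1)[OF L(1)] .
  define n e f where "n = Om.dim ?K L" and "e = ramification_index v L ?K" and "f = inertia_degree v L ?K"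
  have dim: "Om.dimension n ?K L"
    using Om.finite_dimensionE[OF base_subfield fin] by (simp add: n_def over_def)
  \<comment> \<open>A quotient by zero is 0, so defect 1 forces both e and f to be nonzero; an
    infinite ramification index would be recorded as 0.\<close>
  have "(of_nat n :: rat) / of_nat (e * f) = 1"
    using assms(5) unfolding defectless_def defect_def n_def e_def f_def .
  then have "(of_nat n :: rat) = of_nat (e * f)" "e * f \<noteq> 0"
    by (metis div_by_0 eq_divide_eq_1 of_nat_0 zero_neq_one)+
  then have nef: "n = e * f" "0 < n" "0 < e" "0 < f" by (simp_all only: of_nat_eq_iff) auto
  obtain \<eta> \<phi> Q where \<eta>: "\<eta> \<in> L" and rr: "residual_root \<iota> v \<eta> \<phi> Q" and deg: "degree \<phi> = f"
    using residual_root_exists[OF L dim assms(7)] unfolding f_def by blast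
  interpret residual_root \<iota> v \<eta> \<phi> Q by (rule rr)
  have "\<exists>\<theta>. L = adjoin \<iota> \<theta> \<and> depth \<iota> v \<theta> \<le> 2"
  proof (cases "e = 1")
    case True
    have nz: "poly (emb g) \<eta> \<noteq> 0" if "g \<noteq> 0" "degree g < n" for g
      using value_center[of g] that nef(1) True deg mon_infty_iff[of 0 0 g] by auto
    obtain p where "lead_coeff p = 1" "degree p = n" "poly (emb p) \<eta> = 0"
      using full_degree_generates(1)[OF L dim nef(2) \<eta> nz] by blast
    then have "depth \<iota> v \<eta> \<le> 1" using nef(1) True deg by (intro unramified_depth) auto
    then show ?thesis using full_degree_generates(2)[OF L dim nef(2) \<eta> nz] by fastforce
  next
    case False
    then have e1: "1 < e" using nef(3) by simp
    have "\<exists>\<delta>\<in>value_group v L. 0 < \<delta> \<and> (\<forall>i. 0 < i \<longrightarrow> i < e \<longrightarrow> (\<Sum>j<i. \<delta>) \<notin> value_group v ?K)"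
    proof (rule cyclic_quotient_generator)
      show "value_group v ?K \<subseteq> value_group v L" using L(2) by (auto simp: value_group_def)
      show "cyclic_group (\<lparr>carrier = value_group v L, monoid.mult = (+), one = 0\<rparr> Mod value_group v ?K)"
        "Coset.order (\<lparr>carrier = value_group v L, monoid.mult = (+), one = 0\<rparr> Mod value_group v ?K) = e"
        using assms(6) by (simp_all add: value_quotient_def e_def ramification_index_def)
    qed (use e1 value_group_closed[OF LR subfield_inverse[OF L(1)]] value_group_closed[OF base_subring base_inverse] in auto)
    then obtain \<delta> where \<delta>: "\<delta> \<in> value_group v L" "0 < \<delta>"
      "\<And>i. 0 < i \<Longrightarrow> i < e \<Longrightarrow> (\<Sum>j<i. \<delta>) \<notin> value_group v ?K" by blast
    then obtain \<pi> where \<pi>: "\<pi> \<in> L" "v \<pi> = Fin \<delta>" unfolding value_group_def by blast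
    let ?\<theta> = "\<eta> + \<pi>"
    have \<theta>: "?\<theta> \<in> L" using \<eta> \<pi> by (intro subring_add[OF LR])
    have nz: "poly (emb g) ?\<theta> \<noteq> 0" if "g \<noteq> 0" "degree g < n" for g
      using ramified_nonzero[OF \<delta>(2) \<pi>(2) refl nef(3) \<delta>(3)] that nef(1) deg by simp
    obtain p where "lead_coeff p = 1" "degree p = n" "poly (emb p) ?\<theta> = 0"
      using full_degree_generates(1)[OF L dim nef(2) \<theta> nz] by blast
    then have "depth \<iota> v ?\<theta> \<le> 2"
      using nef(1) deg by (intro ramified_depth[OF \<delta>(2) \<pi>(2) refl nef(3) \<delta>(3)] e1) auto
    then show ?thesis using full_degree_generates(2)[OF L dim nef(2) \<theta> nz] by blast
  qed
  then obtain \<theta> where "L = adjoin \<iota> \<theta>" "depth \<iota> v \<theta> \<le> 2" by blast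
  then show ?thesis
    unfolding extension_depth_def by (intro order_trans[OF Least_le[of _ "depth \<iota> v \<theta>"]]) auto
qed

end
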